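(* For every nonempty compact metric space $L$ and every prime $p$, there exist a compact group $G$, a compact metric space $X$ with $\dim_{\mathbb{Z}_p} X = 1$, and a continuous action of $G$ on $X$ such that the orbit space $X/G$ is homeomorphic to $L$.
   Context: Here $\mathbb{Z}_p$ denotes the cyclic group $\mathbb{Z}/p\mathbb{Z}$ (not the $p$-adic integers). For a compact metric space $X$, $\dim_{\mathbb{Z}_p} X$ denotes the cohomological dimension of $X$ with coefficients in $\mathbb{Z}_p$: the least integer $n\ge 0$ such that for every closed subset $A\subset X$ every continuous map $A\to K(\mathbb{Z}_p,n)$ to the Eilenberg--MacLane space extends to a continuous map $X\to K(\mathbb{Z}_p,n)$ (and $\infty$ if no such $n$ exists). In particular $\dim_{\mathbb{Z}_p}X\le 1$ if and only if for every closed $A\subset X$ the restriction map $H^1(X;\mathbb{Z}_p)\to H^1(A;\mathbb{Z}_p)$ in Čech cohomology is surjective. A compact group is a compact Hausdorff topological group; the orbit space $X/G$ carries the quotient topology. *)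

theory Defs
  imports
    "HOL-Analysis.Analysis"
    "HOL-Algebra.Elementary_Groups"
    "HOL-Algebra.Group_Action"
    "HOL-Library.Extended_Nat"
begin

section \<open>Homotopy groups of abstract topological spaces\<close>

text \<open>As in \<^const>\<open>nsphere\<close>, points of n-dimensional Euclidean space are sequences of reals
  vanishing from index n on.\<close>

definition unit_cube :: "nat \<Rightarrow> (nat \<Rightarrow> real) topology"
  where "unit_cube n = subtopology (Euclidean_space n) {x. \<forall>i<n. 0 \<le> x i \<and> x i \<le> 1}"

definition cube_boundary :: "nat \<Rightarrow> (nat \<Rightarrow> real) set"
  where "cube_boundary n = {x \<in> topspace (unit_cube n). \<exists>i<n. x i = 0 \<or> x i = 1}"

definition spheroid :: "nat \<Rightarrow> 'a topology \<Rightarrow> 'a \<Rightarrow> ((nat \<Rightarrow> real) \<Rightarrow> 'a) \<Rightarrow> bool"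
  where "spheroid n X b f \<longleftrightarrow>
    continuous_map (unit_cube n) X f \<and> (\<forall>x \<in> cube_boundary n. f x = b)"

definition spheroid_homotopic ::
    "nat \<Rightarrow> 'a topology \<Rightarrow> 'a \<Rightarrow> ((nat \<Rightarrow> real) \<Rightarrow> 'a) \<Rightarrow> ((nat \<Rightarrow> real) \<Rightarrow> 'a) \<Rightarrow> bool"
  where "spheroid_homotopic n X b = homotopic_with (\<lambda>h. \<forall>x \<in> cube_boundary n. h x = b) (unit_cube n) X"

definition spheroid_class ::
    "nat \<Rightarrow> 'a topology \<Rightarrow> 'a \<Rightarrow> ((nat \<Rightarrow> real) \<Rightarrow> 'a) \<Rightarrow> ((nat \<Rightarrow> real) \<Rightarrow> 'a) set"
  where "spheroid_class n X b f = {g. spheroid_homotopic n X b f g}"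

definition spheroid_concat ::
    "((nat \<Rightarrow> real) \<Rightarrow> 'a) \<Rightarrow> ((nat \<Rightarrow> real) \<Rightarrow> 'a) \<Rightarrow> (nat \<Rightarrow> real) \<Rightarrow> 'a"
  where "spheroid_concat f g x =
    (if x 0 \<le> 1/2 then f (x(0 := 2 * x 0)) else g (x(0 := 2 * x 0 - 1)))"

text \<open>The n-th homotopy group at base point b; meaningful for n at least 1 only.\<close>

definition homotopy_group ::
    "nat \<Rightarrow> 'a topology \<Rightarrow> 'a \<Rightarrow> ((nat \<Rightarrow> real) \<Rightarrow> 'a) set monoid"
  where "homotopy_group n X b =
    \<lparr>carrier = spheroid_class n X b ` {f. spheroid n X b f},
     monoid.mult = (\<lambda>\<alpha> \<beta>. {h. \<exists>f\<in>\<alpha>. \<exists>g\<in>\<beta>. spheroid_homotopic n X b (spheroid_concat f g) h}),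
     one = spheroid_class n X b (\<lambda>x. b)\<rparr>"


section \<open>CW complexes\<close>

definition closed_disc :: "nat \<Rightarrow> (nat \<Rightarrow> real) topology"
  where "closed_disc n = subtopology (Euclidean_space n) {x. (\<Sum>i<n. (x i)\<^sup>2) \<le> 1}"

definition open_disc :: "nat \<Rightarrow> (nat \<Rightarrow> real) set"
  where "open_disc n = {x \<in> topspace (Euclidean_space n). (\<Sum>i<n. (x i)\<^sup>2) < 1}"

definition disc_boundary :: "nat \<Rightarrow> (nat \<Rightarrow> real) set"
  where "disc_boundary n = {x \<in> topspace (Euclidean_space n). (\<Sum>i<n. (x i)\<^sup>2) = 1}"

text \<open>A cell structure is a set of pairs (n, f) of a dimension n and a characteristic map f
  of an n-cell.  Since X is Hausdorff, injectivity of f on the open disc, together with the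
  open cells being disjoint and the boundary being sent to cells of smaller dimension, makes f
  restrict to a homeomorphism from the open disc onto the open cell.\<close>

definition cw_structure :: "'a topology \<Rightarrow> (nat \<times> ((nat \<Rightarrow> real) \<Rightarrow> 'a)) set \<Rightarrow> bool"
  where "cw_structure X \<Phi> \<longleftrightarrow>
    Hausdorff_space X \<and>
    (\<forall>(n, f) \<in> \<Phi>. continuous_map (closed_disc n) X f \<and> inj_on f (open_disc n)) \<and>
    (\<forall>x \<in> topspace X. \<exists>!c. c \<in> \<Phi> \<and> x \<in> snd c ` open_disc (fst c)) \<and>
    (\<forall>(n, f) \<in> \<Phi>. \<exists>\<Psi> \<subseteq> \<Phi>. finite \<Psi> \<and> (\<forall>(m, g) \<in> \<Psi>. m < n) \<and>
       f ` disc_boundary n \<subseteq> (\<Union>(m, g) \<in> \<Psi>. g ` open_disc m)) \<and>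
    (\<forall>C \<subseteq> topspace X.
       (\<forall>(n, f) \<in> \<Phi>. closedin X (C \<inter> f ` topspace (closed_disc n))) \<longrightarrow> closedin X C)"

definition cw_complex :: "'a topology \<Rightarrow> bool"
  where "cw_complex X \<longleftrightarrow> (\<exists>\<Phi>. cw_structure X \<Phi>)"


section \<open>Eilenberg-MacLane spaces and cohomological dimension\<close>

definition eilenberg_maclane_space :: "('g, 'm) monoid_scheme \<Rightarrow> nat \<Rightarrow> 'a topology \<Rightarrow> bool"
  where "eilenberg_maclane_space G n K \<longleftrightarrow>
    cw_complex K \<and> topspace K \<noteq> {} \<and>
    (if n = 0 then \<exists>h. bij_betw h (path_components_of K) (carrier G)
     else path_connected_space K \<and> (\<forall>b \<in> topspace K. homotopy_group n K b \<cong> G)) \<and>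
    (\<forall>k \<ge> 1. k \<noteq> n \<longrightarrow>
       (\<forall>b \<in> topspace K. carrier (homotopy_group k K b) = {\<one>\<^bsub>homotopy_group k K b\<^esub>}))"

definition extends_all_maps :: "'a topology \<Rightarrow> 'b topology \<Rightarrow> bool"
  where "extends_all_maps X K \<longleftrightarrow>
    (\<forall>A f. closedin X A \<and> continuous_map (subtopology X A) K f \<longrightarrow>
       (\<exists>g. continuous_map X K g \<and> (\<forall>x \<in> A. g x = f x)))"

text \<open>K(G,n) is determined up to homotopy equivalence, and for compact metrizable X the property
  \<^term>\<open>extends_all_maps X K\<close> depends only on the homotopy type of the CW complex K (by the homotopy
  extension property).  Hence the choice of K(G,n) does not matter.  The type
  \<^typ>\<open>(nat \<Rightarrow> real) set\<close> is large enough to carry a K(G,n) for every countable G.\<close>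

definition cohomological_dim :: "('g, 'm) monoid_scheme \<Rightarrow> 'a topology \<Rightarrow> enat"
  where "cohomological_dim G X =
    Inf {enat n | n. \<exists>K :: (nat \<Rightarrow> real) set topology.
                       eilenberg_maclane_space G n K \<and> extends_all_maps X K}"


section \<open>Compact groups, continuous actions and orbit spaces\<close>

definition compact_group :: "('g, 'm) monoid_scheme \<Rightarrow> 'g topology \<Rightarrow> bool"
  where "compact_group G T \<longleftrightarrow>
    group G \<and> topspace T = carrier G \<and>
    continuous_map (prod_topology T T) T (\<lambda>(x, y). x \<otimes>\<^bsub>G\<^esub> y) \<and>
    continuous_map T T (\<lambda>x. inv\<^bsub>G\<^esub> x) \<and>
    compact_space T \<and> Hausdorff_space T"

definition continuous_action ::
    "('g, 'm) monoid_scheme \<Rightarrow> 'g topology \<Rightarrow> 'a topology \<Rightarrow> ('g \<Rightarrow> 'a \<Rightarrow> 'a) \<Rightarrow> bool"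
  where "continuous_action G T X \<phi> \<longleftrightarrow>
    group_action G (topspace X) \<phi> \<and>
    continuous_map (prod_topology T X) X (\<lambda>(g, x). \<phi> g x)"

definition orbit_space ::
    "('g, 'm) monoid_scheme \<Rightarrow> 'a topology \<Rightarrow> ('g \<Rightarrow> 'a \<Rightarrow> 'a) \<Rightarrow> 'a set topology"
  where "orbit_space G X \<phi> = topology (\<lambda>U. U \<subseteq> orbits G (topspace X) \<phi> \<and>
    openin X {x \<in> topspace X. orbit G \<phi> x \<in> U})"

lemma openin_orbit_space:
  "openin (orbit_space G X \<phi>) U \<longleftrightarrow>
     U \<subseteq> orbits G (topspace X) \<phi> \<and> openin X {x \<in> topspace X. orbit G \<phi> x \<in> U}"
proof -
  have "istopology (\<lambda>U. U \<subseteq> orbits G (topspace X) \<phi> \<and> openin X {x \<in> topspace X. orbit G \<phi> x \<in> U})"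
    unfolding istopology_def
  proof (intro conjI allI impI; (elim conjE)?)
    fix S T
    assume "openin X {x \<in> topspace X. orbit G \<phi> x \<in> S}" "openin X {x \<in> topspace X. orbit G \<phi> x \<in> T}"
    then have "openin X ({x \<in> topspace X. orbit G \<phi> x \<in> S} \<inter> {x \<in> topspace X. orbit G \<phi> x \<in> T})"
      by blast
    moreover have "{x \<in> topspace X. orbit G \<phi> x \<in> S} \<inter> {x \<in> topspace X. orbit G \<phi> x \<in> T}
        = {x \<in> topspace X. orbit G \<phi> x \<in> S \<inter> T}"
      by blast
    ultimately show "openin X {x \<in> topspace X. orbit G \<phi> x \<in> S \<inter> T}"
      by simp
  next
    fix \<K>
    assume "\<forall>K\<in>\<K>. K \<subseteq> orbits G (topspace X) \<phi> \<and> openin X {x \<in> topspace X. orbit G \<phi> x \<in> K}"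
    then have "openin X (\<Union>K\<in>\<K>. {x \<in> topspace X. orbit G \<phi> x \<in> K})"
      by blast
    moreover have "(\<Union>K\<in>\<K>. {x \<in> topspace X. orbit G \<phi> x \<in> K}) = {x \<in> topspace X. orbit G \<phi> x \<in> \<Union>\<K>}"
      by blast
    ultimately show "openin X {x \<in> topspace X. orbit G \<phi> x \<in> \<Union>\<K>}"
      by simp
  qed blast+
  then show ?thesis
    by (simp add: orbit_space_def topology_inverse')
qed

lemma topspace_orbit_space: "topspace (orbit_space G X \<phi>) = orbits G (topspace X) \<phi>"
proof -
  have "{x \<in> topspace X. orbit G \<phi> x \<in> orbits G (topspace X) \<phi>} = topspace X"
    by (auto simp: orbits_def)
  then have "openin (orbit_space G X \<phi>) (orbits G (topspace X) \<phi>)"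
    by (simp add: openin_orbit_space)
  then show ?thesis
    by (meson openin_orbit_space openin_subset openin_topspace subset_antisym)
qed

lemma quotient_map_orbit_space: "quotient_map X (orbit_space G X \<phi>) (orbit G \<phi>)"
  unfolding quotient_map_def
  by (auto simp: topspace_orbit_space openin_orbit_space orbits_def)

end

theory Submission
  imports Defs
begin

text \<open>
  The proof combines a model of the Eilenberg-MacLane space with a way to make closed subsets of a space
  cohomologically trivial by adjoining roots of functions.

  The model is the infinite lens space K, the quotient of the sphere of finitely supported unit vectors of
  complex numbers by the group of p-th roots of unity.  It has one cell in each dimension
  (\<open>cw_complex_K\<close>).  The sphere is an absolute extensor for compacta (\<open>extend_to_next_sphere\<close>).
  This yields the homotopies needed to compute the homotopy groups (\<open>eilenberg_maclane_K\<close>), and it reduces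
  the extension of a map f from a closed set A to K to the question whether f lifts to the sphere.

  Locally f lifts.  Two lifts over closed sets B and C differ on the intersection by a function m into
  the p-th roots of unity, and an extension of the argument of m to C turns this mismatch into a function
  on the union of B and C without zeros, whose p-th root, if there is one, corrects the lifts to fit
  together.  Hence, if on every closed subset of X every complex function without zeros has a
  continuous p-th root, then all maps from closed subsets to K lift and extend
  (\<open>has_roots_imp_extends_all_maps\<close>).  In other words, divisibility by p of the integral first cohomology of
  all closed subsets forces their first cohomology modulo p to vanish.

  A space X over a compact set L of real sequences with this property arises by adjoining roots
  formally.  Terms are built from the coordinates on L and rational constants by sums, products,
  conjugation and formal p-th roots, and the points of X are the valuations of all terms that respect these
  operations and whose coordinates lie in L.  The values of terms are dense among the
  continuous functions on X by the Stone-Weierstrass theorem, and they have roots by construction; a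
  function without zeros that is close enough to one with a root has a root too
  (\<open>has_roots_root_space\<close>).  A function that assigns to every term t a shift of the p labels of its
  formal roots induces a substitution of terms.  These functions form a profinite group, which acts on X by
  composition, and by recursion on terms it acts transitively on the valuations over each point of L
  (\<open>fibre_transitive\<close>).  Thus the orbit space is L.

  The dimension of a space containing a connected set with two points is not 0, because path components
  of CW complexes are clopen (\<open>connected_not_dim_0\<close>).  The projection from X to L is open, so X contains
  such a set if L does.  Otherwise L is zero-dimensional, and the product of L and the circle with the
  rotation action is used instead.  Maps from its closed subsets to K extend because over the product of L
  and an interval lifts can be continued from slice to slice: the mismatch is a finite-valued function on a
  closed subset of L and hence extends over L (\<open>circle_prod_extends\<close>).\<close>

section \<open>The infinite lens space and local lifts\<close>

text \<open>The union of these spheres, with the colimit topology, is a contractible space on which the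
  p-th roots of unity act freely; its quotient is the Eilenberg-MacLane space used throughout.\<close>

definition sph :: "nat \<Rightarrow> (nat \<Rightarrow> complex) set" where
  "sph N = {z. (\<forall>i\<ge>N. z i = 0) \<and> (\<Sum>i<N. (cmod (z i))\<^sup>2) = 1}"

definition sphinf :: "(nat \<Rightarrow> complex) set" where
  "sphinf = (\<Union>N. sph N)"

definition smul :: "complex \<Rightarrow> (nat \<Rightarrow> complex) \<Rightarrow> nat \<Rightarrow> complex" where
  "smul u z = (\<lambda>i. u * z i)"

text \<open>Real coordinates of a complex sequence.  They only serve to place the points of the lens space,
  which are orbits of complex sequences, in the type of sets of real sequences.\<close>

definition enc :: "(nat \<Rightarrow> complex) \<Rightarrow> nat \<Rightarrow> real" where
  "enc z n = (if even n then Re (z (n div 2)) else Im (z (n div 2)))"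

text \<open>Distances on one sphere are measured by the sum of the coordinate distances: rotations by a
  scalar of modulus 1 preserve it, and every unit vector has at least distance 1 from the origin.\<close>

definition l1 :: "nat \<Rightarrow> (nat \<Rightarrow> complex) \<Rightarrow> (nat \<Rightarrow> complex) \<Rightarrow> real" where
  "l1 N z w = (\<Sum>i<N. cmod (z i - w i))"

lemma inj_enc: "inj enc"
proof (rule injI, rule ext)
  fix z w :: "nat \<Rightarrow> complex" and i assume "enc z = enc w"
  then have "enc z (2*i) = enc w (2*i)" "enc z (2*i+1) = enc w (2*i+1)" by auto
  then show "z i = w i" by (simp add: enc_def complex_eq_iff)
qed

lemma smul_smul [simp]: "smul u (smul v z) = smul (u * v) z"
  by (auto simp: smul_def)

lemma smul_1 [simp]: "smul 1 z = z"
  by (auto simp: smul_def)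

lemma sph_mono: assumes "N \<le> M" shows "sph N \<subseteq> sph M"
proof
  fix z assume z: "z \<in> sph N"
  have "(\<Sum>i<M. (cmod (z i))\<^sup>2) = (\<Sum>i<N. (cmod (z i))\<^sup>2)"
    by (rule sum.mono_neutral_right) (use z assms in \<open>auto simp: sph_def\<close>)
  with z assms show "z \<in> sph M" by (auto simp: sph_def)
qed

lemma sph_subset_sphinf: "sph N \<subseteq> sphinf"
  by (auto simp: sphinf_def)

lemma sph_smul: "z \<in> sph N \<Longrightarrow> cmod u = 1 \<Longrightarrow> smul u z \<in> sph N"
  by (auto simp: sph_def smul_def norm_mult)

lemma continuous_smul: "continuous_on S (smul u)"
  unfolding smul_def by (intro continuous_intros) (auto intro: continuous_on_product_then_coordinatewise)

lemma sphinf_common: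
  assumes "z \<in> sphinf" "w \<in> sphinf"
  obtains N where "z \<in> sph N" "w \<in> sph N"
proof -
  obtain A B where "z \<in> sph A" "w \<in> sph B" using assms by (auto simp: sphinf_def)
  then have "z \<in> sph (max A B)" "w \<in> sph (max A B)"
    using sph_mono[of A "max A B"] sph_mono[of B "max A B"] by auto
  then show ?thesis by (rule that)
qed

lemma cmod_le_1_sph: assumes "z \<in> sph N" shows "cmod (z i) \<le> 1"
proof (cases "i < N")
  case True
  have "(cmod (z i))\<^sup>2 \<le> (\<Sum>i<N. (cmod (z i))\<^sup>2)"
    by (rule member_le_sum) (use True in auto)
  also have "\<dots> = 1" using assms by (simp add: sph_def)
  finally show ?thesis by (simp add: abs_square_le_1 power2_le_imp_le)
qed (use assms in \<open>auto simp: sph_def\<close>)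

lemma l1_norm_ge_1: assumes "z \<in> sph N" shows "(\<Sum>i<N. cmod (z i)) \<ge> 1"
proof -
  have "1 = (\<Sum>i<N. (cmod (z i))\<^sup>2)" using assms by (simp add: sph_def)
  also have "\<dots> \<le> (\<Sum>i<N. cmod (z i))"
    by (rule sum_mono) (use cmod_le_1_sph[OF assms] in \<open>auto simp: power2_eq_square intro: mult_left_le_one_le\<close>)
  finally show ?thesis .
qed

lemma l1_triangle: "l1 N x z \<le> l1 N x y + l1 N y z"
proof -
  have "cmod (x i - z i) \<le> cmod (x i - y i) + cmod (y i - z i)" for i
    using norm_triangle_ineq[of "x i - y i" "y i - z i"] by simp
  then show ?thesis unfolding l1_def sum.distrib[symmetric] by (intro sum_mono)
qed

lemma l1_commute: "l1 N x y = l1 N y x"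
  by (simp add: l1_def norm_minus_commute)

lemma l1_refl [simp]: "l1 N x x = 0"
  by (simp add: l1_def)

lemma l1_nonneg [simp]: "0 \<le> l1 N x y"
  by (simp add: l1_def sum_nonneg)

lemma l1_smul: "cmod u = 1 \<Longrightarrow> l1 N (smul u x) (smul u y) = l1 N x y"
  by (simp add: l1_def smul_def flip: right_diff_distrib) (simp add: norm_mult)

lemma continuous_on_l1 [continuous_intros]:
  assumes "continuous_on S f" "continuous_on S g"
  shows "continuous_on S (\<lambda>x. l1 N (f x) (g x))"
  unfolding l1_def
  by (intro continuous_intros continuous_on_product_then_coordinatewise[OF assms(1)]
        continuous_on_product_then_coordinatewise[OF assms(2)])

lemma open_l1: "open {w. l1 N z w < e}"
proof -
  have "continuous_on UNIV (\<lambda>w. l1 N z w)"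
    by (intro continuous_intros)
  then show ?thesis
    by (simp add: open_Collect_less)
qed

lemma diameter_doubleton_le: "diameter {a, b} \<le> dist a b"
proof -
  have le: "dist (fst z) (snd z) \<le> dist a b" if "z \<in> {a, b} \<times> {a, b}" for z
    using that by (auto simp: dist_commute)
  have "(SUP z\<in>{a, b} \<times> {a, b}. dist (fst z) (snd z)) \<le> dist a b"
    by (rule cSUP_least[OF _ le]) simp_all
  then show ?thesis by (simp only: diameter_def insert_not_empty if_False case_prod_unfold)
qed

locale root_of_unity_group =
  fixes p :: nat
  assumes p2: "p \<ge> 2"
begin

definition mu :: "complex set" where
  "mu = {u. u ^ p = 1}"

lemma p_pos [simp]: "p > 0" "p \<noteq> 0" using p2 by auto

lemma one_in_mu [simp]: "1 \<in> mu" by (simp add: mu_def)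

lemma mu_mult [intro]: "u \<in> mu \<Longrightarrow> v \<in> mu \<Longrightarrow> u * v \<in> mu"
  by (simp add: mu_def power_mult_distrib)

lemma mu_inverse [intro]: "u \<in> mu \<Longrightarrow> inverse u \<in> mu"
  by (simp add: mu_def power_inverse)

lemma mu_nz: "u \<in> mu \<Longrightarrow> u \<noteq> 0"
  by (auto simp: mu_def power_0_left)

lemma mu_cmod: assumes "u \<in> mu" shows "cmod u = 1"
proof -
  have "cmod u ^ p = 1" using assms by (simp add: mu_def flip: norm_power)
  then show ?thesis using power_eq_imp_eq_base[of "cmod u" p 1] by simp
qed

lemma finite_mu: "finite mu"
  unfolding mu_def using finite_roots_unity[of p] p2 by simp

text \<open>Half of this number is a radius below which different points of one orbit cannot both be
  close to the same point.  The 1 only makes the set nonempty.\<close>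

definition delta :: real where
  "delta = Min (insert 1 ((\<lambda>u. cmod (1 - u)) ` (mu - {1})))"

lemma delta_pos: "delta > 0"
  unfolding delta_def using finite_mu by (subst Min_gr_iff) auto

lemma delta_le: "u \<in> mu \<Longrightarrow> u \<noteq> 1 \<Longrightarrow> delta \<le> cmod (1 - u)"
  unfolding delta_def using finite_mu by (intro Min_le) auto

lemma smul_in_sph: "u \<in> mu \<Longrightarrow> z \<in> sph N \<Longrightarrow> smul u z \<in> sph N"
  using sph_smul mu_cmod by auto

text \<open>A point of the unit sphere has coordinate sum at least 1, so rotating it by u moves it by at
  least the distance from 1 to u.\<close>

lemma orbit_separated:
  assumes "z \<in> sph N" "u \<in> mu" "l1 N z (smul u z) < delta"
  shows "u = 1"
proof (rule ccontr)
  assume "u \<noteq> 1"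
  have "l1 N z (smul u z) = (\<Sum>i<N. cmod (1 - u) * cmod (z i))"
    unfolding l1_def smul_def by (simp add: algebra_simps flip: norm_mult)
  also have "\<dots> = cmod (1 - u) * (\<Sum>i<N. cmod (z i))" by (simp add: sum_distrib_left)
  also have "\<dots> \<ge> cmod (1 - u) * 1"
    using l1_norm_ge_1[OF assms(1)] by (intro mult_left_mono) auto
  finally show False using delta_le[OF assms(2) \<open>u \<noteq> 1\<close>] assms(3) by simp
qed

definition q :: "(nat \<Rightarrow> complex) \<Rightarrow> (nat \<Rightarrow> real) set" where
  "q z = enc ` {smul u z | u. u \<in> mu}"

lemma q_eq_iff: "q z = q w \<longleftrightarrow> (\<exists>u\<in>mu. w = smul u z)"
proof
  assume "q z = q w"
  then have "{smul u z | u. u \<in> mu} = {smul u w | u. u \<in> mu}"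
    using inj_enc by (simp add: q_def inj_image_eq_iff)
  moreover have "smul 1 w \<in> {smul u w | u. u \<in> mu}" by (blast intro: one_in_mu)
  ultimately show "\<exists>u\<in>mu. w = smul u z" by auto
next
  assume "\<exists>u\<in>mu. w = smul u z"
  then obtain u where u: "u \<in> mu" "w = smul u z" by auto
  have "{smul v z | v. v \<in> mu} = {smul v w | v. v \<in> mu}"
  proof safe
    fix v assume "v \<in> mu"
    then have "smul v z = smul (v * inverse u) w" "v * inverse u \<in> mu"
      using u mu_nz[OF u(1)] mu_mult mu_inverse by (simp_all add: mult.assoc)
    then show "\<exists>v'. smul v z = smul v' w \<and> v' \<in> mu" by (intro exI[of _ "v * inverse u"]) simp
  next
    fix v assume "v \<in> mu"
    then show "\<exists>v'. smul v w = smul v' z \<and> v' \<in> mu"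
      using u mu_mult by (intro exI[of _ "v * u"]) simp
  qed
  then show "q z = q w" by (simp add: q_def)
qed

lemma q_smul [simp]: "u \<in> mu \<Longrightarrow> q (smul u z) = q z"
  using q_eq_iff[of z "smul u z"] by auto

lemma q_in_sph: assumes "q z \<in> q ` sph N" shows "z \<in> sph N"
proof -
  obtain w where "w \<in> sph N" "q w = q z" using assms by auto
  then show ?thesis using smul_in_sph by (auto simp: q_eq_iff)
qed

lemma finite_fiber: "finite {z. q z = b}"
proof (cases "\<exists>z0. q z0 = b")
  case True
  then obtain z0 where z0: "q z0 = b" by auto
  have "{z. q z = b} \<subseteq> (\<lambda>u. smul u z0) ` mu"
  proof
    fix z assume "z \<in> {z. q z = b}"
    then have "q z0 = q z" using z0 by simp
    then show "z \<in> (\<lambda>u. smul u z0) ` mu" unfolding q_eq_iff by blast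
  qed
  then show ?thesis using finite_mu by (meson finite_imageI finite_subset)
qed auto

lemma near_unique:
  assumes "w \<in> sph N" "w' \<in> sph N" "q w = q w'" "l1 N s w < delta/2" "l1 N s w' < delta/2"
  shows "w = w'"
proof -
  obtain u where u: "u \<in> mu" "w' = smul u w" using assms(3) by (auto simp: q_eq_iff)
  have "l1 N w w' \<le> l1 N w s + l1 N s w'" by (rule l1_triangle)
  then have "l1 N w w' < delta" using assms by (simp add: l1_commute)
  then show ?thesis using orbit_separated[OF assms(1) u(1)] u by simp
qed

text \<open>A set is open when its preimage in every finite-dimensional sphere is.  This is the colimit
  topology that a CW structure needs, and it makes maps from compacta factor through one sphere.\<close>

definition K :: "(nat \<Rightarrow> real) set topology" where
  "K = topology (\<lambda>U. U \<subseteq> q ` sphinf \<and> (\<forall>N. openin (top_of_set (sph N)) {z \<in> sph N. q z \<in> U}))"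

lemma openin_K: "openin K U \<longleftrightarrow>
    U \<subseteq> q ` sphinf \<and> (\<forall>N. openin (top_of_set (sph N)) {z \<in> sph N. q z \<in> U})"
proof -
  have "istopology (\<lambda>U. U \<subseteq> q ` sphinf \<and> (\<forall>N. openin (top_of_set (sph N)) {z \<in> sph N. q z \<in> U}))"
    unfolding istopology_def
  proof (intro conjI allI impI; (elim conjE)?)
    fix S T N
    assume "\<forall>N. openin (top_of_set (sph N)) {z \<in> sph N. q z \<in> S}"
      "\<forall>N. openin (top_of_set (sph N)) {z \<in> sph N. q z \<in> T}"
    then have "openin (top_of_set (sph N)) ({z \<in> sph N. q z \<in> S} \<inter> {z \<in> sph N. q z \<in> T})"
      by blast
    moreover have "{z \<in> sph N. q z \<in> S} \<inter> {z \<in> sph N. q z \<in> T} = {z \<in> sph N. q z \<in> S \<inter> T}" by auto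
    ultimately show "openin (top_of_set (sph N)) {z \<in> sph N. q z \<in> S \<inter> T}" by simp
  next
    fix \<U> N
    assume "\<forall>U\<in>\<U>. U \<subseteq> q ` sphinf \<and> (\<forall>N. openin (top_of_set (sph N)) {z \<in> sph N. q z \<in> U})"
    then have "openin (top_of_set (sph N)) (\<Union>U\<in>\<U>. {z \<in> sph N. q z \<in> U})" by blast
    moreover have "(\<Union>U\<in>\<U>. {z \<in> sph N. q z \<in> U}) = {z \<in> sph N. q z \<in> \<Union>\<U>}" by auto
    ultimately show "openin (top_of_set (sph N)) {z \<in> sph N. q z \<in> \<Union>\<U>}" by simp
  qed blast+
  then show ?thesis by (simp add: K_def topology_inverse')
qed

lemma topspace_K: "topspace K = q ` sphinf"
proof
  show "topspace K \<subseteq> q ` sphinf" using openin_topspace[of K] unfolding openin_K by blast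
  have "{z \<in> sph N. q z \<in> q ` sphinf} = sph N" for N using sph_subset_sphinf by auto
  then have "openin K (q ` sphinf)" unfolding openin_K by auto
  then show "q ` sphinf \<subseteq> topspace K" by (rule openin_subset)
qed

lemma closedin_K: "closedin K C \<longleftrightarrow>
    C \<subseteq> q ` sphinf \<and> (\<forall>N. closedin (top_of_set (sph N)) {z \<in> sph N. q z \<in> C})"
proof -
  have "sph N - {z \<in> sph N. q z \<in> C} = {z \<in> sph N. q z \<in> q ` sphinf - C}" for N
    using sph_subset_sphinf by auto
  then show ?thesis unfolding closedin_def topspace_K openin_K by auto
qed

text \<open>The preimage of the image is the finite union of the rotated copies of the open set.\<close>

lemma openin_K_image: assumes "open W" shows "openin K (q ` (sphinf \<inter> W))"
  unfolding openin_K
proof (intro conjI allI)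
  fix N
  have "{z \<in> sph N. q z \<in> q ` (sphinf \<inter> W)} = sph N \<inter> (\<Union>u\<in>mu. smul u -` W)"
  proof safe
    fix z w assume "z \<in> sph N" "q z = q w" "w \<in> sphinf" "w \<in> W"
    then show "z \<in> (\<Union>u\<in>mu. smul u -` W)" by (auto simp: q_eq_iff)
  next
    fix z u assume "z \<in> sph N" "u \<in> mu" "smul u z \<in> W"
    then have "q z = q (smul u z)" "smul u z \<in> sphinf \<inter> W"
      using subsetD[OF sph_subset_sphinf smul_in_sph] by auto
    then show "q z \<in> q ` (sphinf \<inter> W)" by blast
  qed
  moreover have "open (\<Union>u\<in>mu. smul u -` W)"
    using continuous_smul[of UNIV] by (intro open_UN ballI open_vimage assms) auto
  ultimately show "openin (top_of_set (sph N)) {z \<in> sph N. q z \<in> q ` (sphinf \<inter> W)}"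
    by auto
qed auto

lemma continuous_map_into_K:
  assumes "continuous_on Y s" "s ` Y \<subseteq> sph N"
  shows "continuous_map (top_of_set Y) K (\<lambda>y. q (s y))"
  unfolding continuous_map_def
proof (intro conjI allI impI)
  show "(\<lambda>y. q (s y)) \<in> topspace (top_of_set Y) \<rightarrow> topspace K"
    using assms sph_subset_sphinf by (force simp: topspace_K)
  fix U assume "openin K U"
  then have "openin (top_of_set (sph N)) {z \<in> sph N. q z \<in> U}" by (simp add: openin_K)
  then have "openin (top_of_set Y) (Y \<inter> s -` {z \<in> sph N. q z \<in> U})"
    by (intro continuous_openin_preimage[OF assms(1)]) (use assms(2) in auto)
  moreover have "Y \<inter> s -` {z \<in> sph N. q z \<in> U} = {x \<in> topspace (top_of_set Y). q (s x) \<in> U}"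
    using assms(2) by auto
  ultimately show "openin (top_of_set Y) {x \<in> topspace (top_of_set Y). q (s x) \<in> U}" by simp
qed

text \<open>Otherwise one could choose points whose images lie outside larger and larger stages.  Every
  tail of this sequence of images is closed, since each stage contains only finitely many of its terms;
  the complements of the tails then form an increasing open cover without a finite subcover.\<close>

lemma compact_map_stage:
  fixes f :: "'y::topological_space \<Rightarrow> (nat \<Rightarrow> real) set"
  assumes "compact C" "continuous_map (top_of_set C) K f"
  obtains N where "f ` C \<subseteq> q ` sph N"
proof -
  have "\<exists>N. f ` C \<subseteq> q ` sph N"
  proof (rule ccontr)
    assume "\<nexists>N. f ` C \<subseteq> q ` sph N"
    then have "\<forall>N. \<exists>x. x \<in> C \<and> f x \<notin> q ` sph N" by blast
    then obtain x where x: "\<And>N. x N \<in> C" "\<And>N. f (x N) \<notin> q ` sph N" by metis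
    define D where "D M = f ` x ` {M..}" for M
    have fK: "f ` C \<subseteq> q ` sphinf" using assms(2) by (auto simp: continuous_map_def topspace_K)
    have clo: "closedin K (D M)" for M
      unfolding closedin_K
    proof (intro conjI allI)
      show "D M \<subseteq> q ` sphinf" using fK x(1) by (auto simp: D_def)
      fix N
      have "{z \<in> sph N. q z \<in> D M} \<subseteq> (\<Union>k<N. {z. q z = f (x k)})"
      proof
        fix z assume "z \<in> {z \<in> sph N. q z \<in> D M}"
        then obtain k where k: "z \<in> sph N" "q z = f (x k)" by (auto simp: D_def)
        have "k < N" using k x(2)[of k] sph_mono[of N k] by (metis image_eqI linorder_not_le subsetD)
        with k show "z \<in> (\<Union>k<N. {z. q z = f (x k)})" by auto
      qed
      moreover have "finite {z. q z = f (x k)}" for k by (rule finite_fiber)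
      ultimately have "finite {z \<in> sph N. q z \<in> D M}" by (meson finite_UN_I finite_lessThan finite_subset)
      then show "closedin (top_of_set (sph N)) {z \<in> sph N. q z \<in> D M}"
        by (intro closed_subset finite_imp_closed) auto
    qed
    have "openin (top_of_set C) {y \<in> C. f y \<in> topspace K - D M}" for M
      using openin_continuous_map_preimage[OF assms(2), of "topspace K - D M"] clo[of M]
      unfolding topspace_euclidean_subtopology by (simp add: openin_diff)
    then have "\<forall>M. \<exists>T. open T \<and> {y \<in> C. f y \<in> topspace K - D M} = C \<inter> T"
      by (auto simp: openin_open)
    then obtain T where T: "\<And>M. open (T M)" "\<And>M. {y \<in> C. f y \<in> topspace K - D M} = C \<inter> T M" by metis
    have "C \<subseteq> (\<Union>M\<in>UNIV. T M)"
    proof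
      fix y assume y: "y \<in> C"
      then have "f y \<in> q ` sphinf" using fK by auto
      then obtain M where M: "f y \<in> q ` sph M" by (auto simp: sphinf_def)
      have "f y \<notin> D M"
      proof
        assume "f y \<in> D M"
        then obtain k where "k \<ge> M" "f y = f (x k)" by (auto simp: D_def)
        then show False using M x(2)[of k] sph_mono[of M k] by auto
      qed
      then have "y \<in> C \<inter> T M" using T(2)[of M] y \<open>f y \<in> q ` sphinf\<close> by (auto simp: topspace_K)
      then show "y \<in> (\<Union>M\<in>UNIV. T M)" by auto
    qed
    then obtain F where F: "finite F" "C \<subseteq> (\<Union>M\<in>F. T M)"
      using compactE_image[OF assms(1), of UNIV T] T(1) by metis
    define m where "m = Max (insert 0 F)"
    have "x m \<in> C" using x by simp
    then obtain M where M: "M \<in> F" "x m \<in> T M" using F(2) by auto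
    have "M \<le> m" unfolding m_def using F(1) M(1) by simp
    then have "f (x m) \<in> D M" by (auto simp: D_def)
    moreover have "x m \<in> C \<inter> T M" using M x by auto
    then have "f (x m) \<notin> D M" using T(2)[of M] by auto
    ultimately show False by simp
  qed
  then show ?thesis using that by blast
qed

text \<open>The basic covering argument.  If g stays within delta/2 of a map that comes with a lift s, there is
  exactly one way to pick a point over g y near s y, and this choice is continuous because images of
  small open sets are open in K.  With constant s it gives local lifts, with moving s it transports
  lifts along homotopies.\<close>

lemma near_lift:
  fixes g :: "'y::topological_space \<Rightarrow> (nat \<Rightarrow> real) set"
  assumes s: "continuous_on Y s" and g: "continuous_map (top_of_set Y) K g"
    and near: "\<And>y. y \<in> Y \<Longrightarrow> \<exists>w \<in> sph N. q w = g y \<and> l1 N (s y) w < delta/2"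
  obtains r where "continuous_on Y r" "r ` Y \<subseteq> sph N" "\<And>y. y \<in> Y \<Longrightarrow> q (r y) = g y"
proof -
  obtain r where r: "\<And>y. y \<in> Y \<Longrightarrow> r y \<in> sph N \<and> q (r y) = g y \<and> l1 N (s y) (r y) < delta/2"
    using near by metis
  have "continuous_on Y r"
    unfolding continuous_on_topological
  proof (intro ballI allI impI)
    fix y W assume y: "y \<in> Y" and W: "open W" "r y \<in> W"
    \<comment> \<open>half of the room left, since both s and r may move by e\<close>
    define e where "e = (delta/2 - l1 N (s y) (r y)) / 2"
    have e: "e > 0" using r[OF y] by (simp add: e_def)
    define W' where "W' = W \<inter> {w. l1 N (r y) w < e}"
    have "open W'" "r y \<in> W'" using W e open_l1 by (auto simp: W'_def)
    then have "openin K (q ` (sphinf \<inter> W'))" by (intro openin_K_image)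
    then have "openin (top_of_set Y) {x \<in> Y. g x \<in> q ` (sphinf \<inter> W')}"
      using openin_continuous_map_preimage[OF g] by simp
    then obtain A where A: "open A" "{x \<in> Y. g x \<in> q ` (sphinf \<inter> W')} = Y \<inter> A"
      by (auto simp: openin_open)
    have "open {w. l1 N (s y) w < e}" by (rule open_l1)
    then obtain B where B: "open B" "Y \<inter> s -` {w. l1 N (s y) w < e} = Y \<inter> B"
      using continuous_openin_preimage_gen[OF s] by (metis openin_open)
    have "y \<in> A"
    proof -
      have "g y \<in> q ` (sphinf \<inter> W')" using r[OF y] \<open>r y \<in> W'\<close> sph_subset_sphinf by blast
      then show ?thesis using A y by blast
    qed
    moreover have "y \<in> B"
    proof -
      have "y \<in> Y \<inter> s -` {w. l1 N (s y) w < e}" using y e by simp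
      then show ?thesis using B(2) by blast
    qed
    moreover have "r y' \<in> W" if "y' \<in> Y" "y' \<in> A \<inter> B" for y'
    proof -
      have "g y' \<in> q ` (sphinf \<inter> W')" using A that by blast
      then obtain w where w: "w \<in> sphinf" "w \<in> W'" "q w = g y'" by auto
      have wN: "w \<in> sph N" using q_in_sph[of w N] w r[OF that(1)] by (metis image_eqI)
      have "l1 N (s y') w \<le> l1 N (s y') (s y) + (l1 N (s y) (r y) + l1 N (r y) w)"
        using l1_triangle[of N "s y'" w "s y"] l1_triangle[of N "s y" w "r y"] by linarith
      moreover have "y' \<in> Y \<inter> s -` {w. l1 N (s y) w < e}" using B(2) that by blast
      then have "l1 N (s y') (s y) < e" by (simp add: l1_commute)
      moreover have "l1 N (r y) w < e" using w by (simp add: W'_def)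
      ultimately have "l1 N (s y') w < delta/2" by (simp add: e_def)
      then have "w = r y'" using near_unique[OF wN, of "r y'" "s y'"] r[OF that(1)] w by simp
      then show ?thesis using w by (simp add: W'_def)
    qed
    ultimately show "\<exists>A. open A \<and> y \<in> A \<and> (\<forall>y\<in>Y. y \<in> A \<longrightarrow> r y \<in> W)"
      using A B by (intro exI[of _ "A \<inter> B"]) auto
  qed
  then show ?thesis using that r by blast
qed

text \<open>Lifts are required to take values in one finite-dimensional sphere, where the colimit topology
  is the ordinary one; by compactness this loses nothing.\<close>

definition lifts :: "('y::topological_space \<Rightarrow> (nat \<Rightarrow> real) set) \<Rightarrow> 'y set \<Rightarrow> bool" where
  "lifts f B \<longleftrightarrow> (\<exists>N s. continuous_on B s \<and> s ` B \<subseteq> sph N \<and> (\<forall>x\<in>B. q (s x) = f x))"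

lemma lifts_empty: "lifts f {}"
  unfolding lifts_def by (intro exI[of _ 0] exI[of _ "\<lambda>_. undefined"]) auto

lemma lifts_subset: "lifts f B \<Longrightarrow> A \<subseteq> B \<Longrightarrow> lifts f A"
proof -
  assume "lifts f B" "A \<subseteq> B"
  then obtain N s where "continuous_on B s" "s ` B \<subseteq> sph N" "\<And>x. x \<in> B \<Longrightarrow> q (s x) = f x"
    unfolding lifts_def by metis
  with \<open>A \<subseteq> B\<close> have "continuous_on A s" "s ` A \<subseteq> sph N" "\<forall>x\<in>A. q (s x) = f x"
    by (auto intro: continuous_on_subset)
  then show ?thesis unfolding lifts_def by (intro exI conjI)
qed

lemma lifts_locally:
  fixes f :: "'y::topological_space \<Rightarrow> (nat \<Rightarrow> real) set"
  assumes "compact C" "continuous_map (top_of_set C) K f" "x \<in> C"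
  obtains V where "open V" "x \<in> V" "lifts f (C \<inter> V)"
proof -
  obtain N where N: "f ` C \<subseteq> q ` sph N" using compact_map_stage[OF assms(1,2)] .
  then obtain z where z: "z \<in> sph N" "f x = q z" using assms(3) by auto
  let ?W = "{w. l1 N z w < delta/2}"
  have "openin K (q ` (sphinf \<inter> ?W))" by (rule openin_K_image[OF open_l1])
  then have "openin (top_of_set C) {y \<in> C. f y \<in> q ` (sphinf \<inter> ?W)}"
    using openin_continuous_map_preimage[OF assms(2)] by simp
  then obtain V where V: "open V" "{y \<in> C. f y \<in> q ` (sphinf \<inter> ?W)} = C \<inter> V"
    by (auto simp: openin_open)
  have "z \<in> sphinf \<inter> ?W" using z sph_subset_sphinf delta_pos by auto
  then have "x \<in> V" using V z assms(3) by blast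
  moreover have "lifts f (C \<inter> V)"
  proof -
    have "continuous_map (top_of_set (C \<inter> V)) K f"
      using continuous_map_from_subtopology[OF assms(2), of "C \<inter> V"] by (simp add: subtopology_subtopology Int_ac)
    moreover have "\<exists>w \<in> sph N. q w = f y \<and> l1 N z w < delta/2" if "y \<in> C \<inter> V" for y
    proof -
      have "f y \<in> q ` (sphinf \<inter> ?W)" using V that by blast
      then obtain w where w: "f y = q w" "l1 N z w < delta/2" by auto
      moreover have "q w \<in> q ` sph N" using subsetD[OF N imageI, of y] w that by simp
      then have "w \<in> sph N" by (rule q_in_sph)
      ultimately show ?thesis by auto
    qed
    ultimately show ?thesis using near_lift[of "C \<inter> V" "\<lambda>_. z" f N] unfolding lifts_def
      by (metis continuous_on_const)
  qed
  ultimately show ?thesis using V that by blast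
qed

text \<open>Contract C to a point and run the contraction backwards in so many steps that consecutive
  maps are close; the constant map lifts, and closeness passes the lift on from step to step.\<close>

lemma lifts_contractible:
  fixes f :: "'y::metric_space \<Rightarrow> (nat \<Rightarrow> real) set" and H :: "real \<times> 'y \<Rightarrow> 'y"
  assumes C: "compact C" and f: "continuous_map (top_of_set C) K f" and x0: "x0 \<in> C"
    and H: "continuous_on ({0..1} \<times> C) H" "H ` ({0..1} \<times> C) \<subseteq> C"
    and H0: "\<And>x. x \<in> C \<Longrightarrow> H (0, x) = x0" and H1: "\<And>x. x \<in> C \<Longrightarrow> H (1, x) = x"
  shows "lifts f C"
proof -
  obtain N where N: "f ` C \<subseteq> q ` sph N" using compact_map_stage[OF C f] .
  let ?P = "{0..1::real} \<times> C"
  have cP: "compact ?P" using C by (intro compact_Times) auto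
  define F where "F = f \<circ> H"
  have F: "continuous_map (top_of_set ?P) K F"
    unfolding F_def using H by (intro continuous_map_compose[OF _ f]) auto
  have FN: "F y \<in> q ` sph N" if "y \<in> ?P" for y
  proof -
    have "H y \<in> C" using H(2) that by blast
    then show ?thesis using N by (auto simp: F_def)
  qed
  let ?W = "\<lambda>z. {w. l1 N z w < delta/4}"
  have "\<forall>z. \<exists>V. open V \<and> {y \<in> ?P. F y \<in> q ` (sphinf \<inter> ?W z)} = ?P \<inter> V"
  proof
    fix z
    have "openin (top_of_set ?P) {y \<in> ?P. F y \<in> q ` (sphinf \<inter> ?W z)}"
      using openin_continuous_map_preimage[OF F openin_K_image[OF open_l1]]
      by (simp only: topspace_euclidean_subtopology)
    then show "\<exists>V. open V \<and> {y \<in> ?P. F y \<in> q ` (sphinf \<inter> ?W z)} = ?P \<inter> V"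
      by (auto simp: openin_open)
  qed
  from choice[OF this] obtain V where V: "\<And>z. open (V z)"
    "\<And>z. {y \<in> ?P. F y \<in> q ` (sphinf \<inter> ?W z)} = ?P \<inter> V z" by blast
  have cover: "?P \<subseteq> \<Union>(V ` sph N)"
  proof
    fix y assume y: "y \<in> ?P"
    then have "F y \<in> q ` sph N" by (rule FN)
    then obtain z where z: "z \<in> sph N" "F y = q z" by auto
    have "z \<in> sphinf \<inter> ?W z" using z sph_subset_sphinf delta_pos by auto
    then have "y \<in> ?P \<inter> V z" using V(2)[of z] y z by blast
    then show "y \<in> \<Union>(V ` sph N)" using z by auto
  qed
  obtain z0 where z0: "z0 \<in> sph N" "f x0 = q z0" using N x0 by auto
  obtain e where e: "e > 0" "\<And>T. T \<subseteq> ?P \<Longrightarrow> diameter T < e \<Longrightarrow> \<exists>B\<in>V ` sph N. T \<subseteq> B"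
    using Lebesgue_number_lemma[OF cP, of "V ` sph N"] cover V(1) z0 by blast
  obtain n :: nat where n: "n > 0" "1 / real n < e"
    using e(1) by (metis nat_approx_posE zero_less_Suc)
  have "lifts (\<lambda>x. F (real k / real n, x)) C" if "k \<le> n" for k
    using that
  proof (induction k)
    case 0
    have "continuous_on C (\<lambda>x. z0)" "(\<lambda>x. z0) ` C \<subseteq> sph N" "\<forall>x\<in>C. q z0 = F (real 0 / real n, x)"
      using z0 H0 by (auto simp: F_def)
    then show ?case unfolding lifts_def by (intro exI[of _ N] exI[of _ "\<lambda>x. z0"]) blast
  next
    case (Suc k)
    then obtain M s where s: "continuous_on C s" "s ` C \<subseteq> sph M" "\<forall>x\<in>C. q (s x) = F (real k / real n, x)"
      unfolding lifts_def by auto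
    have mem: "(real j / real n, x) \<in> ?P" if "j \<le> n" "x \<in> C" for j x
      using that n by (auto simp: divide_le_eq)
    have sN: "s x \<in> sph N" if "x \<in> C" for x
    proof -
      have "F (real k / real n, x) \<in> q ` sph N"
        using FN[OF mem[of k x]] Suc.prems that by simp
      then show ?thesis using s(3) that q_in_sph by metis
    qed
    have g: "continuous_map (top_of_set C) K (\<lambda>x. F (real (Suc k) / real n, x))"
    proof -
      have "continuous_map (top_of_set C) (top_of_set ?P) (\<lambda>x. (real (Suc k) / real n, x))"
        unfolding continuous_map_subtopology_eu
        using mem[OF Suc.prems] by (intro conjI continuous_intros) blast
      from continuous_map_compose[OF this F] show ?thesis by (simp add: o_def)
    qed
    have "\<exists>w \<in> sph N. q w = F (real (Suc k) / real n, x) \<and> l1 N (s x) w < delta/2" if x: "x \<in> C" for x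
    proof -
      let ?T = "{(real k / real n, x), (real (Suc k) / real n, x)}"
      have "dist (real k / real n, x) (real (Suc k) / real n, x) = 1 / real n"
        by (simp add: dist_Pair_Pair dist_real_def divide_simps)
      then have "diameter ?T \<le> 1 / real n"
        using diameter_doubleton_le[of "(real k / real n, x)" "(real (Suc k) / real n, x)"] by linarith
      then have dT: "diameter ?T < e" using n(2) by linarith
      have TP: "?T \<subseteq> ?P" using mem[OF Suc_leD[OF Suc.prems] x] mem[OF Suc.prems x] by blast
      from e(2)[OF TP dT] obtain z where z: "z \<in> sph N" "?T \<subseteq> V z" by (rule bexE) blast
      have "F y \<in> q ` (sphinf \<inter> ?W z)" if "y \<in> ?T" for y
      proof -
        have "y \<in> ?P \<inter> V z" using that z(2) TP by blast
        then show ?thesis unfolding V(2)[of z, symmetric] by blast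
      qed
      then have Fw: "F (real k / real n, x) \<in> q ` (sphinf \<inter> ?W z)"
          "F (real (Suc k) / real n, x) \<in> q ` (sphinf \<inter> ?W z)" by blast+
      obtain w where w: "F (real k / real n, x) = q w" "l1 N z w < delta/4" using Fw(1) by blast
      obtain w' where w': "F (real (Suc k) / real n, x) = q w'" "l1 N z w' < delta/4" using Fw(2) by blast
      have "q w = q (s x)" using s(3) x w by simp
      then obtain u where u: "u \<in> mu" "s x = smul u w" by (auto simp: q_eq_iff)
      have "F (real (Suc k) / real n, x) \<in> q ` sph N"
        by (rule FN[OF mem[OF Suc.prems x]])
      then have w'N: "w' \<in> sph N" using q_in_sph w' by metis
      have "l1 N (s x) (smul u w') = l1 N w w'" using u mu_cmod l1_smul by simp
      also have "\<dots> < delta/2" using l1_triangle[of N w w' z] w w' by (simp add: l1_commute)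
      finally show ?thesis using w' w'N u smul_in_sph by (intro bexI[of _ "smul u w'"]) auto
    qed
    from near_lift[OF s(1) g this] obtain r where
      "continuous_on C r" "r ` C \<subseteq> sph N" "\<And>x. x \<in> C \<Longrightarrow> q (r x) = F (real (Suc k) / real n, x)" by blast
    then show ?case unfolding lifts_def by blast
  qed
  from this[of n] have "lifts (\<lambda>x. F (1, x)) C" using n by simp
  then show ?thesis unfolding lifts_def F_def using H1 by simp
qed

end

section \<open>Extending and gluing lifts\<close>

lemma continuous_on_smul [continuous_intros]:
  assumes "continuous_on S u" "continuous_on S s"
  shows "continuous_on S (\<lambda>x. smul (u x) (s x))"
  unfolding smul_def
  by (intro continuous_on_coordinatewise_then_product continuous_on_mult assms(1)
      continuous_on_product_then_coordinatewise[OF assms(2)])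

lemma compact_closed_subset:
  assumes "compact T" "closed S" "S \<subseteq> T" shows "compact S"
  using compact_Int_closed[OF assms(1,2)] assms(3) by (simp add: Int_absorb1)

lemma compact_Pi_coordinates:
  fixes B :: "'i \<Rightarrow> 'b::topological_space set"
  assumes "\<And>i. compact (B i)"
  shows "compact {x. \<forall>i. x i \<in> B i}"
proof -
  have "compactin (product_topology (\<lambda>i. euclidean) UNIV) (PiE UNIV B)"
    using assms by (subst compactin_PiE) auto
  then have "compact (PiE UNIV B)" by (simp add: euclidean_product_topology)
  moreover have "PiE UNIV B = {x. \<forall>i. x i \<in> B i}" by (auto simp: PiE_def)
  ultimately show ?thesis by simp
qed

text \<open>The sphere of infinite dimension is an absolute extensor, at the price of one coordinate.
  Tietze extends each of the N coordinates; the distance from A, placed in a new coordinate, keeps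
  the extension away from the origin, so that it can be normalised.\<close>

lemma extend_to_next_sphere:
  fixes s :: "'y::{metric_space,second_countable_topology} \<Rightarrow> nat \<Rightarrow> complex"
  assumes cl: "closedin (top_of_set Y) A" and s: "continuous_on A s" "s ` A \<subseteq> sph N"
  obtains t where "continuous_on Y t" "t ` Y \<subseteq> sph (Suc N)" "\<And>x. x \<in> A \<Longrightarrow> t x = s x"
proof (cases "A = {}")
  case True
  define e :: "nat \<Rightarrow> complex" where "e i = (if i = N then 1 else 0)" for i
  have "(\<Sum>i<Suc N. (cmod (e i))\<^sup>2) = 1" by (simp add: e_def)
  then have "e \<in> sph (Suc N)" by (auto simp: sph_def e_def)
  then show ?thesis using True by (intro that[of "\<lambda>_. e"]) auto
next
  case False
  have "\<exists>g. continuous_on Y g \<and> (\<forall>x\<in>A. g x = s x i)" for i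
    using Tietze_unbounded[OF continuous_on_product_then_coordinatewise[OF s(1)] cl] by metis
  then obtain g where g: "\<And>i. continuous_on Y (g i)" "\<And>i x. x \<in> A \<Longrightarrow> g i x = s x i" by metis
  define c where "c x i = (if i < N then g i x else if i = N then of_real (infdist x A) else 0)" for x i
  define n where "n x = sqrt (\<Sum>i<Suc N. (cmod (c x i))\<^sup>2)" for x
  have cA: "c x = s x" if "x \<in> A" for x
  proof
    fix i
    have "s x \<in> sph N" using s(2) that by auto
    then have "s x i = 0" if "i \<ge> N" using that by (simp add: sph_def)
    then show "c x i = s x i" using g(2)[OF that] that by (simp add: c_def)
  qed
  have nA: "n x = 1" if "x \<in> A" for x
  proof -
    have "s x \<in> sph (Suc N)" using s(2) that sph_mono[of N "Suc N"] by auto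
    then show ?thesis unfolding n_def cA[OF that] by (simp only: sph_def mem_Collect_eq real_sqrt_one)
  qed
  have npos: "n x > 0" if "x \<in> Y" for x
  proof (cases "x \<in> A")
    case False
    have "x \<notin> closure A"
      using cl False that by (metis Int_iff closedin_closed closure_closed closure_minimal closed_closure inf.bounded_iff subsetD inf_le2)
    then have "infdist x A > 0" using in_closure_iff_infdist_zero[OF \<open>A \<noteq> {}\<close>, of x] infdist_nonneg[of x A]
      by linarith
    then have "(cmod (c x N))\<^sup>2 > 0" by (simp add: c_def)
    moreover have "(cmod (c x N))\<^sup>2 \<le> (\<Sum>i<Suc N. (cmod (c x i))\<^sup>2)"
      by (rule member_le_sum) auto
    ultimately have "0 < (\<Sum>i<Suc N. (cmod (c x i))\<^sup>2)" by (rule less_le_trans)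
    then show ?thesis unfolding n_def by (rule real_sqrt_gt_zero)
  qed (use nA in simp)
  have cc: "continuous_on Y (\<lambda>x. c x i)" for i
  proof -
    have "continuous_on Y (\<lambda>x. complex_of_real (infdist x A))" by (intro continuous_intros)
    then show ?thesis unfolding c_def using g(1)[of i]
      by (cases "i < N"; cases "i = N") simp_all
  qed
  have cn: "continuous_on Y n"
    unfolding n_def by (intro continuous_intros cc)
  define t where "t x i = c x i / of_real (n x)" for x i
  show ?thesis
  proof (rule that[of t])
    show "continuous_on Y t"
      unfolding t_def using npos
      by (intro continuous_on_coordinatewise_then_product continuous_intros cc cn) force
    show "t ` Y \<subseteq> sph (Suc N)"
    proof clarify
      fix x assume x: "x \<in> Y"
      have "(\<Sum>i<Suc N. (cmod (t x i))\<^sup>2) = (\<Sum>i<Suc N. (cmod (c x i))\<^sup>2) / (n x)\<^sup>2"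
        by (simp only: t_def norm_divide power_divide sum_divide_distrib norm_of_real power2_abs)
      also have "(\<Sum>i<Suc N. (cmod (c x i))\<^sup>2) = (n x)\<^sup>2"
        unfolding n_def by (rule real_sqrt_pow2[symmetric]) (intro sum_nonneg zero_le_power2)
      also have "\<dots> / (n x)\<^sup>2 = 1" using npos[OF x] by simp
      finally show "t x \<in> sph (Suc N)" by (auto simp: sph_def t_def c_def)
    qed
    show "t x = s x" if "x \<in> A" for x
      using cA[OF that] nA[OF that] by (auto simp: t_def)
  qed
qed

text \<open>If z = u w on the unit sphere, this Hermitian product recovers the scalar u, and it does so
  continuously.\<close>

definition phase :: "nat \<Rightarrow> (nat \<Rightarrow> complex) \<Rightarrow> (nat \<Rightarrow> complex) \<Rightarrow> complex" where
  "phase N z w = (\<Sum>i<N. z i * cnj (w i))"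

lemma phase_smul: assumes "w \<in> sph N" shows "phase N (smul u w) w = u"
proof -
  have "phase N (smul u w) w = u * (\<Sum>i<N. complex_of_real ((cmod (w i))\<^sup>2))"
    unfolding phase_def smul_def sum_distrib_left
    by (rule sum.cong) (simp_all add: mult.assoc complex_norm_square[symmetric])
  also have "(\<Sum>i<N. complex_of_real ((cmod (w i))\<^sup>2)) = of_real (\<Sum>i<N. (cmod (w i))\<^sup>2)"
    by (rule of_real_sum[symmetric])
  also have "(\<Sum>i<N. (cmod (w i))\<^sup>2) = 1" using assms by (simp add: sph_def)
  also have "u * of_real 1 = u" by simp
  finally show ?thesis .
qed

lemma continuous_on_phase:
  assumes "continuous_on S f" "continuous_on S g"
  shows "continuous_on S (\<lambda>x. phase N (f x) (g x))"
  unfolding phase_def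
  by (intro continuous_intros continuous_on_product_then_coordinatewise[OF assms(1)]
        continuous_on_product_then_coordinatewise[OF assms(2)])

context root_of_unity_group
begin

lemma phase_mu:
  assumes "q z = q w" "w \<in> sph N"
  shows "phase N z w \<in> mu" "z = smul (phase N z w) w"
proof -
  obtain u where "u \<in> mu" "z = smul u w" using assms(1) q_eq_iff[of w z] by auto
  then show "phase N z w \<in> mu" "z = smul (phase N z w) w" using phase_smul[OF assms(2)] by auto
qed

lemma lifts_glue:
  fixes f :: "'y::topological_space \<Rightarrow> (nat \<Rightarrow> real) set"
  assumes "closed B" "closed C"
    and sB: "continuous_on B sB" "sB ` B \<subseteq> sph N" "\<And>x. x \<in> B \<Longrightarrow> q (sB x) = f x"
    and sC: "continuous_on C sC" "sC ` C \<subseteq> sph N" "\<And>x. x \<in> C \<Longrightarrow> q (sC x) = f x"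
    and u: "continuous_on B u" "u ` B \<subseteq> mu" and w: "continuous_on C w" "w ` C \<subseteq> mu"
    and eq: "\<And>x. x \<in> B \<inter> C \<Longrightarrow> smul (u x) (sB x) = smul (w x) (sC x)"
  shows "lifts f (B \<union> C)"
proof -
  define s where "s x = (if x \<in> B then smul (u x) (sB x) else smul (w x) (sC x))" for x
  have "continuous_on (B \<union> C) s"
    unfolding s_def
    by (intro continuous_on_cases assms continuous_on_smul) (use eq in auto)
  moreover have "s ` (B \<union> C) \<subseteq> sph N"
    using sB(2) sC(2) u(2) w(2) smul_in_sph by (auto simp add: s_def image_subset_iff)
  moreover have "\<forall>x\<in>B \<union> C. q (s x) = f x"
    using sB(3) sC(3) u(2) w(2) by (auto simp add: s_def image_subset_iff)
  ultimately show ?thesis unfolding lifts_def by (intro exI conjI)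
qed

text \<open>Two lifts of f over closed sets differ on the intersection by a function m with values in the roots
  of unity.  They can be corrected to agree as soon as m is a quotient of such functions on B and C.\<close>

lemma lifts_Un:
  fixes f :: "'y::topological_space \<Rightarrow> (nat \<Rightarrow> real) set"
  assumes "closed B" "closed C" "lifts f B" "lifts f C"
    and ext: "\<And>m. continuous_on (B \<inter> C) m \<Longrightarrow> m ` (B \<inter> C) \<subseteq> mu \<Longrightarrow>
      \<exists>u w. continuous_on B u \<and> u ` B \<subseteq> mu \<and> continuous_on C w \<and> w ` C \<subseteq> mu \<and>
        (\<forall>x\<in>B \<inter> C. u x = w x * m x)"
  shows "lifts f (B \<union> C)"
proof -
  obtain M s where s: "continuous_on B s" "s ` B \<subseteq> sph M" "\<And>x. x \<in> B \<Longrightarrow> q (s x) = f x"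
    using assms(3) unfolding lifts_def by metis
  obtain M' t where t: "continuous_on C t" "t ` C \<subseteq> sph M'" "\<And>x. x \<in> C \<Longrightarrow> q (t x) = f x"
    using assms(4) unfolding lifts_def by metis
  define N where "N = max M M'"
  have sN: "s ` B \<subseteq> sph N" using s(2) sph_mono[of M N] by (auto simp: N_def)
  have tN: "t ` C \<subseteq> sph N" using t(2) sph_mono[of M' N] by (auto simp: N_def)
  define m where "m x = phase N (t x) (s x)" for x
  have m: "m x \<in> mu" "t x = smul (m x) (s x)" if "x \<in> B \<inter> C" for x
    unfolding m_def using that s(3) t(3) sN by (auto intro!: phase_mu)
  have "continuous_on (B \<inter> C) m"
    unfolding m_def
    by (intro continuous_on_phase continuous_on_subset[OF s(1)] continuous_on_subset[OF t(1)]) auto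
  moreover have "m ` (B \<inter> C) \<subseteq> mu" using m(1) by auto
  ultimately obtain u w where uw: "continuous_on B u" "u ` B \<subseteq> mu" "continuous_on C w" "w ` C \<subseteq> mu"
    "\<forall>x\<in>B \<inter> C. u x = w x * m x" using ext by blast
  show ?thesis
    by (rule lifts_glue[OF assms(1,2) s(1) sN s(3) t(1) tN t(3) uw(1-4)])
      (use m(2) uw(5) in auto)
qed

text \<open>For compact X this says that the first integral cohomology group of every closed subset is divisible
  by p.\<close>

definition has_roots :: "'y::topological_space set \<Rightarrow> bool" where
  "has_roots X \<longleftrightarrow> (\<forall>A (h :: 'y \<Rightarrow> complex). closed A \<longrightarrow> A \<subseteq> X \<longrightarrow> continuous_on A h \<longrightarrow> (\<forall>x\<in>A. h x \<noteq> 0) \<longrightarrow>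
     (\<exists>r. continuous_on A r \<and> (\<forall>x\<in>A. r x ^ p = h x)))"

text \<open>Extend an argument of the mismatch m to a real function on C.  Its p-th multiple gives a
  function h without zeros that equals 1 on B and, since m is a p-th root of 1, also on the intersection.
  A p-th root r of h takes values in the roots of unity on B; divided by the exponential of the extended
  argument it also does so on C, and on the intersection the two functions differ by m.\<close>

lemma has_roots_lifts_Un:
  fixes f :: "'y::{metric_space,second_countable_topology} \<Rightarrow> (nat \<Rightarrow> real) set"
  assumes X: "has_roots X" and BC: "closed B" "closed C" "B \<subseteq> X" "C \<subseteq> X"
    and "lifts f B" "lifts f C"
  shows "lifts f (B \<union> C)"
proof (rule lifts_Un[OF BC(1,2) assms(6,7)])
  fix m assume m: "continuous_on (B \<inter> C) m" "m ` (B \<inter> C) \<subseteq> mu"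
  define k where "k = Arg"
  have k: "exp (\<i> * of_real (k v)) = v \<and> exp (\<i> * of_real (real p * k v)) = 1" if "v \<in> mu" for v
  proof -
    have "cmod v = 1" using that mu_cmod by simp
    then have 1: "exp (\<i> * of_real (Arg v)) = v"
      by (metis Arg_eq mult_1 norm_zero of_real_1 zero_neq_one)
    have "exp (\<i> * of_real (real p * Arg v)) = exp (\<i> * of_real (Arg v)) ^ p"
      by (simp add: exp_of_nat_mult[symmetric] algebra_simps)
    also have "\<dots> = 1" using 1 that by (simp add: mu_def)
    finally show ?thesis unfolding k_def using 1 by blast
  qed
  have "continuous_on mu k" using finite_mu by (rule continuous_on_finite)
  then have "continuous_on (B \<inter> C) (\<lambda>x. k (m x))"
    using m by (rule continuous_on_compose2)
  moreover have "closedin (top_of_set C) (B \<inter> C)" using BC by (intro closed_subset) auto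
  ultimately obtain \<kappa> where \<kappa>: "continuous_on C \<kappa>" "\<And>x. x \<in> B \<inter> C \<Longrightarrow> \<kappa> x = k (m x)"
    by (rule Tietze_unbounded) blast
  define h where "h x = (if x \<in> B then 1 else exp (\<i> * of_real (real p * \<kappa> x)))" for x
  have "continuous_on (B \<union> C) h"
    unfolding h_def
    by (intro continuous_on_cases BC continuous_intros \<kappa>) (use \<kappa>(2) m(2) k in auto)
  moreover have "\<forall>x\<in>B \<union> C. h x \<noteq> 0" by (simp add: h_def)
  moreover have "closed (B \<union> C)" "B \<union> C \<subseteq> X" using BC by auto
  ultimately obtain r where r: "continuous_on (B \<union> C) r" "\<forall>x\<in>B \<union> C. r x ^ p = h x"
    using X unfolding has_roots_def by blast
  define w where "w x = r x * exp (- (\<i> * of_real (\<kappa> x)))" for x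
  have hC: "h x = exp (\<i> * of_real (real p * \<kappa> x))" if "x \<in> C" for x
    using that \<kappa>(2)[of x] k[of "m x"] m(2) by (auto simp: h_def)
  have "r ` B \<subseteq> mu" using r(2) by (auto simp: mu_def h_def)
  moreover have "w ` C \<subseteq> mu"
  proof clarify
    fix x assume x: "x \<in> C"
    have "w x ^ p = r x ^ p * exp (- (\<i> * of_real (real p * \<kappa> x)))"
      by (simp add: w_def power_mult_distrib exp_of_nat_mult[symmetric] algebra_simps)
    also have "r x ^ p = exp (\<i> * of_real (real p * \<kappa> x))" using r(2) x hC by auto
    finally show "w x \<in> mu" by (simp add: mu_def exp_minus)
  qed
  moreover have "continuous_on B r" using r(1) by (rule continuous_on_subset) auto
  moreover have "continuous_on C w" unfolding w_def
    by (intro continuous_intros \<kappa>(1) continuous_on_subset[OF r(1)]) auto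
  moreover have "r x = w x * m x" if "x \<in> B \<inter> C" for x
  proof -
    have "m x \<in> mu" using that m(2) by auto
    then have "exp (\<i> * of_real (\<kappa> x)) = m x" using k[of "m x"] \<kappa>(2)[OF that] by simp
    then have "exp (- (\<i> * of_real (\<kappa> x))) * m x = 1"
      using mu_nz[OF \<open>m x \<in> mu\<close>] by (simp add: exp_minus field_simps)
    then show ?thesis by (simp add: w_def mult.assoc)
  qed
  ultimately show "\<exists>u w. continuous_on B u \<and> u ` B \<subseteq> mu \<and> continuous_on C w \<and> w ` C \<subseteq> mu \<and>
        (\<forall>x\<in>B \<inter> C. u x = w x * m x)" by blast
qed

text \<open>Lifts exist locally, and finitely many of them are glued one after the other.\<close>

lemma has_roots_imp_lifts:
  fixes f :: "'y::{metric_space,second_countable_topology} \<Rightarrow> (nat \<Rightarrow> real) set"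
  assumes X: "has_roots X" and A: "compact A" "A \<subseteq> X" and f: "continuous_map (top_of_set A) K f"
  shows "lifts f A"
proof -
  have "\<exists>r>0. lifts f (A \<inter> cball x r)" if x: "x \<in> A" for x
  proof -
    obtain V where V: "open V" "x \<in> V" "lifts f (A \<inter> V)" using lifts_locally[OF A(1) f x] .
    then obtain r where r: "r > 0" "cball x r \<subseteq> V" by (meson open_contains_cball)
    have "A \<inter> cball x r \<subseteq> A \<inter> V" using r by auto
    from lifts_subset[OF V(3) this] r(1) show ?thesis by blast
  qed
  then obtain r where r: "\<And>x. x \<in> A \<Longrightarrow> r x > 0" "\<And>x. x \<in> A \<Longrightarrow> lifts f (A \<inter> cball x (r x))" by metis
  have "A \<subseteq> (\<Union>x\<in>A. ball x (r x))" using r(1) by auto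
  then obtain F where F: "F \<subseteq> A" "finite F" "A \<subseteq> (\<Union>x\<in>F. ball x (r x))"
    using compactE_image[OF A(1), of A "\<lambda>x. ball x (r x)"] by (metis open_ball)
  have clA: "closed A" using A(1) by (rule compact_imp_closed)
  have "lifts f (A \<inter> (\<Union>x\<in>F. cball x (r x)))"
    using F(2,1)
  proof (induction F rule: finite_induct)
    case empty
    then show ?case using lifts_empty by simp
  next
    case (insert x F)
    have "lifts f ((A \<inter> (\<Union>x\<in>F. cball x (r x))) \<union> (A \<inter> cball x (r x)))"
      by (rule has_roots_lifts_Un[OF X])
        (use insert r(2) clA A(2) in \<open>auto intro!: closed_Int closed_UN\<close>)
    moreover have "(A \<inter> (\<Union>x\<in>F. cball x (r x))) \<union> (A \<inter> cball x (r x)) = A \<inter> (\<Union>x\<in>insert x F. cball x (r x))"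
      by auto
    ultimately show ?case by simp
  qed
  moreover have "A \<subseteq> A \<inter> (\<Union>x\<in>F. cball x (r x))" using F(3) ball_subset_cball by blast
  ultimately show ?thesis by (rule lifts_subset)
qed

text \<open>Extend the lift instead of the map.\<close>

lemma lifts_imp_extension:
  fixes f :: "'y::{metric_space,second_countable_topology} \<Rightarrow> (nat \<Rightarrow> real) set"
  assumes "lifts f A" "closedin (top_of_set Y) A"
  obtains g where "continuous_map (top_of_set Y) K g" "\<And>x. x \<in> A \<Longrightarrow> g x = f x"
proof -
  obtain N s where s: "continuous_on A s" "s ` A \<subseteq> sph N" "\<And>x. x \<in> A \<Longrightarrow> q (s x) = f x"
    using assms(1) unfolding lifts_def by metis
  obtain t where t: "continuous_on Y t" "t ` Y \<subseteq> sph (Suc N)" "\<And>x. x \<in> A \<Longrightarrow> t x = s x"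
    using extend_to_next_sphere[OF assms(2) s(1,2)] by blast
  show ?thesis
    by (rule that[OF continuous_map_into_K[OF t(1,2)]]) (simp add: t(3) s(3))
qed

lemma has_roots_imp_extends_all_maps:
  fixes X :: "'y::{metric_space,second_countable_topology} set"
  assumes "compact X" "has_roots X"
  shows "extends_all_maps (top_of_set X) K"
  unfolding extends_all_maps_def
proof (intro allI impI, elim conjE)
  fix A f assume A: "closedin (top_of_set X) A" and f: "continuous_map (subtopology (top_of_set X) A) K f"
  have AX: "A \<subseteq> X" using A by (simp add: closedin_imp_subset)
  have "compact A" using A assms(1) by (metis closedin_compact)
  moreover have "continuous_map (top_of_set A) K f"
    using f AX by (simp add: subtopology_subtopology Int_absorb1)
  ultimately have "lifts f A" using has_roots_imp_lifts[OF assms(2) _ AX] by blast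
  then show "\<exists>g. continuous_map (top_of_set X) K g \<and> (\<forall>x\<in>A. g x = f x)"
    using lifts_imp_extension[OF _ A] by metis
qed

end

section \<open>Higher homotopy groups of the lens space\<close>

definition cube :: "nat \<Rightarrow> (nat \<Rightarrow> real) set" where
  "cube n = {x. (\<forall>i<n. 0 \<le> x i \<and> x i \<le> 1) \<and> (\<forall>i\<ge>n. x i = 0)}"

lemma unit_cube_eq: "unit_cube n = top_of_set (cube n)"
proof -
  have "{x. \<forall>i\<ge>n. x i = 0} \<inter> {x. \<forall>i<n. 0 \<le> x i \<and> x i \<le> 1} = cube n"
    by (auto simp: cube_def)
  then show ?thesis
    by (simp add: unit_cube_def Euclidean_space_def euclidean_product_topology subtopology_subtopology)
qed

lemma cube_boundary_eq: "cube_boundary n = {x \<in> cube n. \<exists>i<n. x i = 0 \<or> x i = 1}"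
  by (simp add: cube_boundary_def unit_cube_eq)

lemma compact_cube: "compact (cube n)"
proof -
  have eq: "cube n = {x. \<forall>i. x i \<in> (if i < n then {0..1} else {0})}"
    unfolding cube_def by (auto simp: not_less)
  show ?thesis
    unfolding eq by (rule compact_Pi_coordinates) simp
qed

lemma cube_scale: assumes "x \<in> cube n" "0 \<le> t" "t \<le> 1" shows "(\<lambda>i. t * x i) \<in> cube n"
  using assms by (auto simp: cube_def mult_le_one)

lemma zero_in_cube: "(\<lambda>i. 0) \<in> cube n"
  by (simp add: cube_def)

lemma continuous_on_coord: "continuous_on S (\<lambda>x. x i)"
  by (rule continuous_on_product_then_coordinatewise[OF continuous_on_id])

lemma closed_cube_boundary: "closed (cube_boundary n)"
proof -
  have "cube_boundary n = cube n \<inter> (\<Union>i\<in>{..<n}. {x. x i = 0} \<union> {x. x i = 1})"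
    by (auto simp: cube_boundary_eq)
  moreover have "closed {x::nat \<Rightarrow> real. x i = c}" for i c
    by (intro closed_Collect_eq continuous_on_coord continuous_on_const)
  then have "closed (cube n \<inter> (\<Union>i\<in>{..<n}. {x. x i = 0} \<union> {x. x i = 1}))"
    by (intro closed_Int closed_UN closed_Un compact_imp_closed[OF compact_cube] ballI) auto
  ultimately show ?thesis by simp
qed

lemma finite_range_constant:
  fixes s :: "'y::topological_space \<Rightarrow> nat \<Rightarrow> complex"
  assumes "connected Y" "continuous_on Y s" "finite (s ` Y)" "x \<in> Y" "y \<in> Y"
  shows "s x = s y"
proof
  fix i
  have "continuous_on Y (\<lambda>x. s x i)" by (rule continuous_on_product_then_coordinatewise[OF assms(2)])
  moreover have "finite ((\<lambda>x. s x i) ` Y)"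
  proof -
    have "(\<lambda>x. s x i) ` Y = (\<lambda>z. z i) ` s ` Y" by auto
    then show ?thesis using assms(3) by simp
  qed
  ultimately have "(\<lambda>x. s x i) constant_on Y"
    using assms(1) continuous_finite_range_constant by blast
  then show "s x i = s y i" using assms(4,5) by (auto simp: constant_on_def)
qed

lemma continuous_on_snd_comp:
  assumes "continuous_on C s" "A \<subseteq> UNIV \<times> C" shows "continuous_on A (\<lambda>y. s (snd y))"
  by (rule continuous_on_compose2[OF assms(1) continuous_on_snd[OF continuous_on_id]]) (use assms(2) in auto)

context root_of_unity_group
begin

text \<open>Fibres are finite, hence discrete.\<close>

lemma lift_constant_on_fiber:
  fixes s :: "'y::topological_space \<Rightarrow> nat \<Rightarrow> complex"
  assumes "connected Y" "continuous_on Y s" "\<And>y. y \<in> Y \<Longrightarrow> q (s y) = b" "x \<in> Y" "y \<in> Y"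
  shows "s x = s y"
  by (rule finite_range_constant[OF assms(1,2) _ assms(4,5)])
    (rule finite_subset[OF _ finite_fiber[of b]], use assms(3) in auto)

lemma lifts_cube:
  assumes "continuous_map (top_of_set (cube n)) K f"
  shows "lifts f (cube n)"
proof (rule lifts_contractible[OF compact_cube assms zero_in_cube, where H = "\<lambda>(t, x) i. t * x i"])
  show "continuous_on ({0..1} \<times> cube n) (\<lambda>(t, x) i. t * x i)"
    unfolding case_prod_beta
    by (intro continuous_on_coordinatewise_then_product continuous_on_mult continuous_on_fst continuous_on_id
        continuous_on_product_then_coordinatewise[OF continuous_on_snd[OF continuous_on_id]])
  show "(\<lambda>(t, x) i. t * x i) ` ({0..1} \<times> cube n) \<subseteq> cube n"
    using cube_scale by auto
qed auto

lemma lifts_prism: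
  assumes "continuous_map (top_of_set ({0..1::real} \<times> cube n)) K f"
  shows "lifts f ({0..1} \<times> cube n)"
proof (rule lifts_contractible[OF _ assms, where H = "\<lambda>y. (fst y * fst (snd y), \<lambda>i. fst y * snd (snd y) i)"])
  show "compact ({0..1::real} \<times> cube n)" by (intro compact_Times compact_cube) auto
  show "(0, \<lambda>i. 0) \<in> {0..1::real} \<times> cube n" using zero_in_cube by auto
  show "continuous_on ({0..1} \<times> ({0..1} \<times> cube n)) (\<lambda>y. (fst y * fst (snd y), \<lambda>i. fst y * snd (snd y) i))"
    by (intro continuous_on_Pair continuous_on_coordinatewise_then_product continuous_on_mult continuous_on_fst continuous_on_id
        continuous_on_snd
        continuous_on_product_then_coordinatewise[OF continuous_on_snd[OF continuous_on_snd[OF continuous_on_id]]])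
  show "(\<lambda>y. (fst y * fst (snd y), \<lambda>i. fst y * snd (snd y) i)) ` ({0..1} \<times> ({0..1} \<times> cube n)) \<subseteq> {0..1} \<times> cube n"
    using cube_scale by (auto simp: mult_le_one)
qed auto

lemma spheroid_iff: "spheroid n K b f \<longleftrightarrow>
    continuous_map (top_of_set (cube n)) K f \<and> (\<forall>x\<in>cube_boundary n. f x = b)"
  by (simp add: spheroid_def unit_cube_eq)

lemma spheroid_homotopic_iff:
  "spheroid_homotopic n K b f g \<longleftrightarrow>
   (\<exists>h. continuous_map (top_of_set ({0..1::real} \<times> cube n)) K h \<and>
     (\<forall>x\<in>cube n. h (0, x) = f x) \<and> (\<forall>x\<in>cube n. h (1, x) = g x) \<and>
     (\<forall>t\<in>{0..1}. \<forall>x\<in>cube_boundary n. h (t, x) = b))"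
proof -
  have *: "(\<forall>x\<in>cube_boundary n. h x = b) = (\<forall>x\<in>cube_boundary n. k x = b)"
    if "\<And>x. x \<in> topspace (unit_cube n) \<Longrightarrow> h x = k x" for h k :: "(nat \<Rightarrow> real) \<Rightarrow> (nat \<Rightarrow> real) set"
    using that by (auto simp: cube_boundary_def)
  show ?thesis
    unfolding spheroid_homotopic_def
    by (subst homotopic_with[OF *]) (simp_all add: unit_cube_eq)
qed

lemma spheroid_homotopic_sym: "spheroid_homotopic n K b f g \<Longrightarrow> spheroid_homotopic n K b g f"
  unfolding spheroid_homotopic_def by (rule homotopic_with_symD)

lemma spheroid_homotopic_trans:
  "spheroid_homotopic n K b f g \<Longrightarrow> spheroid_homotopic n K b g h \<Longrightarrow> spheroid_homotopic n K b f h"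
  unfolding spheroid_homotopic_def by (rule homotopic_with_trans)

lemma spheroid_class_eq:
  assumes "spheroid_homotopic n K b f g"
  shows "spheroid_class n K b f = spheroid_class n K b g"
  unfolding spheroid_class_def
  using spheroid_homotopic_trans[OF assms] spheroid_homotopic_trans[OF spheroid_homotopic_sym[OF assms]] by blast

lemma spheroid_homotopic_imp_spheroid:
  assumes "spheroid_homotopic n K b f g" shows "spheroid n K b f" "spheroid n K b g"
  using homotopic_with_imp_property[OF assms[unfolded spheroid_homotopic_def]]
    homotopic_with_imp_continuous_maps[OF assms[unfolded spheroid_homotopic_def]]
  by (simp_all add: spheroid_def)

text \<open>On the prism over the cube, the two lifts are prescribed on bottom and top and their
  common values on the sides; extending over the whole prism gives a homotopy that is fixed on the
  boundary.\<close>

lemma lifts_agreeing_on_boundary_homotopic: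
  assumes f: "\<forall>x\<in>cube_boundary n. f x = b"
    and s: "continuous_on (cube n) s" "s ` cube n \<subseteq> sph N" "\<And>x. x \<in> cube n \<Longrightarrow> q (s x) = f x"
    and t: "continuous_on (cube n) t" "t ` cube n \<subseteq> sph N" "\<And>x. x \<in> cube n \<Longrightarrow> q (t x) = g x"
    and st: "\<And>x. x \<in> cube_boundary n \<Longrightarrow> s x = t x"
  shows "spheroid_homotopic n K b f g"
proof -
  let ?Y = "{0..1::real} \<times> cube n"
  define A0 where "A0 = {0::real} \<times> cube n \<union> {0..1} \<times> cube_boundary n"
  define A1 where "A1 = {1::real} \<times> cube n"
  have bd: "cube_boundary n \<subseteq> cube n" by (auto simp: cube_boundary_eq)
  have cl: "closed A0" "closed A1"
    unfolding A0_def A1_def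
    by (intro closed_Un closed_Times compact_imp_closed[OF compact_cube] closed_cube_boundary; simp)+
  define \<sigma> where "\<sigma> y = (if y \<in> A0 then s (snd y) else t (snd y))" for y
  have "continuous_on (A0 \<union> A1) \<sigma>"
    unfolding \<sigma>_def
  proof (rule continuous_on_cases[OF cl])
    show "continuous_on A0 (\<lambda>y. s (snd y))" "continuous_on A1 (\<lambda>y. t (snd y))"
      using bd by (auto intro!: continuous_on_snd_comp s(1) t(1) simp: A0_def A1_def)
    show "\<forall>y. y \<in> A0 \<and> y \<notin> A0 \<or> y \<in> A1 \<and> y \<in> A0 \<longrightarrow> s (snd y) = t (snd y)"
      using st by (auto simp: A0_def A1_def)
  qed
  moreover have "\<sigma> ` (A0 \<union> A1) \<subseteq> sph N"
    using s(2) t(2) bd by (auto simp: \<sigma>_def A0_def A1_def image_subset_iff)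
  moreover have "closedin (top_of_set ?Y) (A0 \<union> A1)"
    using cl bd by (intro closed_subset closed_Un) (auto simp: A0_def A1_def)
  ultimately obtain T where T: "continuous_on ?Y T" "T ` ?Y \<subseteq> sph (Suc N)" "\<And>y. y \<in> A0 \<union> A1 \<Longrightarrow> T y = \<sigma> y"
    using extend_to_next_sphere by blast
  have "continuous_map (top_of_set ?Y) K (\<lambda>y. q (T y))" by (rule continuous_map_into_K[OF T(1,2)])
  moreover have "q (T (0, x)) = f x" if "x \<in> cube n" for x
    using that T(3)[of "(0, x)"] s(3) by (simp add: \<sigma>_def A0_def)
  moreover have "q (T (1, x)) = g x" if "x \<in> cube n" for x
    using that T(3)[of "(1, x)"] t(3) st[of x] by (simp add: \<sigma>_def A0_def A1_def)
  moreover have "q (T (r, x)) = b" if "r \<in> {0..1}" "x \<in> cube_boundary n" for r x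
  proof -
    have "T (r, x) = s x" using that T(3)[of "(r, x)"] by (simp add: \<sigma>_def A0_def)
    then show ?thesis using that f s(3) bd by auto
  qed
  ultimately show ?thesis unfolding spheroid_homotopic_iff by (intro exI[of _ "\<lambda>y. q (T y)"]) blast
qed

lemma spheroid_const: "b \<in> topspace K \<Longrightarrow> spheroid n K b (\<lambda>x. b)"
  by (simp add: spheroid_iff)

text \<open>The boundary of a cube of dimension at least 2 is connected: scale all coordinates other than one
  that is 0 or 1, then scale this one, staying in a face where a second coordinate vanishes.\<close>

lemma lift_constant_on_boundary:
  assumes n: "n \<ge> 2" and s: "continuous_on (cube n) s" "\<And>x. x \<in> cube_boundary n \<Longrightarrow> q (s x) = b"
    and x: "x \<in> cube_boundary n"
  shows "s x = s (\<lambda>i. 0)"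
proof -
  have bd: "cube_boundary n \<subseteq> cube n" by (auto simp: cube_boundary_eq)
  have seg: "s (\<gamma> 0) = s (\<gamma> 1)" if "continuous_on {0..1::real} \<gamma>" "\<gamma> ` {0..1} \<subseteq> cube_boundary n" for \<gamma>
  proof -
    have "continuous_on {0..1} (s \<circ> \<gamma>)"
      by (intro continuous_on_compose that(1) continuous_on_subset[OF s(1)]) (use that(2) bd in auto)
    moreover have "q ((s \<circ> \<gamma>) y) = b" if "y \<in> {0..1}" for y
      using s(2)[of "\<gamma> y"] that \<open>\<gamma> ` {0..1} \<subseteq> cube_boundary n\<close> by (simp add: image_subset_iff)
    ultimately have "(s \<circ> \<gamma>) 0 = (s \<circ> \<gamma>) 1"
      by (rule lift_constant_on_fiber[rotated]) auto
    then show ?thesis by simp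
  qed
  obtain i where i: "i < n" "x i = 0 \<or> x i = 1" and xc: "x \<in> cube n"
    using x by (auto simp: cube_boundary_eq)
  obtain j where j: "j < n" "j \<noteq> i"
  proof (cases "i = 0")
    case True then show ?thesis using n that[of 1] by simp
  next
    case False then show ?thesis using n that[of 0] by simp
  qed
  define \<alpha> where "\<alpha> t k = (if k = i then x k else t * x k)" for t k
  define \<beta> where "\<beta> t k = (if k = i then t * x k else 0)" for t k
  have "s (\<alpha> 0) = s (\<alpha> 1)"
  proof (rule seg)
    show "continuous_on {0..1} \<alpha>"
    proof (rule continuous_on_coordinatewise_then_product)
      fix k show "continuous_on {0..1} (\<lambda>t. \<alpha> t k)"
        by (cases "k = i") (auto simp: \<alpha>_def intro!: continuous_intros)
    qed
    show "\<alpha> ` {0..1} \<subseteq> cube_boundary n"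
    proof clarify
      fix t :: real assume "t \<in> {0..1}"
      then have "\<alpha> t \<in> cube n" using xc by (auto simp: cube_def \<alpha>_def mult_le_one)
      moreover have "\<alpha> t i = x i" by (simp add: \<alpha>_def)
      ultimately show "\<alpha> t \<in> cube_boundary n" using i by (auto simp: cube_boundary_eq)
    qed
  qed
  moreover have "s (\<beta> 0) = s (\<beta> 1)"
  proof (rule seg)
    show "continuous_on {0..1} \<beta>"
    proof (rule continuous_on_coordinatewise_then_product)
      fix k show "continuous_on {0..1} (\<lambda>t. \<beta> t k)"
        by (cases "k = i") (auto simp: \<beta>_def intro!: continuous_intros)
    qed
    show "\<beta> ` {0..1} \<subseteq> cube_boundary n"
    proof clarify
      fix t :: real assume "t \<in> {0..1}"
      then have "\<beta> t \<in> cube n" using xc i by (auto simp: cube_def \<beta>_def mult_le_one)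
      moreover have "\<beta> t j = 0" using j by (simp add: \<beta>_def)
      ultimately show "\<beta> t \<in> cube_boundary n" using j by (auto simp: cube_boundary_eq)
    qed
  qed
  moreover have "\<alpha> 1 = x" "\<alpha> 0 = \<beta> 1" "\<beta> 0 = (\<lambda>i. 0)" by (auto simp: \<alpha>_def \<beta>_def)
  ultimately show ?thesis by metis
qed

lemma spheroid_null_homotopic:
  assumes n: "n \<ge> 2" and f: "spheroid n K b f"
  shows "spheroid_homotopic n K b f (\<lambda>x. b)"
proof -
  have fc: "continuous_map (top_of_set (cube n)) K f" and fb: "\<forall>x\<in>cube_boundary n. f x = b"
    using f by (auto simp: spheroid_iff)
  obtain N s where s: "continuous_on (cube n) s" "s ` cube n \<subseteq> sph N" "\<And>x. x \<in> cube n \<Longrightarrow> q (s x) = f x"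
    using lifts_cube[OF fc] unfolding lifts_def by metis
  have bd: "cube_boundary n \<subseteq> cube n" by (auto simp: cube_boundary_eq)
  have zb: "(\<lambda>i. 0) \<in> cube_boundary n" using n zero_in_cube by (auto simp: cube_boundary_eq intro!: exI[of _ 0])
  have sb: "q (s x) = b" if "x \<in> cube_boundary n" for x using that s(3)[of x] fb bd by auto
  show ?thesis
  proof (rule lifts_agreeing_on_boundary_homotopic[OF fb s])
    show "continuous_on (cube n) (\<lambda>x. s (\<lambda>i. 0))" by (rule continuous_on_const)
    show "(\<lambda>x. s (\<lambda>i. 0)) ` cube n \<subseteq> sph N" using s(2) zero_in_cube by (auto simp: image_subset_iff)
    show "q (s (\<lambda>i. 0)) = b" by (rule sb[OF zb])
    show "s x = s (\<lambda>i. 0)" if "x \<in> cube_boundary n" for x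
      by (rule lift_constant_on_boundary[OF n s(1) sb that])
  qed
qed

lemma homotopy_group_trivial:
  assumes n: "n \<ge> 2" and b: "b \<in> topspace K"
  shows "carrier (homotopy_group n K b) = {\<one>\<^bsub>homotopy_group n K b\<^esub>}"
proof -
  have "spheroid_class n K b f = spheroid_class n K b (\<lambda>x. b)" if "spheroid n K b f" for f
    by (rule spheroid_class_eq[OF spheroid_null_homotopic[OF n that]])
  then have "spheroid_class n K b ` {f. spheroid n K b f} \<subseteq> {spheroid_class n K b (\<lambda>x. b)}"
    by (intro image_subsetI) simp
  moreover have "spheroid_class n K b (\<lambda>x. b) \<in> spheroid_class n K b ` {f. spheroid n K b f}"
    by (intro imageI CollectI spheroid_const[OF b])
  ultimately have "spheroid_class n K b ` {f. spheroid n K b f} = {spheroid_class n K b (\<lambda>x. b)}" by blast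
  then show ?thesis by (simp only: homotopy_group_def partial_object.simps monoid.simps)
qed

end

section \<open>The fundamental group of the lens space\<close>

(* keeps the dimension of the 1-dimensional cube in the form 1 *)
declare One_nat_def [simp del]

definition pt :: "real \<Rightarrow> nat \<Rightarrow> real" where
  "pt t i = (if i = 0 then t else 0)"

lemma cube_1: "cube 1 = pt ` {0..1}"
proof
  show "cube 1 \<subseteq> pt ` {0..1}"
  proof
    fix x assume "x \<in> cube 1"
    then have "x = pt (x 0)" "x 0 \<in> {0..1}" by (auto simp: cube_def pt_def)
    then show "x \<in> pt ` {0..1}" by (rule image_eqI)
  qed
qed (auto simp: cube_def pt_def)

lemma pt_inject [simp]: "pt s = pt t \<longleftrightarrow> s = t"
  by (metis pt_def)

lemma pt_in_cube [simp]: "pt t \<in> cube 1 \<longleftrightarrow> 0 \<le> t \<and> t \<le> 1"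
  by (auto simp: cube_1)

lemma cube_1_pt: "x \<in> cube 1 \<Longrightarrow> x = pt (x 0)"
  by (auto simp: cube_1 pt_def)

lemma cube_1_upd: "x \<in> cube 1 \<Longrightarrow> x(0 := c) = pt c"
  by (auto simp: cube_1 pt_def)

lemma cube_boundary_1: "cube_boundary 1 = {pt 0, pt 1}"
proof
  show "cube_boundary 1 \<subseteq> {pt 0, pt 1}"
    using cube_1_pt by (force simp: cube_boundary_eq)
  show "{pt 0, pt 1} \<subseteq> cube_boundary 1"
    by (simp add: cube_boundary_eq) (simp add: pt_def)
qed

lemma continuous_on_pt [continuous_intros]:
  assumes "continuous_on S f" shows "continuous_on S (\<lambda>x. pt (f x))"
proof (rule continuous_on_coordinatewise_then_product)
  fix i show "continuous_on S (\<lambda>x. pt (f x) i)" using assms by (cases "i = 0") (simp_all add: pt_def)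
qed

lemma connected_cube_1: "connected (cube 1)"
  unfolding cube_1 by (intro connected_continuous_image continuous_intros) auto

context root_of_unity_group
begin

text \<open>The phase between two lifts of the same map is continuous with finitely many values.\<close>

lemma lift_unique:
  fixes s t :: "'y::topological_space \<Rightarrow> nat \<Rightarrow> complex"
  assumes Y: "connected Y" and s: "continuous_on Y s" and t: "continuous_on Y t" "t ` Y \<subseteq> sph N"
    and st: "\<And>y. y \<in> Y \<Longrightarrow> q (s y) = q (t y)" and x: "x \<in> Y" "s x = t x" and y: "y \<in> Y"
  shows "s y = t y"
proof -
  have ph: "phase N (s y) (t y) \<in> mu" "s y = smul (phase N (s y) (t y)) (t y)" if "y \<in> Y" for y
    using phase_mu[OF st[OF that], of N] t(2) that by auto
  have "(\<lambda>y. phase N (s y) (t y)) constant_on Y"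
  proof (rule continuous_finite_range_constant[OF Y continuous_on_phase[OF s t(1)]])
    show "finite ((\<lambda>y. phase N (s y) (t y)) ` Y)"
      by (rule finite_subset[OF _ finite_mu]) (use ph in auto)
  qed
  then have "phase N (s y) (t y) = phase N (s x) (t x)"
    using x y unfolding constant_on_def by metis
  also have "\<dots> = 1" using phase_smul[of "t x" N 1] x t(2) by auto
  finally show ?thesis using ph(2)[OF y] by simp
qed

text \<open>Relative to a lift z of the base point, the degree of a loop is the root of unity by which the end
  point of its lift starting at z differs from z.\<close>

definition has_degree :: "(nat \<Rightarrow> complex) \<Rightarrow> ((nat \<Rightarrow> real) \<Rightarrow> (nat \<Rightarrow> real) set) \<Rightarrow> complex \<Rightarrow> bool" where
  "has_degree z f u \<longleftrightarrow> u \<in> mu \<and> (\<exists>N s. continuous_on (cube 1) s \<and> s ` cube 1 \<subseteq> sph N \<and>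
     (\<forall>x\<in>cube 1. q (s x) = f x) \<and> s (pt 0) = z \<and> s (pt 1) = smul u z)"

lemma has_degreeE:
  assumes "has_degree z f u"
  obtains N s where "continuous_on (cube 1) s" "s ` cube 1 \<subseteq> sph N" "\<And>x. x \<in> cube 1 \<Longrightarrow> q (s x) = f x"
    "s (pt 0) = z" "s (pt 1) = smul u z" "u \<in> mu"
  using assms unfolding has_degree_def by blast

lemma has_degreeI:
  assumes "continuous_on (cube 1) s" "s ` cube 1 \<subseteq> sph N" "\<And>x. x \<in> cube 1 \<Longrightarrow> q (s x) = f x"
    "s (pt 0) = z" "s (pt 1) = smul u z" "u \<in> mu"
  shows "has_degree z f u"
  unfolding has_degree_def using assms by (intro conjI exI[of _ N] exI[of _ s] ballI)

lemma ex_has_degree: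
  assumes f: "spheroid 1 K (q z) f"
  shows "\<exists>u. has_degree z f u"
proof -
  have fc: "continuous_map (top_of_set (cube 1)) K f" and fb: "f (pt 0) = q z" "f (pt 1) = q z"
    using f by (simp_all add: spheroid_iff cube_boundary_1)
  obtain N s where s: "continuous_on (cube 1) s" "s ` cube 1 \<subseteq> sph N" "\<And>x. x \<in> cube 1 \<Longrightarrow> q (s x) = f x"
    using lifts_cube[OF fc] unfolding lifts_def by metis
  have "q (s (pt 0)) = q z" using s(3)[of "pt 0"] fb by simp
  then obtain v where v: "v \<in> mu" "z = smul v (s (pt 0))" by (auto simp: q_eq_iff)
  have "q z = q (smul v (s (pt 1)))" using s(3)[of "pt 1"] fb v by simp
  then obtain u where u: "u \<in> mu" "smul v (s (pt 1)) = smul u z" by (auto simp: q_eq_iff)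
  have "has_degree z f u"
  proof (rule has_degreeI)
    show "continuous_on (cube 1) (\<lambda>x. smul v (s x))" by (intro continuous_intros s(1))
    show "(\<lambda>x. smul v (s x)) ` cube 1 \<subseteq> sph N" using s(2) smul_in_sph[OF v(1)] by auto
    show "q (smul v (s x)) = f x" if "x \<in> cube 1" for x using s(3)[OF that] v by simp
  qed (use u v in auto)
  then show ?thesis ..
qed

lemma has_degree_imp_spheroid:
  assumes "has_degree z f u" shows "spheroid 1 K (q z) f"
proof -
  obtain N s where s: "continuous_on (cube 1) s" "s ` cube 1 \<subseteq> sph N" "\<And>x. x \<in> cube 1 \<Longrightarrow> q (s x) = f x"
    "s (pt 0) = z" "s (pt 1) = smul u z" "u \<in> mu" using has_degreeE[OF assms] by blast
  have "continuous_map (top_of_set (cube 1)) K f"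
    by (rule continuous_map_eq[OF continuous_map_into_K[OF s(1,2)]]) (simp add: s(3))
  moreover have "f (pt 0) = q z" "f (pt 1) = q z" using s(3)[of "pt 0"] s(3)[of "pt 1"] s(4-6) by auto
  ultimately show ?thesis by (simp add: spheroid_iff cube_boundary_1)
qed

text \<open>Lift the homotopy.  Its sides are constant since they lie over the base point, and its ends are the
  lifts of the two loops by uniqueness.\<close>

lemma homotopic_imp_same_degree:
  assumes hom: "spheroid_homotopic 1 K (q z) f g" and f: "has_degree z f u" and g: "has_degree z g v"
  shows "u = v"
proof -
  let ?Y = "{0..1::real} \<times> cube 1"
  obtain h where h: "continuous_map (top_of_set ?Y) K h"
    "\<And>x. x \<in> cube 1 \<Longrightarrow> h (0, x) = f x" "\<And>x. x \<in> cube 1 \<Longrightarrow> h (1, x) = g x"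
    "\<And>t x. t \<in> {0..1} \<Longrightarrow> x \<in> {pt 0, pt 1} \<Longrightarrow> h (t, x) = q z"
    using hom unfolding spheroid_homotopic_iff cube_boundary_1 by metis
  obtain N s where s: "continuous_on (cube 1) s" "s ` cube 1 \<subseteq> sph N" "\<And>x. x \<in> cube 1 \<Longrightarrow> q (s x) = f x"
    "s (pt 0) = z" "s (pt 1) = smul u z" "u \<in> mu" using has_degreeE[OF f] by blast
  obtain M t where t: "continuous_on (cube 1) t" "t ` cube 1 \<subseteq> sph M" "\<And>x. x \<in> cube 1 \<Longrightarrow> q (t x) = g x"
    "t (pt 0) = z" "t (pt 1) = smul v z" "v \<in> mu" using has_degreeE[OF g] by blast
  obtain L T where T: "continuous_on ?Y T" "T ` ?Y \<subseteq> sph L" "\<And>y. y \<in> ?Y \<Longrightarrow> q (T y) = h y"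
    using lifts_prism[OF h(1)] unfolding lifts_def by metis
  have "q (T (0, pt 0)) = q z" using T(3)[of "(0, pt 0)"] h(4)[of 0 "pt 0"] by simp
  then obtain w where w: "w \<in> mu" "z = smul w (T (0, pt 0))" by (auto simp: q_eq_iff)
  define R where "R y = smul w (T y)" for y
  have RY: "continuous_on ?Y R" unfolding R_def by (intro continuous_on_smul continuous_on_const T(1))
  have R: "continuous_on ?Y R" "\<And>y. y \<in> ?Y \<Longrightarrow> q (R y) = h y" "R (0, pt 0) = z"
    using T w RY by (simp_all add: R_def)
  have slice: "continuous_on (cube 1) (\<lambda>x. R (r, x))" if "r \<in> {0..1}" for r
    by (rule continuous_on_compose2[OF R(1)]) (use that in \<open>auto intro!: continuous_intros\<close>)
  have side: "R (0, x) = R (1, x)" if "x \<in> {pt 0, pt 1}" for x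
  proof (rule lift_constant_on_fiber[where s = "\<lambda>r. R (r, x)" and Y = "{0..1}" and b = "q z"])
    show "continuous_on {0..1} (\<lambda>r. R (r, x))"
      by (rule continuous_on_compose2[OF R(1)]) (use that in \<open>auto intro!: continuous_intros\<close>)
    show "q (R (r, x)) = q z" if r: "r \<in> {0..1}" for r
    proof -
      have "(r, x) \<in> ?Y" using r \<open>x \<in> {pt 0, pt 1}\<close> by auto
      then show ?thesis using R(2)[of "(r, x)"] h(4)[OF r \<open>x \<in> {pt 0, pt 1}\<close>] by simp
    qed
  qed auto
  have "R (0, pt 1) = s (pt 1)"
    by (rule lift_unique[OF connected_cube_1 slice s(1,2), where x = "pt 0"])
      (use R s h(2) in auto)
  moreover have "R (1, pt 1) = t (pt 1)"
    by (rule lift_unique[OF connected_cube_1 slice t(1,2), where x = "pt 0"])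
      (use R t h(3) side[of "pt 0"] in auto)
  ultimately have "smul u z = smul v z" using side[of "pt 1"] s t by simp
  moreover have "z \<in> sph N" using s(2,4) by (auto simp: image_subset_iff)
  ultimately show ?thesis using phase_smul by metis
qed

lemma same_degree_imp_homotopic:
  assumes f: "has_degree z f u" and g: "has_degree z g u"
  shows "spheroid_homotopic 1 K (q z) f g"
proof -
  obtain N s where s: "continuous_on (cube 1) s" "s ` cube 1 \<subseteq> sph N" "\<And>x. x \<in> cube 1 \<Longrightarrow> q (s x) = f x"
    "s (pt 0) = z" "s (pt 1) = smul u z" "u \<in> mu" using has_degreeE[OF f] by blast
  obtain M t where t: "continuous_on (cube 1) t" "t ` cube 1 \<subseteq> sph M" "\<And>x. x \<in> cube 1 \<Longrightarrow> q (t x) = g x"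
    "t (pt 0) = z" "t (pt 1) = smul u z" "u \<in> mu" using has_degreeE[OF g] by blast
  have sub: "sph N \<subseteq> sph (max N M)" "sph M \<subseteq> sph (max N M)" by (auto intro!: sph_mono)
  show ?thesis
  proof (rule lifts_agreeing_on_boundary_homotopic[OF _ s(1) order_trans[OF s(2) sub(1)] s(3)
        t(1) order_trans[OF t(2) sub(2)] t(3)])
    show "\<forall>x\<in>cube_boundary 1. f x = q z"
      using has_degree_imp_spheroid[OF f] by (simp add: spheroid_iff)
    show "s x = t x" if "x \<in> cube_boundary 1" for x
      using that s(4,5) t(4,5) unfolding cube_boundary_1 by auto
  qed
qed

text \<open>The second half of the lift is rotated by u so that it starts where the first half ends.\<close>

lemma has_degree_concat:
  assumes f: "has_degree z f u" and g: "has_degree z g v"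
  shows "has_degree z (spheroid_concat f g) (u * v)"
proof -
  obtain N s where s: "continuous_on (cube 1) s" "s ` cube 1 \<subseteq> sph N" "\<And>x. x \<in> cube 1 \<Longrightarrow> q (s x) = f x"
    "s (pt 0) = z" "s (pt 1) = smul u z" "u \<in> mu" using has_degreeE[OF f] by blast
  obtain M t where t: "continuous_on (cube 1) t" "t ` cube 1 \<subseteq> sph M" "\<And>x. x \<in> cube 1 \<Longrightarrow> q (t x) = g x"
    "t (pt 0) = z" "t (pt 1) = smul v z" "v \<in> mu" using has_degreeE[OF g] by blast
  let ?A = "{x \<in> cube 1. x 0 \<le> 1/2}" and ?B = "{x \<in> cube 1. x 0 \<ge> 1/2}"
  define r where "r x = (if x 0 \<le> 1/2 then s (pt (2 * x 0)) else smul u (t (pt (2 * x 0 - 1))))" for x :: "nat \<Rightarrow> real"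
  have cube_01: "0 \<le> x 0 \<and> x 0 \<le> 1" if "x \<in> cube 1" for x using that by (auto simp: cube_def)
  have "closed {x :: nat \<Rightarrow> real. x 0 \<le> 1/2}" "closed {x :: nat \<Rightarrow> real. x 0 \<ge> 1/2}"
    by (intro closed_Collect_le continuous_on_coord continuous_on_const)+
  then have cl: "closed ?A" "closed ?B"
    using compact_imp_closed[OF compact_cube[of 1]] by (auto simp: Collect_conj_eq intro!: closed_Int)
  have "continuous_on (?A \<union> ?B) r"
    unfolding r_def
  proof (rule continuous_on_cases[OF cl])
    show "continuous_on ?A (\<lambda>x. s (pt (2 * x 0)))"
      by (rule continuous_on_compose2[OF s(1)]) (use cube_01 in \<open>auto intro!: continuous_intros continuous_on_coord\<close>)
    show "continuous_on ?B (\<lambda>x. smul u (t (pt (2 * x 0 - 1))))"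
      by (intro continuous_on_smul continuous_on_const continuous_on_compose2[OF t(1)])
        (use cube_01 in \<open>auto intro!: continuous_intros continuous_on_coord\<close>)
    have "s (pt (2 * x 0)) = smul u (t (pt (2 * x 0 - 1)))" if "x 0 = 1/2" for x :: "nat \<Rightarrow> real"
    proof -
      have "2 * x 0 = 1" using that by simp
      then show ?thesis unfolding \<open>2 * x 0 = 1\<close> using s(5) t(4) by simp
    qed
    then show "\<forall>x. x \<in> ?A \<and> \<not> x 0 \<le> 1/2 \<or> x \<in> ?B \<and> x 0 \<le> 1/2 \<longrightarrow>
        s (pt (2 * x 0)) = smul u (t (pt (2 * x 0 - 1)))" by force
  qed
  moreover have "?A \<union> ?B = cube 1" by auto
  ultimately have rc: "continuous_on (cube 1) r" by simp
  have sN: "s x \<in> sph (max N M)" "t x \<in> sph (max N M)" if "x \<in> cube 1" for x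
    using that s(2) t(2) sph_mono[of N "max N M"] sph_mono[of M "max N M"] by (auto simp: image_subset_iff)
  show ?thesis
  proof (rule has_degreeI[OF rc])
    show "r ` cube 1 \<subseteq> sph (max N M)"
    proof clarify
      fix x assume x: "x \<in> cube 1"
      then show "r x \<in> sph (max N M)" using cube_01[OF x] s(6)
        by (auto simp: r_def intro!: sN smul_in_sph)
    qed
    show "q (r x) = spheroid_concat f g x" if x: "x \<in> cube 1" for x
      using cube_01[OF x] s(3)[of "pt (2 * x 0)"] t(3)[of "pt (2 * x 0 - 1)"] s(6)
      unfolding spheroid_concat_def cube_1_upd[OF x] r_def by simp
    show "r (pt 0) = z" using s(4) by (simp add: r_def pt_def)
    show "r (pt 1) = smul (u * v) z" using t(5) by (simp add: r_def pt_def)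
    show "u * v \<in> mu" using s(6) t(6) by (rule mu_mult)
  qed
qed

lemma ex_loop_of_degree:
  assumes z: "z \<in> sph N" and u: "u \<in> mu"
  shows "\<exists>f. has_degree z f u"
proof -
  have "closedin (top_of_set (cube 1)) {pt 0, pt 1}" by (intro closed_subset) auto
  moreover have "continuous_on {pt 0, pt 1} (\<lambda>x. if x = pt 0 then z else smul u z)"
    by (rule continuous_on_finite) simp
  moreover have "(\<lambda>x. if x = pt 0 then z else smul u z) ` {pt 0, pt 1} \<subseteq> sph N"
    using z smul_in_sph[OF u z] by auto
  ultimately obtain T where T: "continuous_on (cube 1) T" "T ` cube 1 \<subseteq> sph (Suc N)"
    "\<And>x. x \<in> {pt 0, pt 1} \<Longrightarrow> T x = (if x = pt 0 then z else smul u z)"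
    using extend_to_next_sphere by blast
  have "has_degree z (\<lambda>x. q (T x)) u"
    by (rule has_degreeI[OF T(1,2)]) (use T(3)[of "pt 0"] T(3)[of "pt 1"] u in auto)
  then show ?thesis by (intro exI[of _ "\<lambda>x. q (T x)"])
qed

definition unity_root :: "int \<Rightarrow> complex" where
  "unity_root k = cis (2 * pi * of_int k / of_nat p)"

lemma unity_root_add: "unity_root (a + b) = unity_root a * unity_root b"
  by (simp add: unity_root_def cis_mult distrib_left add_divide_distrib)

lemma unity_root_mod: "unity_root (a mod int p) = unity_root a"
proof -
  have "unity_root (int p * (a div int p)) = cis (2 * pi * of_int (a div int p))"
    unfolding unity_root_def by (rule arg_cong[of _ _ cis]) simp
  also have "\<dots> = 1" by (rule cis_multiple_2pi) simp
  finally have "unity_root (int p * (a div int p) + a mod int p) = unity_root (a mod int p)" unfolding unity_root_add by simp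
  then show ?thesis by simp
qed

lemma bij_betw_unity_root: "bij_betw unity_root {0..<int p} mu"
proof -
  have "bij_betw (\<lambda>k. cis (2 * pi * real k / real p)) {..<p} mu"
    unfolding mu_def using Complex.bij_betw_roots_unity[OF p_pos(1)] by simp
  moreover have "bij_betw nat {0..<int p} {..<p}"
    by (rule bij_betw_byWitness[where f' = int]) auto
  ultimately have "bij_betw ((\<lambda>k. cis (2 * pi * real k / real p)) \<circ> nat) {0..<int p} mu"
    by (rule bij_betw_trans[rotated])
  then show ?thesis
    by (rule bij_betw_cong[THEN iffD1, rotated]) (simp add: unity_root_def)
qed

lemma unity_root_in_mu: "unity_root k \<in> mu"
proof -
  have "unity_root (k mod int p) \<in> mu" by (rule bij_betw_apply[OF bij_betw_unity_root]) simp
  then show ?thesis by (simp only: unity_root_mod)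
qed

text \<open>Homotopy classes of loops are the sets of loops of one degree, so the group is that of the roots of
  unity under multiplication.\<close>

lemma fundamental_group:
  assumes b: "b \<in> topspace K"
  shows "homotopy_group 1 K b \<cong> integer_mod_group p"
proof -
  obtain z N where z: "z \<in> sph N" "b = q z" using b by (auto simp: topspace_K sphinf_def)
  define C where "C k = {f. has_degree z f (unity_root k)}" for k
  have rt_mu: "unity_root k \<in> mu" if "k \<in> {0..<int p}" for k using bij_betw_unity_root that by (auto simp: bij_betw_def)
  have cls: "spheroid_class 1 K b f = C k" if "has_degree z f (unity_root k)" for f k
  proof -
    have "spheroid_homotopic 1 K (q z) f g \<longleftrightarrow> has_degree z g (unity_root k)" for g
    proof
      assume hom: "spheroid_homotopic 1 K (q z) f g"
      then obtain v where v: "has_degree z g v"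
        using ex_has_degree spheroid_homotopic_imp_spheroid(2) by blast
      then show "has_degree z g (unity_root k)" using homotopic_imp_same_degree[OF hom that v] by simp
    qed (rule same_degree_imp_homotopic[OF that])
    then show ?thesis by (simp add: spheroid_class_def C_def z)
  qed
  have degree_range: "\<exists>k\<in>{0..<int p}. u = unity_root k" if "has_degree z f u" for f u
  proof -
    have "u \<in> unity_root ` {0..<int p}" using that bij_betw_unity_root by (simp add: bij_betw_def has_degree_def)
    then show ?thesis by blast
  qed
  have carr: "carrier (homotopy_group 1 K b) = C ` {0..<int p}"
  proof
    show "carrier (homotopy_group 1 K b) \<subseteq> C ` {0..<int p}"
    proof
      fix \<alpha> assume "\<alpha> \<in> carrier (homotopy_group 1 K b)"
      then obtain f where f: "spheroid 1 K b f" "\<alpha> = spheroid_class 1 K b f" by (auto simp: homotopy_group_def)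
      obtain u where "has_degree z f u" using ex_has_degree[of z f] f z by auto
      then show "\<alpha> \<in> C ` {0..<int p}" using degree_range cls f by blast
    qed
    show "C ` {0..<int p} \<subseteq> carrier (homotopy_group 1 K b)"
    proof clarify
      fix k assume "k \<in> {0..<int p}"
      then obtain f where f: "has_degree z f (unity_root k)" using ex_loop_of_degree[OF z(1) rt_mu] by blast
      have "spheroid 1 K b f" using has_degree_imp_spheroid[OF f] z by simp
      then show "C k \<in> carrier (homotopy_group 1 K b)" using cls[OF f] by (auto simp: homotopy_group_def)
    qed
  qed
  have inj: "inj_on C {0..<int p}"
  proof (rule inj_onI)
    fix j k assume jk: "j \<in> {0..<int p}" "k \<in> {0..<int p}" "C j = C k"
    obtain f where f: "has_degree z f (unity_root j)" using ex_loop_of_degree[OF z(1) rt_mu[OF jk(1)]] by blast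
    then have "has_degree z f (unity_root k)" using jk(3) by (auto simp: C_def)
    then have "unity_root j = unity_root k"
      using homotopic_imp_same_degree[OF same_degree_imp_homotopic[OF f f] f] by blast
    then show "j = k" using bij_betw_unity_root jk by (auto simp: bij_betw_def inj_on_def)
  qed
  have mult: "C j \<otimes>\<^bsub>homotopy_group 1 K b\<^esub> C k = C ((j + k) mod int p)"
    if jk: "j \<in> {0..<int p}" "k \<in> {0..<int p}" for j k
  proof -
    have "C j \<otimes>\<^bsub>homotopy_group 1 K b\<^esub> C k
        = (\<Union>f\<in>C j. \<Union>g\<in>C k. spheroid_class 1 K b (spheroid_concat f g))"
      by (auto simp: homotopy_group_def spheroid_class_def)
    also have "\<dots> = (\<Union>f\<in>C j. \<Union>g\<in>C k. C ((j + k) mod int p))"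
    proof (intro SUP_cong refl)
      fix f g assume "f \<in> C j" "g \<in> C k"
      then have "has_degree z (spheroid_concat f g) (unity_root ((j + k) mod int p))"
        using has_degree_concat by (simp add: C_def unity_root_mod unity_root_add)
      then show "spheroid_class 1 K b (spheroid_concat f g) = C ((j + k) mod int p)" by (rule cls)
    qed
    also have "\<dots> = C ((j + k) mod int p)"
    proof -
      have "C j \<noteq> {}" "C k \<noteq> {}"
        using ex_loop_of_degree[OF z(1) rt_mu] jk by (auto simp: C_def)
      then show ?thesis by simp
    qed
    finally show ?thesis .
  qed
  let ?h = "inv_into {0..<int p} C"
  have "?h \<in> iso (homotopy_group 1 K b) (integer_mod_group p)"
  proof (rule isoI)
    show "?h \<in> hom (homotopy_group 1 K b) (integer_mod_group p)"
    proof (rule homI)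
      fix x assume "x \<in> carrier (homotopy_group 1 K b)"
      then show "?h x \<in> carrier (integer_mod_group p)"
        using inv_into_into[of x C "{0..<int p}"] by (simp add: carr carrier_integer_mod_group)
    next
      fix x y assume "x \<in> carrier (homotopy_group 1 K b)" "y \<in> carrier (homotopy_group 1 K b)"
      then obtain j k where jk: "j \<in> {0..<int p}" "k \<in> {0..<int p}" "x = C j" "y = C k"
        by (auto simp: carr)
      have "(j + k) mod int p \<in> {0..<int p}" by simp
      then show "?h (x \<otimes>\<^bsub>homotopy_group 1 K b\<^esub> y) = ?h x \<otimes>\<^bsub>integer_mod_group p\<^esub> ?h y"
        using jk mult[OF jk(1,2)] inj by (simp only: inv_into_f_f mult_integer_mod_group)
    qed
    show "bij_betw ?h (carrier (homotopy_group 1 K b)) (carrier (integer_mod_group p))"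
      unfolding carr carrier_integer_mod_group using inj
      by (simp add: bij_betw_inv_into bij_betw_imageI)
  qed
  then show ?thesis by (auto simp: is_iso_def)
qed

end

declare One_nat_def [simp]

section \<open>The cell structure of the lens space\<close>

lemma Arg2pi_polar: assumes "r > 0" "0 \<le> a" "a < 2 * pi" shows "Arg2pi (of_real r * cis a) = a"
  using Arg2pi_unique[of r a] assms by (simp add: cis_conv_exp)

lemma polar_Arg2pi: "z = of_real (cmod z) * cis (Arg2pi z)"
  using Arg2pi_eq[of z] by (simp add: cis_conv_exp)

lemma closed_disc_eq: "closed_disc n = top_of_set {x. (\<forall>i\<ge>n. x i = 0) \<and> (\<Sum>i<n. (x i)\<^sup>2) \<le> 1}"
  by (simp add: closed_disc_def Euclidean_space_def euclidean_product_topology subtopology_subtopology Collect_conj_eq)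

lemma topspace_closed_disc: "topspace (closed_disc n) = {x. (\<forall>i\<ge>n. x i = 0) \<and> (\<Sum>i<n. (x i)\<^sup>2) \<le> 1}"
  by (simp add: closed_disc_eq)

lemma open_disc_eq: "open_disc n = {x. (\<forall>i\<ge>n. x i = 0) \<and> (\<Sum>i<n. (x i)\<^sup>2) < 1}"
  by (auto simp: open_disc_def topspace_Euclidean_space)

lemma disc_boundary_eq: "disc_boundary n = {x. (\<forall>i\<ge>n. x i = 0) \<and> (\<Sum>i<n. (x i)\<^sup>2) = 1}"
  by (auto simp: disc_boundary_def topspace_Euclidean_space)

lemma sum_pairs: fixes m :: nat shows "(\<Sum>i<2 * m. (x i)\<^sup>2) = (\<Sum>j<m. (cmod (Complex (x (2 * j)) (x (2 * j + 1))))\<^sup>2)"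
proof (induction m)
  case (Suc m)
  have "{..<2 * Suc m} = insert (2 * m + 1) (insert (2 * m) {..<2 * m})" by auto
  then show ?case using Suc by (simp add: cmod_power2)
qed simp

context root_of_unity_group
begin

text \<open>Half of the angle of a fundamental sector.  It is at most a right angle because p is at least 2, which
  makes the formula for arcs below injective.\<close>

definition \<theta> :: real where
  "\<theta> = pi / real p"

lemma theta: "0 < \<theta>" "\<theta> \<le> pi / 2" "sin \<theta> > 0" "cos \<theta> \<ge> 0" "sin \<theta> \<le> 1" "2 * \<theta> \<le> 2 * pi"
proof -
  show 1: "0 < \<theta>" by (simp add: \<theta>_def)
  show 2: "\<theta> \<le> pi / 2" unfolding \<theta>_def using p2 by (intro divide_left_mono) auto
  then have "\<theta> < pi" using pi_gt_zero by linarith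
  with 1 show "sin \<theta> > 0" by (intro sin_gt_zero)
  show "cos \<theta> \<ge> 0" using 1 2 pi_gt_zero by (intro cos_ge_zero) linarith+
  show "sin \<theta> \<le> 1" by simp
  show "2 * \<theta> \<le> 2 * pi" using 2 pi_gt_zero by linarith
qed

definition sector :: "complex \<Rightarrow> bool" where
  "sector w \<longleftrightarrow> w \<noteq> 0 \<and> Arg2pi w < 2 * \<theta>"

text \<open>A nontrivial rotation by a multiple of the sector angle leaves the half-open sector.\<close>

lemma sector_unique:
  assumes w: "sector w" "sector (u * w)" and u: "u \<in> mu"
  shows "u = 1"
proof -
  have "u \<in> unity_root ` {0..<int p}" using u bij_betw_unity_root by (simp add: bij_betw_def)
  then obtain k where k: "k \<in> {0..<int p}" "u = unity_root k" by blast
  define a where "a = Arg2pi w"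
  have "unity_root k = cis (of_int k * (2 * \<theta>))" by (simp add: unity_root_def \<theta>_def mult.commute mult.left_commute)
  then have uw: "u * w = of_real (cmod w) * cis (a + of_int k * (2 * \<theta>))"
    using polar_Arg2pi[of w] k by (metis a_def cis_mult mult.commute mult.left_commute)
  have pos: "cmod w > 0" using w by (simp add: sector_def)
  have a: "0 \<le> a" "a < 2 * \<theta>" using w Arg2pi_ge_0 by (auto simp: a_def sector_def)
  have k0: "0 \<le> real_of_int k * (2 * \<theta>)" using k theta by simp
  have "real_of_int k * (2 * \<theta>) \<le> real_of_int (int p - 1) * (2 * \<theta>)"
    using k theta by (intro mult_right_mono) auto
  also have "\<dots> = 2 * pi - 2 * \<theta>" by (simp add: \<theta>_def left_diff_distrib diff_divide_distrib)
  finally have "a + of_int k * (2 * \<theta>) < 2 * pi" using a by linarith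
  then have "Arg2pi (u * w) = a + of_int k * (2 * \<theta>)"
    unfolding uw using pos a k0 by (intro Arg2pi_polar) auto
  moreover have "Arg2pi (u * w) < 2 * \<theta>" using w(2) by (simp add: sector_def)
  ultimately have lt: "of_int k * (2 * \<theta>) < 1 * (2 * \<theta>)" using a(1) by linarith
  have "real_of_int k < 1" using lt theta(1) by (subst (asm) mult_less_cancel_right) auto
  then have "k = 0" using k by simp
  then show ?thesis using k by (simp add: unity_root_def)
qed

lemma sector_exists:
  assumes "w \<noteq> 0"
  shows "\<exists>u\<in>mu. sector (u * w)"
proof -
  define a where "a = Arg2pi w"
  define k where "k = \<lfloor>a / (2 * \<theta>)\<rfloor>"
  define b where "b = a - of_int k * (2 * \<theta>)"
  have a: "0 \<le> a" "a < 2 * pi" using Arg2pi_ge_0 Arg2pi_lt_2pi by (auto simp: a_def)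
  have "of_int k \<le> a / (2 * \<theta>)" "a / (2 * \<theta>) < of_int k + 1" by (auto simp: k_def)
  then have "of_int k * (2 * \<theta>) \<le> a" "a < (of_int k + 1) * (2 * \<theta>)"
    using theta(1) by (simp_all add: pos_le_divide_eq pos_divide_less_eq)
  then have b: "0 \<le> b" "b < 2 * \<theta>" by (auto simp: b_def distrib_right)
  have u: "unity_root (- k) \<in> mu" by (rule unity_root_in_mu)
  have "unity_root (- k) * w = cis (- (of_int k * (2 * \<theta>))) * (of_real (cmod w) * cis a)"
    using polar_Arg2pi[of w] by (simp add: a_def unity_root_def \<theta>_def mult.commute mult.left_commute)
  also have "\<dots> = of_real (cmod w) * cis b"
    by (simp add: b_def cis_mult mult.left_commute)
  finally have eq: "unity_root (- k) * w = of_real (cmod w) * cis b" .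
  have "Arg2pi (unity_root (- k) * w) = b"
    unfolding eq using assms b theta by (intro Arg2pi_polar) auto
  moreover have "unity_root (- k) * w \<noteq> 0" using mu_nz[OF u] assms by simp
  ultimately show ?thesis using u b by (intro bexI[of _ "unity_root (- k)"]) (simp_all add: sector_def)
qed

text \<open>For t between minus and plus the square root of r this runs through the arc of radius sqrt r with
  angles from 0 to twice theta.  The parameter is the position of the orthogonal projection to the
  chord, up to scale; unlike a parametrisation by the angle it stays continuous when r goes to 0.\<close>

definition arc :: "real \<Rightarrow> real \<Rightarrow> complex" where
  "arc r t = cis \<theta> * Complex (sqrt (r - (t * sin \<theta>)\<^sup>2)) (t * sin \<theta>)"

lemma cmod_arc: assumes "t\<^sup>2 \<le> r" shows "(cmod (arc r t))\<^sup>2 = r"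
proof -
  have "(t * sin \<theta>)\<^sup>2 \<le> t\<^sup>2 * 1"
    unfolding power_mult_distrib using theta by (intro mult_left_mono) (auto simp: power_le_one)
  then have "(t * sin \<theta>)\<^sup>2 \<le> r" using assms by linarith
  then show ?thesis by (simp add: arc_def norm_mult cmod_power2)
qed

lemma arc_inject:
  assumes "arc r t = arc r' t'" shows "t = t'"
proof -
  have "cis (-\<theta>) * arc r t = cis (-\<theta>) * arc r' t'" using assms by simp
  then show ?thesis using theta(3) by (simp add: arc_def cis_mult flip: mult.assoc)
qed

lemma Arg2pi_arc:
  assumes "t\<^sup>2 < r"
  shows "arc r t \<noteq> 0" "0 < Arg2pi (arc r t)" "Arg2pi (arc r t) < 2 * \<theta>"
proof -
  define \<rho> where "\<rho> = sqrt r"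
  have r: "r > 0" using assms zero_le_power2[of t] by linarith
  then have \<rho>: "\<rho> > 0" "\<rho>\<^sup>2 = r" by (auto simp: \<rho>_def)
  define y where "y = t * sin \<theta> / \<rho>"
  have "\<bar>t\<bar> < \<rho>" using assms \<rho> by (metis abs_ge_zero power2_abs power2_less_imp_less less_imp_le)
  then have "\<bar>t\<bar> * sin \<theta> < \<rho> * sin \<theta>" using theta(3) by (rule mult_strict_right_mono)
  then have y: "\<bar>y\<bar> < sin \<theta>" using \<rho> theta(3) by (simp add: y_def abs_mult field_simps)
  then have y1: "-1 \<le> y" "y \<le> 1" using theta(5) by linarith+
  have as: "arcsin (sin \<theta>) = \<theta>" "arcsin (- sin \<theta>) = - \<theta>"
    using theta arcsin_sin[of \<theta>] arcsin_sin[of "-\<theta>"] by auto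
  have phi: "arcsin y < \<theta>" "- \<theta> < arcsin y"
    using arcsin_less_arcsin[of y "sin \<theta>"] arcsin_less_arcsin[of "- sin \<theta>" y] y y1 theta as by auto
  have "of_real \<rho> * cis (arcsin y) = Complex (\<rho> * sqrt (1 - y\<^sup>2)) (\<rho> * y)"
    using y1 by (simp add: complex_eq_iff cos_arcsin)
  also have "\<rho> * y = t * sin \<theta>" using \<rho> by (simp add: y_def)
  also have "\<rho> * sqrt (1 - y\<^sup>2) = sqrt (\<rho>\<^sup>2 * (1 - y\<^sup>2))" using \<rho>(1) by (simp add: real_sqrt_mult)
  also have "\<rho>\<^sup>2 * (1 - y\<^sup>2) = r - (t * sin \<theta>)\<^sup>2"
    using \<rho> r by (simp add: y_def right_diff_distrib power_divide)
  finally have "arc r t = of_real \<rho> * cis (\<theta> + arcsin y)"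
    unfolding arc_def by (simp add: cis_mult[symmetric] mult.left_commute)
  moreover have "Arg2pi (of_real \<rho> * cis (\<theta> + arcsin y)) = \<theta> + arcsin y"
    using phi theta \<rho> by (intro Arg2pi_polar) linarith+
  ultimately show "arc r t \<noteq> 0" "0 < Arg2pi (arc r t)" "Arg2pi (arc r t) < 2 * \<theta>"
    using phi \<rho> by auto
qed

lemma arc_surj:
  assumes "w \<noteq> 0" "0 < Arg2pi w" "Arg2pi w < 2 * \<theta>"
  shows "\<exists>t. t\<^sup>2 < (cmod w)\<^sup>2 \<and> w = arc ((cmod w)\<^sup>2) t"
proof -
  define \<phi> where "\<phi> = Arg2pi w - \<theta>"
  define t where "t = cmod w * (sin \<phi> / sin \<theta>)"
  have phi: "- \<theta> < \<phi>" "\<phi> < \<theta>" using assms by (auto simp: \<phi>_def)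
  have "sin \<phi> < sin \<theta>" using phi theta by (intro sin_monotone_2pi) linarith+
  moreover have "sin (- \<theta>) < sin \<phi>" using phi theta by (intro sin_monotone_2pi) linarith+
  ultimately have "\<bar>sin \<phi>\<bar> < sin \<theta>" by (simp add: abs_less_iff)
  then have "\<bar>sin \<phi> / sin \<theta>\<bar> < 1" using theta(3) by (simp add: abs_divide)
  then have "cmod w * \<bar>sin \<phi> / sin \<theta>\<bar> < cmod w * 1" using assms(1) by (intro mult_strict_left_mono) auto
  then have "\<bar>t\<bar> < cmod w" by (simp add: t_def abs_mult)
  then have t2: "t\<^sup>2 < (cmod w)\<^sup>2" by (metis abs_ge_zero power2_abs power_strict_mono zero_less_numeral)
  have ts: "t * sin \<theta> = cmod w * sin \<phi>" using theta(3) by (simp add: t_def)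
  have "cos \<phi> \<ge> 0" using phi theta by (intro cos_ge_zero) linarith+
  moreover have "(cmod w)\<^sup>2 - (cmod w * sin \<phi>)\<^sup>2 = (cmod w * cos \<phi>)\<^sup>2"
    by (simp add: power_mult_distrib cos_squared_eq right_diff_distrib)
  ultimately have "sqrt ((cmod w)\<^sup>2 - (cmod w * sin \<phi>)\<^sup>2) = cmod w * cos \<phi>" by simp
  then have "arc ((cmod w)\<^sup>2) t = cis \<theta> * (of_real (cmod w) * cis \<phi>)"
    unfolding arc_def ts by (simp add: complex_eq_iff)
  also have "\<dots> = of_real (cmod w) * cis (Arg2pi w)" by (simp add: \<phi>_def cis_mult mult.left_commute)
  also have "\<dots> = w" using polar_Arg2pi by simp
  finally show ?thesis using t2 by metis
qed

text \<open>The square of the modulus that is left for the last coordinate of a unit vector.\<close>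

definition rest :: "nat \<Rightarrow> (nat \<Rightarrow> real) \<Rightarrow> real" where
  "rest m x = 1 - (\<Sum>i<2 * m. (x i)\<^sup>2)"

text \<open>Every orbit has a unique representative whose last nonzero coordinate, at index m, lies in the
  half-open sector.  The cell of dimension 2 m consists of those orbits for which this coordinate is
  positive, the cell of dimension 2 m + 1 of the others; the remaining freedom is the vector of the first m
  coordinates and, in odd dimensions, the position on the arc.\<close>

definition cell :: "nat \<Rightarrow> (nat \<Rightarrow> real) \<Rightarrow> nat \<Rightarrow> complex" where
  "cell n x j = (let m = n div 2 in
     if j < m then Complex (x (2 * j)) (x (2 * j + 1))
     else if j = m then (if even n then of_real (sqrt (rest m x)) else arc (rest m x) (x (2 * m)))
     else 0)"

lemma cell_lt: "j < n div 2 \<Longrightarrow> cell n x j = Complex (x (2 * j)) (x (2 * j + 1))"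
  by (simp add: cell_def)

lemma cell_gt: "j > n div 2 \<Longrightarrow> cell n x j = 0"
  by (simp add: cell_def)

lemma cell_even: "cell (2 * m) x m = of_real (sqrt (rest m x))"
  by (simp add: cell_def)

lemma cell_odd: "cell (2 * m + 1) x m = arc (rest m x) (x (2 * m))"
  by (simp add: cell_def)

lemma continuous_on_cell: "continuous_on S (cell n)"
proof (rule continuous_on_coordinatewise_then_product)
  fix j
  have r: "continuous_on S (rest m)" for m
    unfolding rest_def by (intro continuous_intros continuous_on_coord)
  consider "j < n div 2" | "j = n div 2" "even n" | "j = n div 2" "odd n" | "j > n div 2" by linarith
  then show "continuous_on S (\<lambda>x. cell n x j)"
    unfolding cell_def Let_def arc_def
    by cases (auto intro!: continuous_intros continuous_on_coord r)
qed

lemma sum_cell: "(\<Sum>j<m. (cmod (z j))\<^sup>2) = 1 - rest m x" if "\<And>j. j < m \<Longrightarrow> z j = Complex (x (2 * j)) (x (2 * j + 1))"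
  unfolding rest_def sum_pairs using that by simp

lemma cell_in_sph:
  assumes "x \<in> topspace (closed_disc n)"
  shows "cell n x \<in> sph (Suc (n div 2))"
proof -
  define m where "m = n div 2"
  have s: "(\<Sum>j<m. (cmod (cell n x j))\<^sup>2) = 1 - rest m x"
    by (rule sum_cell) (simp add: cell_lt m_def)
  have "(cmod (cell n x m))\<^sup>2 = rest m x"
  proof (cases "even n")
    case True
    then have n: "n = 2 * m" by (simp add: m_def)
    then have "rest m x \<ge> 0" using assms by (simp add: topspace_closed_disc rest_def)
    then show ?thesis using n cell_even[of m x] by simp
  next
    case False
    then have n: "n = 2 * m + 1" by (simp add: m_def)
    then have "(x (2 * m))\<^sup>2 \<le> rest m x" using assms by (simp add: topspace_closed_disc rest_def)
    then show ?thesis using n cell_odd[of m x] cmod_arc by simp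
  qed
  then have "(\<Sum>j<Suc m. (cmod (cell n x j))\<^sup>2) = 1" using s by simp
  then show ?thesis using cell_gt[of n] by (auto simp: sph_def m_def)
qed

lemma open_disc_subset: "open_disc n \<subseteq> topspace (closed_disc n)"
  by (auto simp: open_disc_eq topspace_closed_disc)

lemma cell_sector:
  assumes x: "x \<in> open_disc n"
  shows "sector (cell n x (n div 2))" "Arg2pi (cell n x (n div 2)) = 0 \<longleftrightarrow> even n"
proof -
  define m where "m = n div 2"
  have "sector (cell n x m) \<and> (Arg2pi (cell n x m) = 0 \<longleftrightarrow> even n)"
  proof (cases "even n")
    case True
    then have n: "n = 2 * m" by (simp add: m_def)
    then have "rest m x > 0" using x by (simp add: open_disc_eq rest_def)
    then have "Arg2pi (cell n x m) = 0" "cell n x m \<noteq> 0"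
      unfolding n cell_even by (auto simp: Arg2pi_eq_0)
    then show ?thesis using True theta by (simp add: sector_def)
  next
    case False
    then have n: "n = 2 * m + 1" by (simp add: m_def)
    then have "(x (2 * m))\<^sup>2 < rest m x" using x by (simp add: open_disc_eq rest_def)
    from Arg2pi_arc[OF this] show ?thesis using False unfolding sector_def n cell_odd by auto
  qed
  then show "sector (cell n x (n div 2))" "Arg2pi (cell n x (n div 2)) = 0 \<longleftrightarrow> even n" by (auto simp: m_def)
qed

text \<open>The last nonzero index is determined by the orbit, uniqueness in the sector shows that the
  representatives coincide, and the argument being 0 or not decides the parity of the dimension.\<close>

lemma cell_unique:
  assumes x: "x \<in> open_disc n" and y: "y \<in> open_disc k" and eq: "q (cell n x) = q (cell k y)"
  shows "n = k" "x = y"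
proof -
  obtain u where u: "u \<in> mu" "cell k y = smul u (cell n x)" using eq by (auto simp: q_eq_iff)
  have nz: "cell n x (n div 2) \<noteq> 0" "cell k y (k div 2) \<noteq> 0"
    using cell_sector(1)[OF x] cell_sector(1)[OF y] by (auto simp: sector_def)
  have iff: "cell k y j = 0 \<longleftrightarrow> cell n x j = 0" for j using u mu_nz by (simp add: smul_def)
  have m: "n div 2 = k div 2"
  proof (rule antisym)
    show "n div 2 \<le> k div 2" using nz(1) cell_gt[of k "n div 2" y] iff by (meson linorder_not_le)
    show "k div 2 \<le> n div 2" using nz(2) cell_gt[of n "k div 2" x] iff by (meson linorder_not_le)
  qed
  have "sector (u * cell n x (n div 2))"
    using cell_sector(1)[OF y] u(2) m by (simp add: smul_def)
  then have "u = 1" using sector_unique[OF cell_sector(1)[OF x] _ u(1)] by blast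
  then have c: "cell k y = cell n x" using u by simp
  then have "even n \<longleftrightarrow> even k" using cell_sector(2)[OF x] cell_sector(2)[OF y] m by simp
  then show nk: "n = k" using m by presburger
  show "x = y"
  proof
    fix i
    have "i < 2 * (n div 2) \<or> (odd n \<and> i = 2 * (n div 2)) \<or> i \<ge> n" by presburger
    then consider "i < 2 * (n div 2)" | "odd n" "i = 2 * (n div 2)" | "i \<ge> n" by blast
    then show "x i = y i"
    proof cases
      case 1
      define j where "j = i div 2"
      have j: "j < n div 2" using 1 by (simp add: j_def)
      have "Complex (x (2 * j)) (x (2 * j + 1)) = Complex (y (2 * j)) (y (2 * j + 1))"
        using cell_lt[OF j, of x] cell_lt[OF j, of y] c nk by simp
      moreover have "i = 2 * j \<or> i = 2 * j + 1" by (auto simp: j_def)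
      ultimately show ?thesis by auto
    next
      case 2
      define m where "m = n div 2"
      have n: "n = 2 * m + 1" using 2 by (simp add: m_def)
      have "arc (rest m x) (x (2 * m)) = arc (rest m y) (y (2 * m))"
        using cell_odd[of m x] cell_odd[of m y] c nk n by simp
      then show ?thesis using arc_inject 2 by (simp add: m_def)
    next
      case 3
      then show ?thesis using x y nk by (simp add: open_disc_eq)
    qed
  qed
qed

lemma cell_exists_even:
  assumes z: "z \<in> sph (Suc m)" and zm: "z m \<noteq> 0" "Arg2pi (z m) = 0"
  shows "\<exists>x\<in>open_disc (2 * m). cell (2 * m) x = z"
proof -
  define x where "x i = (if i < 2 * m then enc z i else 0)" for i
  have C: "Complex (x (2 * j)) (x (2 * j + 1)) = z j" if "j < m" for j
    using that by (simp add: x_def enc_def)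
  have "(\<Sum>j<m. (cmod (z j))\<^sup>2) = 1 - rest m x" by (rule sum_cell) (rule C[symmetric])
  then have rest: "rest m x = (cmod (z m))\<^sup>2" using z by (simp add: sph_def)
  have "(cmod (z m))\<^sup>2 > 0" using zm by simp
  then have "(\<Sum>i<2 * m. (x i)\<^sup>2) < 1" using rest unfolding rest_def by linarith
  then have "x \<in> open_disc (2 * m)" by (simp add: open_disc_eq x_def)
  moreover have "cell (2 * m) x j = z j" for j
  proof -
    have "z m = of_real (cmod (z m))" using polar_Arg2pi[of "z m"] zm by simp
    then show ?thesis
      using C[of j] rest z by (auto simp: cell_def sph_def not_less_eq_eq)
  qed
  ultimately show ?thesis by blast
qed

lemma cell_exists_odd:
  assumes z: "z \<in> sph (Suc m)" and zm: "z m \<noteq> 0" "0 < Arg2pi (z m)" "Arg2pi (z m) < 2 * \<theta>"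
  shows "\<exists>x\<in>open_disc (2 * m + 1). cell (2 * m + 1) x = z"
proof -
  obtain t where t: "t\<^sup>2 < (cmod (z m))\<^sup>2" "z m = arc ((cmod (z m))\<^sup>2) t" using arc_surj[OF zm] by blast
  define x where "x i = (if i < 2 * m then enc z i else if i = 2 * m then t else 0)" for i
  have C: "Complex (x (2 * j)) (x (2 * j + 1)) = z j" if "j < m" for j
    using that by (simp add: x_def enc_def)
  have "(\<Sum>j<m. (cmod (z j))\<^sup>2) = 1 - rest m x" by (rule sum_cell) (rule C[symmetric])
  then have rest: "rest m x = (cmod (z m))\<^sup>2" using z by (simp add: sph_def)
  have "x (2 * m) = t" by (simp add: x_def)
  then have "(\<Sum>i<2 * m + 1. (x i)\<^sup>2) < 1" using rest t(1) by (simp add: rest_def)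
  then have "x \<in> open_disc (2 * m + 1)" by (simp add: open_disc_eq x_def)
  moreover have "cell (2 * m + 1) x j = z j" for j
    using C[of j] rest z t(2) \<open>x (2 * m) = t\<close> by (auto simp: cell_def sph_def not_less_eq_eq)
  ultimately show ?thesis by blast
qed

lemma cell_exists:
  assumes z: "z \<in> sph N"
  shows "\<exists>n<2 * N. \<exists>x\<in>open_disc n. q (cell n x) = q z"
proof -
  have "{i. z i \<noteq> 0} \<noteq> {}" "finite {i. z i \<noteq> 0}"
  proof -
    have "\<exists>i. z i \<noteq> 0"
    proof (rule ccontr)
      assume "\<not> ?thesis"
      then show False using z by (simp add: sph_def)
    qed
    then show "{i. z i \<noteq> 0} \<noteq> {}" by auto
    have "{i. z i \<noteq> 0} \<subseteq> {..<N}" using z by (auto simp: sph_def not_le[symmetric])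
    then show "finite {i. z i \<noteq> 0}" by (rule finite_subset) simp
  qed
  define m where "m = Max {i. z i \<noteq> 0}"
  have m0: "z m \<noteq> 0"
    using Max_in[OF \<open>finite {i. z i \<noteq> 0}\<close> \<open>{i. z i \<noteq> 0} \<noteq> {}\<close>] unfolding m_def by blast
  have "i \<le> m" if "z i \<noteq> 0" for i
    unfolding m_def by (rule Max_ge[OF \<open>finite {i. z i \<noteq> 0}\<close>]) (use that in blast)
  with m0 have m: "z m \<noteq> 0" "\<And>i. i > m \<Longrightarrow> z i = 0" by (auto simp: not_le[symmetric])
  have mN: "m < N" using m(1) z by (auto simp: sph_def not_le[symmetric])
  have zs: "z \<in> sph (Suc m)"
  proof -
    have "(\<Sum>i<N. (cmod (z i))\<^sup>2) = (\<Sum>i<Suc m. (cmod (z i))\<^sup>2)"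
      by (rule sum.mono_neutral_right) (use mN m in auto)
    then show ?thesis using z m by (simp add: sph_def)
  qed
  obtain u where u: "u \<in> mu" "sector (u * z m)" using sector_exists[OF m(1)] by blast
  define w where "w = smul u z"
  have "q w = q z" unfolding w_def by (rule q_smul[OF u(1)])
  with smul_in_sph[OF u(1) zs] u have w: "w \<in> sph (Suc m)" "w m \<noteq> 0" "Arg2pi (w m) < 2 * \<theta>" "q w = q z"
    by (simp_all add: w_def sector_def smul_def)
  show ?thesis
  proof (cases "Arg2pi (w m) = 0")
    case True
    then show ?thesis using cell_exists_even[OF w(1,2)] w(4) mN by (intro exI[of _ "2 * m"]) auto
  next
    case False
    then have "0 < Arg2pi (w m)" using Arg2pi_ge_0[of "w m"] by linarith
    then show ?thesis using cell_exists_odd[OF w(1,2) _ w(3)] w(4) mN by (intro exI[of _ "2 * m + 1"]) auto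
  qed
qed

text \<open>On the boundary either the last coordinate vanishes, so that a shorter vector remains, or the arc
  parameter is extremal, and then the last coordinate is positive up to rotation, which is the case of the
  even cell one dimension below.\<close>

lemma cell_boundary:
  assumes x: "x \<in> disc_boundary n"
  shows "\<exists>k<n. q (cell n x) \<in> (\<lambda>y. q (cell k y)) ` open_disc k"
proof -
  define m where "m = n div 2"
  have xd: "x \<in> topspace (closed_disc n)" using x by (auto simp: disc_boundary_eq topspace_closed_disc)
  have zs: "cell n x \<in> sph (Suc m)" using cell_in_sph[OF xd] by (simp add: m_def)
  have mn: "2 * m \<le> n" by (simp add: m_def)
  show ?thesis
  proof (cases "cell n x m = 0")
    case True
    have "cell n x \<in> sph m"
    proof -
      have "cell n x i = 0" if "i \<ge> m" for i
        using that True zs by (cases "i = m") (auto simp: sph_def)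
      then show ?thesis using zs True by (simp add: sph_def)
    qed
    from cell_exists[OF this] obtain k y where ky: "k < 2 * m" "y \<in> open_disc k" "q (cell k y) = q (cell n x)"
      by blast
    have "q (cell n x) \<in> (\<lambda>y. q (cell k y)) ` open_disc k"
      unfolding ky(3)[symmetric] by (rule imageI[OF ky(2)])
    then show ?thesis using ky(1) mn by (intro exI[of _ k]) simp
  next
    case False
    have "odd n"
    proof
      assume "even n"
      then have n: "n = 2 * m" by (simp add: m_def)
      then have "rest m x = 0" using x by (simp add: disc_boundary_eq rest_def)
      then show False using False cell_even[of m x] n by simp
    qed
    then have n: "n = 2 * m + 1" by (simp add: m_def)
    define t where "t = x (2 * m)"
    have r: "rest m x = t\<^sup>2" using x n by (simp add: disc_boundary_eq rest_def t_def)
    have "cell n x m = arc (t\<^sup>2) t" using cell_odd[of m x] n r t_def by simp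
    also have "\<dots> = cis \<theta> * Complex (\<bar>t\<bar> * cos \<theta>) (t * sin \<theta>)"
    proof -
      have "t\<^sup>2 - (t * sin \<theta>)\<^sup>2 = (t * cos \<theta>)\<^sup>2"
        by (simp add: power_mult_distrib cos_squared_eq right_diff_distrib)
      then show ?thesis using theta(4) by (simp add: arc_def abs_mult)
    qed
    finally have c: "cell n x m = cis \<theta> * Complex (\<bar>t\<bar> * cos \<theta>) (t * sin \<theta>)" .
    have t0: "t \<noteq> 0"
    proof
      assume "t = 0"
      then show False using c False by (simp add: complex_eq_iff)
    qed
    have "\<exists>u\<in>mu. u * cell n x m = of_real \<bar>t\<bar>"
    proof (cases "t > 0")
      case True
      have "Complex (\<bar>t\<bar> * cos \<theta>) (t * sin \<theta>) = of_real \<bar>t\<bar> * cis \<theta>"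
        using True by (simp add: complex_eq_iff)
      then have "cell n x m = of_real \<bar>t\<bar> * cis (2 * \<theta>)"
        using c by (simp add: cis_mult mult.left_commute)
      then have "unity_root (-1) * cell n x m = of_real \<bar>t\<bar>"
        by (simp add: unity_root_def \<theta>_def cis_mult mult.left_commute)
      moreover have "unity_root (-1) \<in> mu" by (rule unity_root_in_mu)
      ultimately show ?thesis by blast
    next
      case False
      have "Complex (\<bar>t\<bar> * cos \<theta>) (t * sin \<theta>) = of_real \<bar>t\<bar> * cis (- \<theta>)"
        using False by (simp add: complex_eq_iff)
      then have "cell n x m = of_real \<bar>t\<bar>"
        using c by (simp add: cis_mult mult.left_commute)
      then have "1 * cell n x m = of_real \<bar>t\<bar>" by simp
      then show ?thesis using one_in_mu by blast
    qed
    then obtain u where u: "u \<in> mu" "u * cell n x m = of_real \<bar>t\<bar>" by blast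
    define w where "w = smul u (cell n x)"
    have "w m = of_real \<bar>t\<bar>" using u by (simp add: w_def smul_def)
    then have "w m \<noteq> 0" "Arg2pi (w m) = 0" using t0 by (auto simp: Arg2pi_eq_0)
    then obtain y where y: "y \<in> open_disc (2 * m)" "cell (2 * m) y = w"
      using cell_exists_even[of w m] smul_in_sph[OF u(1) zs] by (auto simp: w_def)
    have "q (cell n x) = q (cell (2 * m) y)" unfolding y(2) w_def by (rule q_smul[OF u(1), symmetric])
    then have "q (cell n x) \<in> (\<lambda>y. q (cell (2 * m) y)) ` open_disc (2 * m)" using y(1) by (simp only: image_eqI)
    then show ?thesis using n by (intro exI[of _ "2 * m"]) simp
  qed
qed

text \<open>Distinct orbits have positive distance in the finitely many coordinates that they involve.\<close>

lemma Hausdorff_K: "Hausdorff_space K"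
  unfolding Hausdorff_space_def
proof (intro allI impI, elim conjE)
  fix a b assume "a \<in> topspace K" "b \<in> topspace K" and ab: "a \<noteq> b"
  then obtain z w where zw: "z \<in> sphinf" "w \<in> sphinf" "a = q z" "b = q w" by (auto simp: topspace_K)
  obtain N where N: "z \<in> sph N" "w \<in> sph N" using sphinf_common[OF zw(1,2)] .
  define e where "e = Min (insert 1 ((\<lambda>u. l1 N z (smul u w)) ` mu))"
  have pos: "l1 N z (smul u w) > 0" if "u \<in> mu" for u
  proof (rule ccontr)
    assume "\<not> ?thesis"
    then have "l1 N z (smul u w) = 0" using l1_nonneg[of N z "smul u w"] by linarith
    then have "z i = smul u w i" if "i < N" for i
      using that by (simp add: l1_def sum_nonneg_eq_0_iff)
    moreover have "z i = smul u w i" if "i \<ge> N" for i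
      using that N by (simp add: sph_def smul_def)
    ultimately have "z = smul u w" by (intro ext) (meson linorder_not_le)
    then have "q z = q w" using \<open>u \<in> mu\<close> by simp
    then show False using ab zw by simp
  qed
  have e: "e > 0" "\<And>u. u \<in> mu \<Longrightarrow> e \<le> l1 N z (smul u w)"
    unfolding e_def using finite_mu pos by (auto intro!: Min_le)
  let ?U = "q ` (sphinf \<inter> {v. l1 N z v < e / 2})" and ?V = "q ` (sphinf \<inter> {v. l1 N w v < e / 2})"
  have "?U \<inter> ?V = {}"
  proof (rule ccontr)
    assume "?U \<inter> ?V \<noteq> {}"
    then obtain v v' where v: "l1 N z v < e / 2" "l1 N w v' < e / 2" "q v' = q v" by auto
    then obtain u where u: "u \<in> mu" "v = smul u v'" by (auto simp: q_eq_iff)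
    have "l1 N z (smul u w) \<le> l1 N z v + l1 N v (smul u w)" by (rule l1_triangle)
    also have "l1 N v (smul u w) = l1 N v' w" using u l1_smul mu_cmod by simp
    finally have "l1 N z (smul u w) < e" using v by (simp add: l1_commute)
    then show False using e(2)[OF u(1)] by simp
  qed
  moreover have "a \<in> ?U" "b \<in> ?V" using zw e(1) by auto
  ultimately show "\<exists>U V. openin K U \<and> openin K V \<and> a \<in> U \<and> b \<in> V \<and> disjnt U V"
    unfolding disjnt_def by (intro exI[of _ ?U] exI[of _ ?V] conjI openin_K_image[OF open_l1])
qed

text \<open>Each stage of the colimit meets only finitely many cells, which are compact; this identifies the colimit
  topology with the weak topology of the cells.\<close>

lemma cw_complex_K: "cw_complex K"
proof -
  define f where "f n x = q (cell n x)" for n x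
  define \<Phi> where "\<Phi> = range (\<lambda>n. (n, f n))"
  have cover: "\<exists>n<2 * N. q z \<in> f n ` open_disc n" if z: "z \<in> sph N" for z N
  proof -
    obtain n x where n: "n < 2 * N" "x \<in> open_disc n" "q (cell n x) = q z" using cell_exists[OF z] by blast
    have "q z \<in> f n ` open_disc n" unfolding f_def n(3)[symmetric] by (rule imageI[OF n(2)])
    then show ?thesis using n(1) by blast
  qed
  have cont: "continuous_map (closed_disc n) K (f n)" for n
  proof -
    have "cell n ` topspace (closed_disc n) \<subseteq> sph (Suc (n div 2))" using cell_in_sph by blast
    then show ?thesis
      unfolding f_def closed_disc_eq topspace_euclidean_subtopology
      by (rule continuous_map_into_K[OF continuous_on_cell])
  qed
  have "cw_structure K \<Phi>"
    unfolding cw_structure_def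
  proof (intro conjI)
    show "Hausdorff_space K" by (rule Hausdorff_K)
    have "inj_on (f n) (open_disc n)" for n
      unfolding f_def by (rule inj_onI) (rule cell_unique(2))
    then show "\<forall>(n, f)\<in>\<Phi>. continuous_map (closed_disc n) K f \<and> inj_on f (open_disc n)"
      using cont by (auto simp: \<Phi>_def)
    show "\<forall>x\<in>topspace K. \<exists>!c. c \<in> \<Phi> \<and> x \<in> snd c ` open_disc (fst c)"
    proof
      fix a assume "a \<in> topspace K"
      then obtain z N where z: "z \<in> sph N" "a = q z" by (auto simp: topspace_K sphinf_def)
      then obtain n where n: "a \<in> f n ` open_disc n" using cover by blast
      show "\<exists>!c. c \<in> \<Phi> \<and> a \<in> snd c ` open_disc (fst c)"
      proof (rule ex1I[of _ "(n, f n)"])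
        show "(n, f n) \<in> \<Phi> \<and> a \<in> snd (n, f n) ` open_disc (fst (n, f n))" using n by (simp add: \<Phi>_def)
        fix c assume c: "c \<in> \<Phi> \<and> a \<in> snd c ` open_disc (fst c)"
        then obtain k where k: "c = (k, f k)" "a \<in> f k ` open_disc k" by (auto simp: \<Phi>_def)
        obtain x y where "x \<in> open_disc n" "y \<in> open_disc k" "a = q (cell n x)" "a = q (cell k y)"
          using n k(2) unfolding f_def by blast
        then have "n = k" using cell_unique(1) by metis
        then show "c = (n, f n)" using k by simp
      qed
    qed
    show "\<forall>(n, f)\<in>\<Phi>. \<exists>\<Psi>\<subseteq>\<Phi>. finite \<Psi> \<and> (\<forall>(m, g)\<in>\<Psi>. m < n) \<and>
       f ` disc_boundary n \<subseteq> (\<Union>(m, g)\<in>\<Psi>. g ` open_disc m)"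
    proof -
      have "\<exists>\<Psi>\<subseteq>\<Phi>. finite \<Psi> \<and> (\<forall>(m, g)\<in>\<Psi>. m < n) \<and>
         f n ` disc_boundary n \<subseteq> (\<Union>(m, g)\<in>\<Psi>. g ` open_disc m)" for n
      proof (intro exI[of _ "(\<lambda>k. (k, f k)) ` {..<n}"] conjI)
        show "f n ` disc_boundary n \<subseteq> (\<Union>(m, g)\<in>(\<lambda>k. (k, f k)) ` {..<n}. g ` open_disc m)"
        proof clarify
          fix x assume "x \<in> disc_boundary n"
          then obtain k where "k < n" "f n x \<in> f k ` open_disc k"
            using cell_boundary unfolding f_def by blast
          then show "f n x \<in> (\<Union>(m, g)\<in>(\<lambda>k. (k, f k)) ` {..<n}. g ` open_disc m)" by auto
        qed
      qed (auto simp: \<Phi>_def)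
      then show ?thesis by (auto simp: \<Phi>_def)
    qed
    show "\<forall>C\<subseteq>topspace K. (\<forall>(n, f)\<in>\<Phi>. closedin K (C \<inter> f ` topspace (closed_disc n))) \<longrightarrow> closedin K C"
    proof (intro allI impI)
      fix C assume C: "C \<subseteq> topspace K" and "\<forall>(n, f)\<in>\<Phi>. closedin K (C \<inter> f ` topspace (closed_disc n))"
      then have cl: "closedin K (C \<inter> f n ` topspace (closed_disc n))" for n by (auto simp: \<Phi>_def)
      show "closedin K C"
        unfolding closedin_K
      proof (intro conjI allI)
        show "C \<subseteq> q ` sphinf" using C by (simp add: topspace_K)
        fix N
        define D where "D n = {z \<in> sph N. q z \<in> C \<inter> f n ` topspace (closed_disc n)}" for n
        have "{z \<in> sph N. q z \<in> C} = \<Union>(D ` {..<2 * N})"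
        proof (intro subset_antisym subsetI)
          fix z assume z: "z \<in> {z \<in> sph N. q z \<in> C}"
          then obtain n where n: "n < 2 * N" "q z \<in> f n ` open_disc n" using cover by blast
          have "q z \<in> f n ` topspace (closed_disc n)" using n(2) image_mono[OF open_disc_subset] by (rule subsetD[rotated])
          then have "z \<in> D n" using z by (simp add: D_def)
          then show "z \<in> \<Union>(D ` {..<2 * N})" using n(1) by blast
        next
          fix z assume "z \<in> \<Union>(D ` {..<2 * N})"
          then obtain n where "z \<in> D n" by blast
          then show "z \<in> {z \<in> sph N. q z \<in> C}" by (simp add: D_def)
        qed
        moreover have "closedin (top_of_set (sph N)) (D n)" for n
          using cl[of n] unfolding closedin_K D_def by (elim conjE allE)
        then have "closedin (top_of_set (sph N)) (\<Union>(D ` {..<2 * N}))"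
          by (intro closedin_Union) auto
        ultimately show "closedin (top_of_set (sph N)) {z \<in> sph N. q z \<in> C}" by (simp only:)
      qed
    qed
  qed
  then show ?thesis unfolding cw_complex_def by blast
qed

lemma path_connected_K: "path_connected_space K"
  unfolding path_connected_space_def
proof (intro ballI)
  fix a b assume "a \<in> topspace K" "b \<in> topspace K"
  then obtain z w where zw: "z \<in> sphinf" "w \<in> sphinf" "a = q z" "b = q w" by (auto simp: topspace_K)
  obtain N where N: "z \<in> sph N" "w \<in> sph N" using sphinf_common[OF zw(1,2)] .
  have "closedin (top_of_set {0..1}) {0, 1::real}" by (intro closed_subset) auto
  moreover have "continuous_on {0, 1::real} (\<lambda>t. if t = 0 then z else w)"
    by (rule continuous_on_finite) simp
  moreover have "(\<lambda>t. if t = 0 then z else w) ` {0, 1::real} \<subseteq> sph N" using N by auto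
  ultimately obtain T where T: "continuous_on {0..1::real} T" "T ` {0..1} \<subseteq> sph (Suc N)"
    "\<And>t. t \<in> {0, 1} \<Longrightarrow> T t = (if t = 0 then z else w)"
    using extend_to_next_sphere by blast
  have "pathin K (\<lambda>t. q (T t))" unfolding pathin_def by (rule continuous_map_into_K[OF T(1,2)])
  moreover have "q (T 0) = a" "q (T 1) = b" using T(3)[of 0] T(3)[of 1] zw by auto
  ultimately show "\<exists>g. pathin K g \<and> g 0 = a \<and> g 1 = b" by blast
qed

theorem eilenberg_maclane_K: "eilenberg_maclane_space (integer_mod_group p) 1 K"
proof -
  have "(\<lambda>i. if i = 0 then 1 else 0) \<in> sph 1" by (auto simp: sph_def)
  then have "topspace K \<noteq> {}" using sph_subset_sphinf by (force simp: topspace_K)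
  moreover have "carrier (homotopy_group n K b) = {\<one>\<^bsub>homotopy_group n K b\<^esub>}"
    if "n \<ge> 1" "n \<noteq> 1" "b \<in> topspace K" for n b
    by (rule homotopy_group_trivial) (use that in auto)
  ultimately show ?thesis
    unfolding eilenberg_maclane_space_def
    using cw_complex_K path_connected_K fundamental_group by (simp only: one_neq_zero if_False) blast
qed

end

section \<open>Root terms and the group of label shifts\<close>

text \<open>Var stands for a coordinate of the given compactum, and each term t has formal p-th roots
  Root a t.  The label a below p tells these roots apart; labels from p on are inert and let
  shifting of labels be a bijection of all terms.\<close>

datatype rterm = Var nat | Const rat rat | Add rterm rterm | Mul rterm rterm | Cnj rterm | Root nat rterm

instance rterm :: countable
  by countable_datatype

lemma infinite_rterm: "infinite (UNIV :: rterm set)"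
proof -
  have "inj Var" by (simp add: inj_def)
  then show ?thesis by (metis finite_imageD finite_subset infinite_UNIV_nat subset_UNIV)
qed

definition tcode :: "rterm \<Rightarrow> nat" where
  "tcode = to_nat_on UNIV"

text \<open>Real and imaginary parts of the values of all terms are the coordinates of a point, so that valuations
  of terms and real sequences are in bijection.\<close>

definition pcode :: "rterm \<times> bool \<Rightarrow> nat" where
  "pcode = to_nat_on UNIV"

lemma bij_tcode: "bij tcode"
  unfolding tcode_def by (rule to_nat_on_infinite[OF _ infinite_rterm]) simp

lemma bij_pcode: "bij pcode"
proof -
  have "infinite (UNIV :: (rterm \<times> bool) set)"
    using infinite_rterm by (simp add: finite_prod)
  then show ?thesis unfolding pcode_def by (rule to_nat_on_infinite[rotated]) simp
qed

definition val :: "(nat \<Rightarrow> real) \<Rightarrow> rterm \<Rightarrow> complex" where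
  "val v t = Complex (v (pcode (t, True))) (v (pcode (t, False)))"

definition unval :: "(rterm \<Rightarrow> complex) \<Rightarrow> nat \<Rightarrow> real" where
  "unval w n = (case inv_into UNIV pcode n of (t, b) \<Rightarrow> if b then Re (w t) else Im (w t))"

lemma val_unval [simp]: "val (unval w) = w"
  using bij_pcode by (auto simp: val_def unval_def fun_eq_iff bij_is_inj complex_eq_iff)

lemma unval_val [simp]: "unval (val v) = v"
proof
  fix n
  obtain t b where "pcode (t, b) = n" using bij_pcode by (metis bij_pointE surj_pair)
  then show "unval (val v) n = v n"
    using bij_pcode by (auto simp: val_def unval_def bij_is_inj split: prod.splits)
qed

lemma continuous_on_val: "continuous_on S (\<lambda>v. val v t)"
  unfolding val_def complex_eq
  by (intro continuous_intros continuous_on_coord)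

definition digit :: "(nat \<Rightarrow> real) \<Rightarrow> rterm \<Rightarrow> nat" where
  "digit g t = nat \<lfloor>g (tcode t)\<rfloor>"

definition undigit :: "(rterm \<Rightarrow> nat) \<Rightarrow> nat \<Rightarrow> real" where
  "undigit c n = real (c (inv_into UNIV tcode n))"

lemma digit_undigit [simp]: "digit (undigit c) = c"
  using bij_tcode by (simp add: digit_def undigit_def fun_eq_iff bij_is_inj)

lemma locally_constant_imp_continuous_on:
  assumes "\<And>x. x \<in> S \<Longrightarrow> \<forall>\<^sub>F y in nhds x. y \<in> S \<longrightarrow> f y = f x"
  shows "continuous_on S f"
  unfolding continuous_on_def
proof
  fix x assume "x \<in> S"
  then have "\<forall>\<^sub>F y in at x within S. f y = f x"
    unfolding eventually_at_filter by (intro eventually_mono[OF assms]) auto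
  then show "(f \<longlongrightarrow> f x) (at x within S)" by (rule tendsto_eventually)
qed

context root_of_unity_group
begin

definition label_root :: "nat \<Rightarrow> complex" where
  "label_root a = (if a < p then unity_root (int a) else 0)"

definition shift_label :: "nat \<Rightarrow> nat \<Rightarrow> nat" where
  "shift_label k a = (if a < p then (a + k) mod p else a)"

lemma label_root_0 [simp]: "label_root 0 = 1"
  by (simp add: label_root_def unity_root_def)

lemma unity_root_power: "unity_root k ^ p = 1"
  using unity_root_in_mu by (simp add: mu_def)

lemma label_root_shift: "label_root (shift_label k a) = label_root a * label_root (shift_label k 0)"
proof -
  have "unity_root (int ((a + k) mod p)) = unity_root (int a) * unity_root (int (k mod p))"
    unfolding zmod_int of_nat_add by (simp add: unity_root_mod unity_root_add)
  then show ?thesis by (simp add: label_root_def shift_label_def)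
qed

lemma shift_label_0 [simp]: "shift_label 0 a = a"
  by (simp add: shift_label_def)

lemma shift_label_shift: "shift_label j (shift_label k a) = shift_label (k + j) a"
  by (simp add: shift_label_def mod_simps add.assoc)

lemma shift_label_mod: "shift_label (k mod p) a = shift_label k a"
  by (simp add: shift_label_def mod_simps)

text \<open>Given the amount c t by which the labels of the roots of each term t are shifted, this is the induced
  substitution of terms; inside a root it applies to the radicand as well.\<close>

primrec twist :: "(rterm \<Rightarrow> nat) \<Rightarrow> rterm \<Rightarrow> rterm" where
  "twist c (Var i) = Var i"
| "twist c (Const a b) = Const a b"
| "twist c (Add s t) = Add (twist c s) (twist c t)"
| "twist c (Mul s t) = Mul (twist c s) (twist c t)"
| "twist c (Cnj t) = Cnj (twist c t)"
| "twist c (Root a t) = Root (shift_label (c t) a) (twist c t)"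

primrec untwist :: "(rterm \<Rightarrow> nat) \<Rightarrow> rterm \<Rightarrow> rterm" where
  "untwist c (Var i) = Var i"
| "untwist c (Const a b) = Const a b"
| "untwist c (Add s t) = Add (untwist c s) (untwist c t)"
| "untwist c (Mul s t) = Mul (untwist c s) (untwist c t)"
| "untwist c (Cnj t) = Cnj (untwist c t)"
| "untwist c (Root a t) = Root (shift_label (p - c (untwist c t)) a) (untwist c t)"

text \<open>The shift function of the composition of two substitutions.\<close>

definition twist_mult :: "(rterm \<Rightarrow> nat) \<Rightarrow> (rterm \<Rightarrow> nat) \<Rightarrow> rterm \<Rightarrow> nat" where
  "twist_mult c d t = (c t + d (twist c t)) mod p"

definition twist_inverse :: "(rterm \<Rightarrow> nat) \<Rightarrow> rterm \<Rightarrow> nat" where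
  "twist_inverse c t = (p - c (untwist c t)) mod p"

lemma twist_twist_mult: "twist (twist_mult c d) t = twist d (twist c t)"
  by (induction t) (simp_all add: twist_mult_def shift_label_mod shift_label_shift)

lemma twist_zero [simp]: "twist (\<lambda>t. 0) t = t"
  by (induction t) simp_all

lemma twist_mult_assoc: "twist_mult (twist_mult c d) e = twist_mult c (twist_mult d e)"
  by (rule ext) (simp add: twist_mult_def twist_twist_mult mod_simps add.assoc)

lemma twist_twist_inverse: "twist (twist_inverse c) t = untwist c t"
  by (induction t) (simp_all add: twist_inverse_def shift_label_mod)

lemma twist_mult_inverse: assumes "\<And>t. c t < p" shows "twist_mult (twist_inverse c) c = (\<lambda>t. 0)"
proof
  fix t
  have "c (untwist c t) < p" by (rule assms)
  then show "twist_mult (twist_inverse c) c t = 0" by (simp add: twist_mult_def twist_twist_inverse twist_inverse_def mod_simps)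
qed

text \<open>Shift functions as real sequences of digits below p.  This is a product of finite sets, and the value
  of a twist at a term depends on finitely many digits, so the group operations are locally constant in
  every coordinate.\<close>

definition twist_carrier :: "(nat \<Rightarrow> real) set" where
  "twist_carrier = {g. \<forall>n. g n \<in> real ` {..<p}}"

lemma undigit_digit: assumes "g \<in> twist_carrier" shows "undigit (digit g) = g"
proof
  fix n
  have "tcode (inv_into UNIV tcode n) = n" using bij_tcode by (simp add: bij_is_surj surj_f_inv_f)
  moreover have "g n \<in> real ` {..<p}" using assms by (simp add: twist_carrier_def)
  ultimately show "undigit (digit g) n = g n" by (auto simp: undigit_def digit_def)
qed

lemma undigit_in_carrier: "(\<And>t. c t < p) \<Longrightarrow> undigit c \<in> twist_carrier"
  by (simp add: twist_carrier_def undigit_def)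

lemma digit_less: assumes "g \<in> twist_carrier" shows "digit g t < p"
proof -
  have "g (tcode t) \<in> real ` {..<p}" using assms by (simp add: twist_carrier_def)
  then show ?thesis by (auto simp: digit_def)
qed

definition twist_group :: "(nat \<Rightarrow> real) monoid" where
  "twist_group = \<lparr>carrier = twist_carrier, monoid.mult = (\<lambda>g h. undigit (twist_mult (digit g) (digit h))), one = undigit (\<lambda>t. 0)\<rparr>"

lemma twist_mult_less: "twist_mult c d t < p"
  by (simp add: twist_mult_def)

lemma twist_inverse_less: "twist_inverse c t < p"
  by (simp add: twist_inverse_def)

lemma group_twist_group: "group twist_group"
proof (rule groupI)
  fix g assume g: "g \<in> carrier twist_group"
  then have gG: "g \<in> twist_carrier" by (simp add: twist_group_def)
  have "twist_mult (\<lambda>t. 0) (digit g) = digit g"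
    using digit_less[OF gG] by (simp add: fun_eq_iff twist_mult_def)
  then show "\<one>\<^bsub>twist_group\<^esub> \<otimes>\<^bsub>twist_group\<^esub> g = g"
    using undigit_digit[OF gG] by (simp add: twist_group_def)
  show "\<exists>h\<in>carrier twist_group. h \<otimes>\<^bsub>twist_group\<^esub> g = \<one>\<^bsub>twist_group\<^esub>"
    using twist_mult_inverse[of "digit g"] digit_less[OF gG]
    by (intro bexI[of _ "undigit (twist_inverse (digit g))"]) (simp_all add: twist_group_def undigit_in_carrier twist_inverse_less)
qed (simp_all add: twist_group_def undigit_in_carrier twist_mult_less twist_mult_assoc)

lemma inv_twist_group: assumes "g \<in> twist_carrier" shows "inv\<^bsub>twist_group\<^esub> g = undigit (twist_inverse (digit g))"
  using twist_mult_inverse[of "digit g"] digit_less[OF assms] assms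
  by (intro group.inv_equality[OF group_twist_group]) (simp_all add: twist_group_def undigit_in_carrier twist_inverse_less)

lemma compact_twist_carrier: "compact twist_carrier"
  unfolding twist_carrier_def by (intro compact_Pi_coordinates finite_imp_compact) auto

lemma eventually_coord_eq: assumes "g \<in> twist_carrier" shows "\<forall>\<^sub>F g' in nhds g. g' \<in> twist_carrier \<longrightarrow> g' n = g n"
proof -
  have "open {x :: nat \<Rightarrow> real. \<bar>x n - g n\<bar> < 1}"
    by (intro open_Collect_less continuous_intros continuous_on_coord)
  then have "\<forall>\<^sub>F g' in nhds g. g' \<in> {x. \<bar>x n - g n\<bar> < 1}"
    by (rule eventually_nhds_in_open) simp
  then show ?thesis
  proof (rule eventually_mono, intro impI)
    fix g' assume "g' \<in> {x. \<bar>x n - g n\<bar> < 1}" "g' \<in> twist_carrier"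
    moreover obtain i j :: nat where "g n = real i" "g' n = real j"
      using assms \<open>g' \<in> twist_carrier\<close> by (force simp: twist_carrier_def)
    ultimately show "g' n = g n" by simp
  qed
qed

lemma eventually_digit_eq: assumes "g \<in> twist_carrier" shows "\<forall>\<^sub>F g' in nhds g. g' \<in> twist_carrier \<longrightarrow> digit g' t = digit g t"
  using eventually_coord_eq[OF assms, of "tcode t"] by (rule eventually_mono) (simp add: digit_def)

lemma eventually_twist_eq: assumes "g \<in> twist_carrier" shows "\<forall>\<^sub>F g' in nhds g. g' \<in> twist_carrier \<longrightarrow> twist (digit g') t = twist (digit g) t"
proof (induction t)
  case (Add s t) then show ?case by eventually_elim simp
next
  case (Mul s t) then show ?case by eventually_elim simp
next
  case (Cnj t) then show ?case by eventually_elim simp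
next
  case (Root a t) with eventually_digit_eq[OF assms, of t] show ?case by eventually_elim simp
qed simp_all

lemma eventually_untwist_eq: assumes "g \<in> twist_carrier" shows "\<forall>\<^sub>F g' in nhds g. g' \<in> twist_carrier \<longrightarrow> untwist (digit g') t = untwist (digit g) t"
proof (induction t)
  case (Add s t) then show ?case by eventually_elim simp
next
  case (Mul s t) then show ?case by eventually_elim simp
next
  case (Cnj t) then show ?case by eventually_elim simp
next
  case (Root a t) with eventually_digit_eq[OF assms, of "untwist (digit g) t"] show ?case by eventually_elim simp
qed simp_all

lemma eventually_nhds_fst: "\<forall>\<^sub>F x in nhds (fst z). P x \<Longrightarrow> \<forall>\<^sub>F y in nhds z. P (fst y)"
  by (rule eventually_compose_filterlim[OF _ tendsto_fst[OF filterlim_ident]])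

lemma eventually_nhds_snd: "\<forall>\<^sub>F x in nhds (snd z). P x \<Longrightarrow> \<forall>\<^sub>F y in nhds z. P (snd y)"
  by (rule eventually_compose_filterlim[OF _ tendsto_snd[OF filterlim_ident]])

lemma compact_group_twist_group: "compact_group twist_group (top_of_set twist_carrier)"
  unfolding compact_group_def
proof (intro conjI)
  show "group twist_group" by (rule group_twist_group)
  show "topspace (top_of_set twist_carrier) = carrier twist_group" by (simp add: twist_group_def)
  show "compact_space (top_of_set twist_carrier)" using compact_twist_carrier by (intro compact_space_subtopology) simp
  show "Hausdorff_space (top_of_set twist_carrier)"
    by (simp add: Hausdorff_space_subtopology)
  have "continuous_on (twist_carrier \<times> twist_carrier) (\<lambda>y. undigit (twist_mult (digit (fst y)) (digit (snd y))))"
  proof (rule continuous_on_coordinatewise_then_product)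
    fix n
    define t where "t = inv_into UNIV tcode n"
    show "continuous_on (twist_carrier \<times> twist_carrier) (\<lambda>y. undigit (twist_mult (digit (fst y)) (digit (snd y))) n)"
    proof (rule locally_constant_imp_continuous_on)
      fix z assume "z \<in> twist_carrier \<times> twist_carrier"
      then have z: "fst z \<in> twist_carrier" "snd z \<in> twist_carrier" by auto
      have "\<forall>\<^sub>F y in nhds z. fst y \<in> twist_carrier \<longrightarrow> digit (fst y) t = digit (fst z) t"
        by (rule eventually_nhds_fst[OF eventually_digit_eq[OF z(1)]])
      moreover have "\<forall>\<^sub>F y in nhds z. fst y \<in> twist_carrier \<longrightarrow> twist (digit (fst y)) t = twist (digit (fst z)) t"
        by (rule eventually_nhds_fst[OF eventually_twist_eq[OF z(1)]])
      moreover have "\<forall>\<^sub>F y in nhds z. snd y \<in> twist_carrier \<longrightarrow> digit (snd y) (twist (digit (fst z)) t) = digit (snd z) (twist (digit (fst z)) t)"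
        by (rule eventually_nhds_snd[OF eventually_digit_eq[OF z(2)]])
      ultimately show "\<forall>\<^sub>F y in nhds z. y \<in> twist_carrier \<times> twist_carrier \<longrightarrow>
          undigit (twist_mult (digit (fst y)) (digit (snd y))) n = undigit (twist_mult (digit (fst z)) (digit (snd z))) n"
        by eventually_elim (auto simp: undigit_def twist_mult_def t_def)
    qed
  qed
  then show "continuous_map (prod_topology (top_of_set twist_carrier) (top_of_set twist_carrier)) (top_of_set twist_carrier) (\<lambda>(x, y). x \<otimes>\<^bsub>twist_group\<^esub> y)"
    using undigit_in_carrier[OF twist_mult_less]
    by (auto simp: twist_group_def case_prod_beta simp flip: subtopology_Times)
  have "continuous_on twist_carrier (\<lambda>g. undigit (twist_inverse (digit g)))"
  proof (rule continuous_on_coordinatewise_then_product)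
    fix n
    define t where "t = inv_into UNIV tcode n"
    show "continuous_on twist_carrier (\<lambda>g. undigit (twist_inverse (digit g)) n)"
    proof (rule locally_constant_imp_continuous_on)
      fix g assume g: "g \<in> twist_carrier"
      from eventually_untwist_eq[OF g, of t] eventually_digit_eq[OF g, of "untwist (digit g) t"]
      show "\<forall>\<^sub>F h in nhds g. h \<in> twist_carrier \<longrightarrow> undigit (twist_inverse (digit h)) n = undigit (twist_inverse (digit g)) n"
        by eventually_elim (auto simp: undigit_def twist_inverse_def t_def)
    qed
  qed
  then have "continuous_on twist_carrier (\<lambda>g. inv\<^bsub>twist_group\<^esub> g)"
    by (rule continuous_on_eq) (simp add: inv_twist_group)
  moreover have "(\<lambda>g. inv\<^bsub>twist_group\<^esub> g) ` twist_carrier \<subseteq> twist_carrier"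
    using undigit_in_carrier[OF twist_inverse_less] by (auto simp: inv_twist_group)
  ultimately show "continuous_map (top_of_set twist_carrier) (top_of_set twist_carrier) (\<lambda>g. inv\<^bsub>twist_group\<^esub> g)"
    by (auto simp: image_subset_iff)
qed

end

section \<open>The space of valuations and its orbits\<close>

context root_of_unity_group
begin

text \<open>A valuation respects the operations, sends the roots of t to the p-th roots of its value in the order
  of their labels, and has its coordinates in L.  Inert labels get the value 0.\<close>

definition valid :: "(nat \<Rightarrow> real) set \<Rightarrow> (rterm \<Rightarrow> complex) \<Rightarrow> bool" where
  "valid L w \<longleftrightarrow> (\<lambda>i. Re (w (Var i))) \<in> L \<and> (\<forall>i. Im (w (Var i)) = 0) \<and>
     (\<forall>a b. w (Const a b) = Complex (of_rat a) (of_rat b)) \<and>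
     (\<forall>s t. w (Add s t) = w s + w t) \<and> (\<forall>s t. w (Mul s t) = w s * w t) \<and>
     (\<forall>t. w (Cnj t) = cnj (w t)) \<and>
     (\<forall>a t. w (Root a t) = label_root a * w (Root 0 t)) \<and> (\<forall>t. w (Root 0 t) ^ p = w t)"

lemma validD:
  assumes "valid L w"
  shows "(\<lambda>i. Re (w (Var i))) \<in> L" "Im (w (Var i)) = 0" "w (Const a b) = Complex (of_rat a) (of_rat b)"
    "w (Add s t) = w s + w t" "w (Mul s t) = w s * w t" "w (Cnj t) = cnj (w t)"
    "w (Root k t) = label_root k * w (Root 0 t)" "w (Root 0 t) ^ p = w t"
  using assms unfolding valid_def by blast+

definition root_space :: "(nat \<Rightarrow> real) set \<Rightarrow> (nat \<Rightarrow> real) set" where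
  "root_space L = {v. valid L (val v)}"

definition base :: "(nat \<Rightarrow> real) \<Rightarrow> nat \<Rightarrow> real" where
  "base v i = Re (val v (Var i))"

lemma base_in: "v \<in> root_space L \<Longrightarrow> base v \<in> L"
  using validD(1) by (auto simp: root_space_def base_def[abs_def])

lemma continuous_on_base: "continuous_on S base"
  unfolding base_def by (intro continuous_on_coordinatewise_then_product continuous_intros continuous_on_val)

lemma closed_root_space: assumes "closed L" shows "closed (root_space L)"
proof -
  have eq: "root_space L = {v. base v \<in> L} \<inter> (\<Inter>i. {v. Im (val v (Var i)) = 0}) \<inter>
     (\<Inter>a b. {v. val v (Const a b) = Complex (of_rat a) (of_rat b)}) \<inter>
     (\<Inter>s t. {v. val v (Add s t) = val v s + val v t}) \<inter>
     (\<Inter>s t. {v. val v (Mul s t) = val v s * val v t}) \<inter>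
     (\<Inter>t. {v. val v (Cnj t) = cnj (val v t)}) \<inter>
     (\<Inter>a t. {v. val v (Root a t) = label_root a * val v (Root 0 t)}) \<inter>
     (\<Inter>t. {v. val v (Root 0 t) ^ p = val v t})"
    by (simp add: set_eq_iff root_space_def valid_def base_def[abs_def])
  have "closed (base -` L)" using continuous_on_base[of UNIV] assms by (rule closed_vimage[rotated])
  then have "closed {v. base v \<in> L}" by (simp add: vimage_def)
  then show ?thesis
    unfolding eq by (intro closed_Int closed_INT ballI closed_Collect_eq continuous_intros continuous_on_val)
qed

primrec bound :: "(nat \<Rightarrow> real) \<Rightarrow> rterm \<Rightarrow> real" where
  "bound B (Var i) = B i"
| "bound B (Const a b) = cmod (Complex (of_rat a) (of_rat b))"
| "bound B (Add s t) = bound B s + bound B t"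
| "bound B (Mul s t) = bound B s * bound B t"
| "bound B (Cnj t) = bound B t"
| "bound B (Root a t) = 1 + bound B t"

lemma cmod_label_root_le_1: "cmod (label_root a) \<le> 1"
  using mu_cmod[OF unity_root_in_mu] by (simp add: label_root_def)

text \<open>A p-th root is at most 1 in modulus or at most as large as its power.\<close>

lemma cmod_le_bound:
  assumes w: "valid L w" and B: "\<And>l i. l \<in> L \<Longrightarrow> \<bar>l i\<bar> \<le> B i"
  shows "cmod (w t) \<le> bound B t"
proof (induction t)
  case (Var i)
  have "cmod (w (Var i)) = \<bar>Re (w (Var i))\<bar>" using validD(2)[OF w] by (simp add: cmod_eq_Re)
  then show ?case using B[OF validD(1)[OF w], of i] by simp
next
  case (Const a b) then show ?case by (simp add: validD(3)[OF w])
next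
  case (Add s t)
  then show ?case using norm_triangle_ineq[of "w s" "w t"] by (simp add: validD(4)[OF w])
next
  case (Mul s t)
  then show ?case by (simp add: validD(5)[OF w] norm_mult mult_mono')
next
  case (Cnj t) then show ?case by (simp add: validD(6)[OF w])
next
  case (Root a t)
  have "cmod (w (Root 0 t)) \<le> 1 + cmod (w t)"
  proof (cases "cmod (w (Root 0 t)) \<le> 1")
    case False
    then have "cmod (w (Root 0 t)) ^ 1 \<le> cmod (w (Root 0 t)) ^ p" using p2 by (intro power_increasing) auto
    also have "\<dots> = cmod (w t)" by (simp add: validD(8)[OF w] flip: norm_power)
    finally show ?thesis by simp
  next
    case True
    then show ?thesis using norm_ge_zero[of "w t"] by linarith
  qed
  moreover have "cmod (w (Root a t)) \<le> 1 * cmod (w (Root 0 t))"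
    unfolding validD(7)[OF w, of a] norm_mult by (intro mult_right_mono cmod_label_root_le_1) simp
  ultimately show ?case using Root by simp
qed

text \<open>The values of each term are bounded, by recursion on the term.\<close>

lemma compact_root_space: assumes L: "compact L" shows "compact (root_space L)"
proof -
  have "\<exists>b. \<forall>l\<in>L. \<bar>l i\<bar> \<le> b" for i
  proof -
    have "compact ((\<lambda>l. l i) ` L)" by (intro compact_continuous_image continuous_on_coord L)
    then have "bounded ((\<lambda>l. l i) ` L)" by (rule compact_imp_bounded)
    then show ?thesis by (auto simp: bounded_iff)
  qed
  then obtain B where B: "\<And>l i. l \<in> L \<Longrightarrow> \<bar>l i\<bar> \<le> B i" by metis
  define b where "b n = bound B (fst (inv_into UNIV pcode n))" for n
  have "root_space L \<subseteq> {v. \<forall>n. v n \<in> {- b n..b n}}"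
  proof (rule subsetI, rule CollectI, rule allI)
    fix v n assume v: "v \<in> root_space L"
    obtain t c where tc: "pcode (t, c) = n" using bij_pcode by (metis bij_pointE surj_pair)
    then have "inv_into UNIV pcode n = (t, c)" using bij_pcode by (metis bij_is_inj inv_into_f_f UNIV_I)
    then have b: "b n = bound B t" by (simp add: b_def)
    have "cmod (val v t) \<le> b n" unfolding b by (rule cmod_le_bound[of L]) (use v B in \<open>auto simp: root_space_def\<close>)
    then have "\<bar>Re (val v t)\<bar> \<le> b n" "\<bar>Im (val v t)\<bar> \<le> b n"
      using abs_Re_le_cmod abs_Im_le_cmod order_trans by blast+
    then show "v n \<in> {- b n..b n}" using tc by (cases c) (auto simp: val_def)
  qed
  moreover have "compact {v. \<forall>n. v n \<in> {- b n..b n}}" by (rule compact_Pi_coordinates) simp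
  ultimately show ?thesis
    using closed_root_space[OF compact_imp_closed[OF L]] by (metis compact_Int_closed inf.absorb2)
qed

lemma ex_root: "\<exists>r::complex. r ^ p = z"
proof (cases "z = 0")
  case True then show ?thesis by (intro exI[of _ 0]) simp
next
  case False
  have "exp (Ln z / of_nat p) ^ p = z" using False by (simp flip: exp_of_nat_mult)
  then show ?thesis by blast
qed

text \<open>A valuation over a given point of L, by choosing roots arbitrarily.\<close>

primrec some_val :: "(nat \<Rightarrow> real) \<Rightarrow> rterm \<Rightarrow> complex" where
  "some_val l (Var i) = of_real (l i)"
| "some_val l (Const a b) = Complex (of_rat a) (of_rat b)"
| "some_val l (Add s t) = some_val l s + some_val l t"
| "some_val l (Mul s t) = some_val l s * some_val l t"
| "some_val l (Cnj t) = cnj (some_val l t)"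
| "some_val l (Root a t) = label_root a * (SOME r. r ^ p = some_val l t)"

lemma base_surj: assumes "l \<in> L" shows "\<exists>v\<in>root_space L. base v = l"
proof -
  have "(SOME r. r ^ p = some_val l t) ^ p = some_val l t" for t
    using someI_ex[OF ex_root] .
  then have "valid L (some_val l)" using assms by (auto simp: valid_def)
  then show ?thesis
    by (intro bexI[of _ "unval (some_val l)"]) (auto simp: root_space_def base_def)
qed

lemma valid_twist: assumes "valid L w" shows "valid L (\<lambda>t. w (twist c t))"
proof -
  have *: "w (Root (shift_label k a) s) = label_root a * w (Root (shift_label k 0) s)" for k a s
    by (simp add: validD(7)[OF assms, of "shift_label k a"] validD(7)[OF assms, of "shift_label k 0"] label_root_shift[of k a])
  have "label_root (shift_label k 0) ^ p = 1" for k
    using unity_root_power by (simp add: label_root_def shift_label_def)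
  then have "w (Root (shift_label k 0) s) ^ p = w s" for k s
    by (simp add: validD(7)[OF assms, of "shift_label k 0"] power_mult_distrib validD(8)[OF assms])
  note pow = this
  show ?thesis
    unfolding valid_def
  proof (intro conjI allI)
    show "w (twist c (Root a t)) = label_root a * w (twist c (Root 0 t))" for a t
      unfolding twist.simps by (rule *)
    show "w (twist c (Root 0 t)) ^ p = w (twist c t)" for t
      unfolding twist.simps by (rule pow)
  qed (simp_all add: validD(1-6)[OF assms])
qed

text \<open>For two valuations over the same point of L this rewrites a term, from the inside out, into one
  whose value under the first is the value of the given term under the second; at each root the label is shifted by the phase between the two chosen roots.\<close>

primrec matching_term :: "(rterm \<Rightarrow> complex) \<Rightarrow> (rterm \<Rightarrow> complex) \<Rightarrow> rterm \<Rightarrow> rterm" where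
  "matching_term w w' (Var i) = Var i"
| "matching_term w w' (Const a b) = Const a b"
| "matching_term w w' (Add s t) = Add (matching_term w w' s) (matching_term w w' t)"
| "matching_term w w' (Mul s t) = Mul (matching_term w w' s) (matching_term w w' t)"
| "matching_term w w' (Cnj t) = Cnj (matching_term w w' t)"
| "matching_term w w' (Root a t) =
     Root (shift_label (SOME k. k < p \<and> w' (Root 0 t) = label_root k * w (Root 0 (matching_term w w' t))) a) (matching_term w w' t)"

lemma equal_powers:
  assumes "x ^ p = y ^ p" shows "\<exists>k<p. x = label_root k * y"
proof (cases "y = 0")
  case True
  then have "x = 0" using assms by (simp add: power_0_left)
  then show ?thesis using True by (intro exI[of _ 0]) simp
next
  case False
  then have "x / y \<in> mu" using assms by (simp add: mu_def power_divide)
  then have "x / y \<in> unity_root ` {0..<int p}" using bij_betw_unity_root by (simp add: bij_betw_def)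
  then obtain k where k: "k \<in> {0..<int p}" "x / y = unity_root k" by blast
  have "x = label_root (nat k) * y" "nat k < p" using k False by (auto simp: label_root_def field_simps)
  then show ?thesis by blast
qed

text \<open>The orbits are the full fibres over L: by recursion on terms, the shifts can be chosen so that the
  twisted valuation agrees with the other one, because both choose p-th roots of the same number.\<close>

lemma fibre_transitive:
  assumes w: "valid L w" and w': "valid L w'" and eq: "\<And>i. Re (w (Var i)) = Re (w' (Var i))"
  shows "\<exists>c. (\<forall>t. c t < p) \<and> (\<forall>t. w' t = w (twist c t))"
proof -
  define c where "c t = (SOME k. k < p \<and> w' (Root 0 t) = label_root k * w (Root 0 (matching_term w w' t)))" for t
  have twist: "twist c t = matching_term w w' t" for t by (induction t) (simp_all add: c_def)
  have c: "c t < p \<and> w' (Root 0 t) = label_root (c t) * w (Root 0 (matching_term w w' t))" if "w' t = w (matching_term w w' t)" for t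
  proof -
    have "w' (Root 0 t) ^ p = w (Root 0 (matching_term w w' t)) ^ p"
      using that validD(8)[OF w] validD(8)[OF w'] by simp
    from equal_powers[OF this] show ?thesis unfolding c_def by (rule someI_ex)
  qed
  have vals: "w' t = w (matching_term w w' t)" for t
  proof (induction t)
    case (Var i)
    then show ?case using eq[of i] validD(2)[OF w, of i] validD(2)[OF w', of i] by (simp add: complex_eq_iff)
  next
    case (Root a t)
    have "w' (Root a t) = label_root a * (label_root (c t) * w (Root 0 (matching_term w w' t)))"
      using c[OF Root] validD(7)[OF w', of a] by simp
    also have "\<dots> = label_root (shift_label (c t) a) * w (Root 0 (matching_term w w' t))"
      using c[OF Root] label_root_shift[of "c t" a] by (simp add: shift_label_def)
    also have "\<dots> = w (matching_term w w' (Root a t))"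
      using validD(7)[OF w, of "shift_label (c t) a"] by (simp add: c_def)
    finally show ?case .
  qed (simp_all add: validD(3-6)[OF w] validD(3-6)[OF w'])
  show ?thesis
  proof (intro exI[of _ c] conjI allI)
    show "c t < p" for t using c[OF vals] by (rule conjunct1)
    show "w' t = w (twist c t)" for t unfolding twist by (rule vals)
  qed
qed

definition twist_action :: "(nat \<Rightarrow> real) set \<Rightarrow> (nat \<Rightarrow> real) \<Rightarrow> (nat \<Rightarrow> real) \<Rightarrow> nat \<Rightarrow> real" where
  "twist_action L g = restrict (\<lambda>v. unval (\<lambda>t. val v (twist (digit g) t))) (root_space L)"

lemma twist_action_in: "v \<in> root_space L \<Longrightarrow> twist_action L g v \<in> root_space L"
  using valid_twist by (simp add: twist_action_def root_space_def)

lemma val_twist_action: "v \<in> root_space L \<Longrightarrow> val (twist_action L g v) = (\<lambda>t. val v (twist (digit g) t))"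
  by (simp add: twist_action_def)

lemma twist_action_mult: assumes "v \<in> root_space L" shows "twist_action L (g \<otimes>\<^bsub>twist_group\<^esub> h) v = twist_action L g (twist_action L h v)"
proof -
  have "val (twist_action L (g \<otimes>\<^bsub>twist_group\<^esub> h) v) = val (twist_action L g (twist_action L h v))"
    by (simp add: val_twist_action twist_action_in assms) (simp add: twist_group_def twist_twist_mult)
  then show ?thesis by (metis unval_val)
qed

lemma twist_action_one: assumes "v \<in> root_space L" shows "twist_action L \<one>\<^bsub>twist_group\<^esub> v = v"
proof -
  have "val (twist_action L \<one>\<^bsub>twist_group\<^esub> v) = val v" by (simp add: val_twist_action assms twist_group_def)
  then show ?thesis by (metis unval_val)
qed

end

lemma group_actionI:
  fixes G (structure)
  assumes G: "group G"
    and closed: "\<And>g x. g \<in> carrier G \<Longrightarrow> x \<in> E \<Longrightarrow> \<phi> g x \<in> E"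
    and ext: "\<And>g. g \<in> carrier G \<Longrightarrow> \<phi> g \<in> extensional E"
    and one: "\<And>x. x \<in> E \<Longrightarrow> \<phi> \<one>\<^bsub>G\<^esub> x = x"
    and mult: "\<And>g h x. g \<in> carrier G \<Longrightarrow> h \<in> carrier G \<Longrightarrow> x \<in> E \<Longrightarrow> \<phi> (g \<otimes>\<^bsub>G\<^esub> h) x = \<phi> g (\<phi> h x)"
  shows "group_action G E \<phi>"
proof -
  interpret group G by (rule G)
  have bij: "\<phi> g \<in> Bij E" if g: "g \<in> carrier G" for g
  proof -
    have "bij_betw (\<phi> g) E E"
    proof (rule bij_betw_byWitness[where f' = "\<phi> (inv g)"])
      show "\<forall>a\<in>E. \<phi> (inv g) (\<phi> g a) = a" "\<forall>a\<in>E. \<phi> g (\<phi> (inv g) a) = a"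
        using mult[of "inv g" g] mult[of g "inv g"] one g by auto
    qed (use closed g in auto)
    then show ?thesis using ext[OF g] by (simp add: Bij_def)
  qed
  show ?thesis
  proof (intro group_action.intro group_hom.intro group_hom_axioms.intro homI)
    fix g h assume gh: "g \<in> carrier G" "h \<in> carrier G"
    have "\<phi> (g \<otimes> h) = compose E (\<phi> g) (\<phi> h)"
    proof (rule extensionalityI[OF ext[of "g \<otimes> h"]])
      show "compose E (\<phi> g) (\<phi> h) \<in> extensional E" by (rule compose_extensional)
      show "\<phi> (g \<otimes> h) x = compose E (\<phi> g) (\<phi> h) x" if "x \<in> E" for x
        using mult[OF gh that] that by (simp add: compose_eq)
    qed (use gh in simp)
    then show "\<phi> (g \<otimes> h) = \<phi> g \<otimes>\<^bsub>BijGroup E\<^esub> \<phi> h"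
      using bij gh by (simp add: BijGroup_def)
  qed (simp_all add: G group_BijGroup, simp add: BijGroup_def bij)
qed

lemma quotient_map_from_compact:
  fixes \<pi> :: "'x::topological_space \<Rightarrow> 'y::metric_space"
  assumes "compact X" "continuous_on X \<pi>" "\<pi> ` X = L"
  shows "quotient_map (top_of_set X) (top_of_set L) \<pi>"
proof -
  have c: "continuous_map (top_of_set X) (top_of_set L) \<pi>" using assms(2,3) by auto
  show ?thesis
  proof (rule continuous_closed_imp_quotient_map[OF c])
    show "closed_map (top_of_set X) (top_of_set L) \<pi>"
      using assms(1) by (intro continuous_imp_closed_map[OF c] compact_space_subtopology Hausdorff_space_subtopology)
        (auto simp: Hausdorff_space_euclidean)
    show "\<pi> ` topspace (top_of_set X) = topspace (top_of_set L)" using assms(3) by simp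
  qed
qed

text \<open>Both spaces are quotients of X with the same fibres.\<close>

lemma orbit_space_homeomorphic:
  fixes \<phi> :: "'g \<Rightarrow> 'x::topological_space \<Rightarrow> 'x" and \<pi> :: "'x \<Rightarrow> 'y::metric_space"
  assumes X: "compact X" and \<pi>: "continuous_on X \<pi>" "\<pi> ` X = L"
    and fib: "\<And>x y. x \<in> X \<Longrightarrow> y \<in> X \<Longrightarrow> orbit G \<phi> x = orbit G \<phi> y \<longleftrightarrow> \<pi> x = \<pi> y"
  shows "orbit_space G (top_of_set X) \<phi> homeomorphic_space top_of_set L"
proof -
  let ?O = "orbit_space G (top_of_set X) \<phi>"
  have c\<pi>: "continuous_map (top_of_set X) (top_of_set L) \<pi>" using \<pi> by auto
  have qO: "quotient_map (top_of_set X) ?O (orbit G \<phi>)" by (rule quotient_map_orbit_space)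
  have q\<pi>: "quotient_map (top_of_set X) (top_of_set L) \<pi>" by (rule quotient_map_from_compact[OF X \<pi>])
  obtain f where f: "continuous_map ?O (top_of_set L) f" "\<And>x. x \<in> X \<Longrightarrow> f (orbit G \<phi> x) = \<pi> x"
    using quotient_map_lift_exists[OF qO c\<pi>] fib by (metis topspace_euclidean_subtopology)
  obtain g where g: "continuous_map (top_of_set L) ?O g" "\<And>x. x \<in> X \<Longrightarrow> g (\<pi> x) = orbit G \<phi> x"
    using quotient_map_lift_exists[OF q\<pi> quotient_imp_continuous_map[OF qO]] fib by (metis topspace_euclidean_subtopology)
  have "homeomorphic_maps ?O (top_of_set L) f g"
    unfolding homeomorphic_maps_def
  proof (intro conjI ballI f g)
    fix a assume "a \<in> topspace ?O"
    then obtain x where "x \<in> X" "a = orbit G \<phi> x" by (auto simp: topspace_orbit_space orbits_def)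
    then show "g (f a) = a" using f g by simp
  next
    fix l assume "l \<in> topspace (top_of_set L)"
    then obtain x where "x \<in> X" "l = \<pi> x" using \<pi>(2) by auto
    then show "f (g l) = l" using f g by simp
  qed
  then show ?thesis by (rule homeomorphic_maps_imp_homeomorphic_space)
qed

context root_of_unity_group
begin

lemma continuous_action_twist: "continuous_action twist_group (top_of_set twist_carrier) (top_of_set (root_space L)) (twist_action L)"
  unfolding continuous_action_def
proof
  show "group_action twist_group (topspace (top_of_set (root_space L))) (twist_action L)"
    by (rule group_actionI[OF group_twist_group]) (auto simp: twist_action_in twist_action_one twist_action_mult, simp add: twist_action_def)
  have "continuous_on (twist_carrier \<times> root_space L) (\<lambda>y. twist_action L (fst y) (snd y))"
  proof (rule continuous_on_coordinatewise_then_product)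
    fix n
    obtain t b where tb: "pcode (t, b) = n" using bij_pcode by (metis bij_pointE surj_pair)
    have act_n: "twist_action L g v n = v (pcode (twist (digit g) t, b))" if "v \<in> root_space L" for g v
    proof -
      have "twist_action L g v n = unval (\<lambda>t. val v (twist (digit g) t)) n" using that by (simp add: twist_action_def)
      also have "\<dots> = (if b then Re (val v (twist (digit g) t)) else Im (val v (twist (digit g) t)))"
        unfolding unval_def tb[symmetric] using bij_pcode by (simp add: bij_is_inj)
      finally show ?thesis by (simp add: val_def)
    qed
    show "continuous_on (twist_carrier \<times> root_space L) (\<lambda>y. twist_action L (fst y) (snd y) n)"
      unfolding continuous_on_def
    proof
      fix z assume z: "z \<in> twist_carrier \<times> root_space L"
      define m where "m = pcode (twist (digit (fst z)) t, b)"
      have "\<forall>\<^sub>F y in nhds z. fst y \<in> twist_carrier \<longrightarrow> twist (digit (fst y)) t = twist (digit (fst z)) t"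
        using z by (intro eventually_nhds_fst eventually_twist_eq) auto
      then have ev: "\<forall>\<^sub>F y in at z within twist_carrier \<times> root_space L. snd y m = twist_action L (fst y) (snd y) n"
        unfolding eventually_at_filter by (rule eventually_mono) (auto simp: act_n m_def)
      have "continuous_on (twist_carrier \<times> root_space L) (\<lambda>y. snd y m)"
        by (rule continuous_on_product_then_coordinatewise[OF continuous_on_snd[OF continuous_on_id]])
      from bspec[OF this[unfolded continuous_on_def] z]
      have "((\<lambda>y. snd y m) \<longlongrightarrow> snd z m) (at z within twist_carrier \<times> root_space L)" .
      then have "((\<lambda>y. twist_action L (fst y) (snd y) n) \<longlongrightarrow> snd z m) (at z within twist_carrier \<times> root_space L)"
        using ev by (rule Lim_transform_eventually)
      moreover have "twist_action L (fst z) (snd z) n = snd z m" using z by (auto simp: act_n m_def)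
      ultimately show "((\<lambda>y. twist_action L (fst y) (snd y) n) \<longlongrightarrow> twist_action L (fst z) (snd z) n) (at z within twist_carrier \<times> root_space L)" by simp
    qed
  qed
  then show "continuous_map (prod_topology (top_of_set twist_carrier) (top_of_set (root_space L))) (top_of_set (root_space L)) (\<lambda>(g, x). twist_action L g x)"
    using twist_action_in by (auto simp: case_prod_beta simp flip: subtopology_Times)
qed

lemma orbit_twist_action_iff:
  assumes v: "v \<in> root_space L" and v': "v' \<in> root_space L"
  shows "orbit twist_group (twist_action L) v = orbit twist_group (twist_action L) v' \<longleftrightarrow> base v = base v'"
proof
  have base_act: "base (twist_action L g x) = base x" if "x \<in> root_space L" for g x
    using that by (simp add: base_def[abs_def] val_twist_action)
  have one: "\<one>\<^bsub>twist_group\<^esub> \<in> carrier twist_group" using group_twist_group by (simp add: group.is_monoid monoid.one_closed)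
  {
    assume "orbit twist_group (twist_action L) v = orbit twist_group (twist_action L) v'"
    moreover have "v \<in> orbit twist_group (twist_action L) v"
      unfolding orbit_def using one twist_action_one[OF v] by force
    ultimately obtain g where "v = twist_action L g v'" by (auto simp: orbit_def)
    then show "base v = base v'" using base_act[OF v'] by simp
  }
  assume eq: "base v = base v'"
  have sub: "orbit twist_group (twist_action L) y \<subseteq> orbit twist_group (twist_action L) x" if x: "x \<in> root_space L" and y: "y \<in> root_space L" and xy: "base x = base y" for x y
  proof -
    have "Re (val x (Var i)) = Re (val y (Var i))" for i using xy by (metis base_def)
    then obtain c where c: "\<And>t. c t < p" "\<And>t. val y t = val x (twist c t)"
      using fibre_transitive[of L "val x" "val y"] x y unfolding root_space_def by blast
    have "val y = val (twist_action L (undigit c) x)" using c(2) by (simp add: val_twist_action[OF x] fun_eq_iff)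
    then have yx: "y = twist_action L (undigit c) x" by (metis unval_val)
    have cG: "undigit c \<in> carrier twist_group" using undigit_in_carrier[OF c(1)] by (simp add: twist_group_def)
    show ?thesis
    proof
      fix z assume "z \<in> orbit twist_group (twist_action L) y"
      then obtain g where g: "g \<in> carrier twist_group" "z = twist_action L g y" by (auto simp: orbit_def)
      then have "z = twist_action L (g \<otimes>\<^bsub>twist_group\<^esub> undigit c) x" using twist_action_mult[OF x] yx by simp
      moreover have "g \<otimes>\<^bsub>twist_group\<^esub> undigit c \<in> carrier twist_group"
        using g(1) cG group_twist_group by (simp add: group.is_monoid monoid.m_closed)
      ultimately show "z \<in> orbit twist_group (twist_action L) x" by (auto simp: orbit_def)
    qed
  qed
  show "orbit twist_group (twist_action L) v = orbit twist_group (twist_action L) v'"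
    using sub[OF v v'] sub[OF v' v] eq by auto
qed

lemma orbit_space_root_space:
  assumes "compact L"
  shows "orbit_space twist_group (top_of_set (root_space L)) (twist_action L) homeomorphic_space top_of_set L"
proof (rule orbit_space_homeomorphic[OF compact_root_space[OF assms] continuous_on_base])
  show "base ` root_space L = L" using base_in base_surj by blast
qed (rule orbit_twist_action_iff)

end

section \<open>Roots of continuous functions\<close>

context root_of_unity_group
begin

text \<open>Functions approximable by values of terms contain a point-separating algebra to which the
  Stone-Weierstrass theorem applies.  Rational constants suffice since only closeness matters.\<close>

definition approx :: "(nat \<Rightarrow> real) set \<Rightarrow> ((nat \<Rightarrow> real) \<Rightarrow> complex) \<Rightarrow> bool" where
  "approx L F \<longleftrightarrow> (\<forall>e>0. \<exists>t. \<forall>v\<in>root_space L. cmod (F v - val v t) < e)"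

lemma val_rules:
  assumes "v \<in> root_space L"
  shows "val v (Const a b) = Complex (of_rat a) (of_rat b)" "val v (Add s t) = val v s + val v t"
    "val v (Mul s t) = val v s * val v t" "val v (Cnj t) = cnj (val v t)"
    "val v (Root 0 t) ^ p = val v t"
proof -
  have "valid L (val v)" using assms by (simp add: root_space_def)
  from validD(3-6,8)[OF this] show "val v (Const a b) = Complex (of_rat a) (of_rat b)"
    "val v (Add s t) = val v s + val v t" "val v (Mul s t) = val v s * val v t"
    "val v (Cnj t) = cnj (val v t)" "val v (Root 0 t) ^ p = val v t" .
qed

lemma approx_term: "(\<And>v. v \<in> root_space L \<Longrightarrow> F v = val v t) \<Longrightarrow> approx L F"
  unfolding approx_def by (intro allI impI exI[of _ t]) simp

lemma approx_add:
  assumes "approx L F" "approx L G" shows "approx L (\<lambda>v. F v + G v)"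
  unfolding approx_def
proof (intro allI impI)
  fix e :: real assume "e > 0"
  then have "e/2 > 0" by simp
  then obtain s t where st: "\<And>v. v \<in> root_space L \<Longrightarrow> cmod (F v - val v s) < e/2" "\<And>v. v \<in> root_space L \<Longrightarrow> cmod (G v - val v t) < e/2"
    using assms unfolding approx_def by meson
  have "cmod (F v + G v - val v (Add s t)) < e" if "v \<in> root_space L" for v
  proof -
    have "F v + G v - val v (Add s t) = (F v - val v s) + (G v - val v t)"
      by (simp add: val_rules[OF that])
    then have "cmod (F v + G v - val v (Add s t)) \<le> cmod (F v - val v s) + cmod (G v - val v t)"
      by (simp only: norm_triangle_ineq)
    then show ?thesis using st[OF that] by linarith
  qed
  then show "\<exists>t. \<forall>v\<in>root_space L. cmod (F v + G v - val v t) < e" by blast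
qed

lemma approx_mult:
  assumes "approx L F" "approx L G" and M: "\<And>v. v \<in> root_space L \<Longrightarrow> cmod (F v) \<le> M" "\<And>v. v \<in> root_space L \<Longrightarrow> cmod (G v) \<le> M"
  shows "approx L (\<lambda>v. F v * G v)"
  unfolding approx_def
proof (intro allI impI)
  fix e :: real assume e: "e > 0"
  define N where "N = max M 0"
  \<comment> \<open>the bound 1 on d controls the size of the approximating term\<close>
  define d where "d = min 1 (e / (2 * N + 2))"
  have N: "N \<ge> 0" "M \<le> N" by (auto simp: N_def)
  then have d: "d > 0" "d \<le> 1" using e by (auto simp: d_def)
  have "d \<le> e / (2 * N + 2)" by (simp add: d_def)
  then have "d * (2 * N + 2) \<le> e" using N by (subst (asm) pos_le_divide_eq) auto
  then have de: "N * d + d * (N + 1) < e" using d by (simp add: algebra_simps)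
  obtain s t where st: "\<And>v. v \<in> root_space L \<Longrightarrow> cmod (F v - val v s) < d" "\<And>v. v \<in> root_space L \<Longrightarrow> cmod (G v - val v t) < d"
    using assms(1,2) d(1) unfolding approx_def by meson
  have "cmod (F v * G v - val v (Mul s t)) < e" if v: "v \<in> root_space L" for v
  proof -
    have "val v t = G v - (G v - val v t)" by simp
    then have "cmod (val v t) \<le> cmod (G v) + cmod (G v - val v t)" using norm_triangle_ineq4 by metis
    then have t: "cmod (val v t) \<le> N + 1" using st(2)[OF v] M(2)[OF v] N d by linarith
    have "F v * G v - val v (Mul s t) = F v * (G v - val v t) + (F v - val v s) * val v t"
      by (simp add: val_rules[OF v] algebra_simps)
    then have "cmod (F v * G v - val v (Mul s t)) \<le> cmod (F v) * cmod (G v - val v t) + cmod (F v - val v s) * cmod (val v t)"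
      by (metis norm_mult norm_triangle_ineq)
    also have "\<dots> \<le> N * d + d * (N + 1)"
      using st[OF v] M(1)[OF v] N t d by (intro add_mono mult_mono) auto
    finally show ?thesis using de by linarith
  qed
  then show "\<exists>t. \<forall>v\<in>root_space L. cmod (F v * G v - val v t) < e" by blast
qed

lemma approx_real_const: "approx L (\<lambda>v. of_real c)"
  unfolding approx_def
proof (intro allI impI)
  fix e :: real assume "e > 0"
  then obtain r where r: "c < of_rat r" "of_rat r < c + e" using of_rat_dense[of c "c + e"] by auto
  have "cmod (of_real c - val v (Const r 0)) < e" if "v \<in> root_space L" for v
  proof -
    have "of_real c - val v (Const r 0) = of_real (c - of_rat r)"
      by (simp add: val_rules[OF that] complex_eq_iff)
    then show ?thesis using r by (simp only: norm_of_real)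
  qed
  then show "\<exists>t. \<forall>v\<in>root_space L. cmod (of_real c - val v t) < e" by blast
qed

lemma approx_Re: "approx L (\<lambda>v. of_real (Re (val v t)))"
proof (rule approx_term)
  fix v assume v: "v \<in> root_space L"
  show "of_real (Re (val v t)) = val v (Mul (Const (1/2) 0) (Add t (Cnj t)))"
    by (simp add: val_rules[OF v] complex_eq_iff of_rat_divide)
qed

lemma approx_Im: "approx L (\<lambda>v. of_real (Im (val v t)))"
proof (rule approx_term)
  fix v assume v: "v \<in> root_space L"
  show "of_real (Im (val v t)) = val v (Mul (Const 0 (- 1/2)) (Add t (Mul (Const (- 1) 0) (Cnj t))))"
    by (simp add: val_rules[OF v] complex_eq_iff of_rat_divide of_rat_minus)
qed

lemma approx_real_continuous:
  assumes L: "compact L" and F: "continuous_on (root_space L) F"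
  shows "approx L (\<lambda>v. of_real (F v))"
proof -
  define R where "R = {F. continuous_on (root_space L) F \<and> approx L (\<lambda>v. complex_of_real (F v))}"
  have bdd: "\<exists>M. \<forall>v\<in>root_space L. \<bar>F v\<bar> \<le> M" if "F \<in> R" for F
  proof -
    have "compact (F ` root_space L)" using that compact_root_space[OF L] by (auto simp: R_def intro: compact_continuous_image)
    then have "bounded (F ` root_space L)" by (rule compact_imp_bounded)
    then show ?thesis by (auto simp: bounded_iff)
  qed
  interpret function_ring_on R "root_space L"
  proof
    show "compact (root_space L)" by (rule compact_root_space[OF L])
    show "continuous_on (root_space L) f" if "f \<in> R" for f using that by (simp add: R_def)
    show "(\<lambda>x. f x + g x) \<in> R" if "f \<in> R" "g \<in> R" for f g
      using that approx_add by (auto simp: R_def intro!: continuous_intros)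
    show "(\<lambda>x. f x * g x) \<in> R" if fg: "f \<in> R" "g \<in> R" for f g
    proof -
      obtain A B where AB: "\<forall>v\<in>root_space L. \<bar>f v\<bar> \<le> A" "\<forall>v\<in>root_space L. \<bar>g v\<bar> \<le> B" using bdd fg by metis
      have "approx L (\<lambda>v. complex_of_real (f v) * complex_of_real (g v))"
        by (rule approx_mult[where M = "max A B"]) (use fg AB in \<open>auto simp: R_def le_max_iff_disj\<close>)
      then show ?thesis using fg by (auto simp: R_def intro!: continuous_intros)
    qed
    show "(\<lambda>_. c) \<in> R" for c using approx_real_const by (simp add: R_def)
    show "\<exists>f\<in>R. f x \<noteq> f y" if xy: "x \<in> root_space L" "y \<in> root_space L" "x \<noteq> y" for x y
    proof -
      have "val x \<noteq> val y" using xy(3) by (metis unval_val)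
      then obtain t where "val x t \<noteq> val y t" by blast
      then have "Re (val x t) \<noteq> Re (val y t) \<or> Im (val x t) \<noteq> Im (val y t)" by (simp add: complex_eq_iff)
      moreover have RI: "(\<lambda>v. Re (val v t)) \<in> R" "(\<lambda>v. Im (val v t)) \<in> R"
        using approx_Re approx_Im by (auto simp: R_def intro!: continuous_intros continuous_on_val)
      ultimately show ?thesis
      proof (elim disjE)
        assume "Re (val x t) \<noteq> Re (val y t)"
        then show ?thesis by (intro bexI[of _ "\<lambda>v. Re (val v t)"] RI)
      next
        assume "Im (val x t) \<noteq> Im (val y t)"
        then show ?thesis by (intro bexI[of _ "\<lambda>v. Im (val v t)"] RI)
      qed
    qed
  qed
  show ?thesis
    unfolding approx_def
  proof (intro allI impI)
    fix e :: real assume "e > 0"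
    then have e2: "e/2 > 0" by simp
    obtain G where G: "G \<in> R" "\<And>v. v \<in> root_space L \<Longrightarrow> \<bar>F v - G v\<bar> < e/2"
      using Stone_Weierstrass_basic[OF F e2] by blast
    obtain t where t: "\<And>v. v \<in> root_space L \<Longrightarrow> cmod (of_real (G v) - val v t) < e/2"
      using G(1) e2 unfolding R_def approx_def by blast
    have "cmod (of_real (F v) - val v t) < e" if v: "v \<in> root_space L" for v
    proof -
      have "cmod (of_real (F v) - val v t) \<le> cmod (of_real (F v - G v)) + cmod (of_real (G v) - val v t)"
        using norm_triangle_ineq[of "of_real (F v - G v)" "of_real (G v) - val v t"] by simp
      then show ?thesis using G(2)[OF v] t[OF v] unfolding norm_of_real by linarith
    qed
    then show "\<exists>t. \<forall>v\<in>root_space L. cmod (of_real (F v) - val v t) < e" by blast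
  qed
qed

lemma approx_continuous:
  assumes L: "compact L" and F: "continuous_on (root_space L) F"
  shows "approx L F"
proof -
  have 1: "approx L (\<lambda>v. of_real (Re (F v)))" "approx L (\<lambda>v. of_real (Im (F v)))"
    by (intro approx_real_continuous L continuous_intros F)+
  have i: "approx L (\<lambda>v. \<i>)"
  proof (rule approx_term)
    fix v assume "v \<in> root_space L"
    then show "\<i> = val v (Const 0 1)" by (simp add: val_rules complex_eq_iff)
  qed
  have "compact (F ` root_space L)" using F compact_root_space[OF L] by (auto intro: compact_continuous_image)
  then have "bounded (F ` root_space L)" by (rule compact_imp_bounded)
  then obtain M where M: "\<And>v. v \<in> root_space L \<Longrightarrow> cmod (F v) \<le> M" by (auto simp: bounded_iff)
  have "approx L (\<lambda>v. \<i> * of_real (Im (F v)))"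
  proof (rule approx_mult[OF i 1(2), where M = "max 1 M"])
    show "cmod (complex_of_real (Im (F v))) \<le> max 1 M" if "v \<in> root_space L" for v
      using M[OF that] abs_Im_le_cmod[of "F v"] unfolding norm_of_real by linarith
  qed simp
  from approx_add[OF 1(1) this] show ?thesis by (simp flip: complex_eq)
qed

text \<open>Let a term t approximate an extension of h to within the minimum of its modulus on A.  Then
  the quotient of the two has positive real part on A and therefore a principal p-th root, while
  the term itself has the p-th root Root 0 t.\<close>

lemma has_roots_root_space: assumes L: "compact L" shows "has_roots (root_space L)"
  unfolding has_roots_def
proof (intro allI impI)
  fix A and h :: "(nat \<Rightarrow> real) \<Rightarrow> complex"
  assume A: "closed A" "A \<subseteq> root_space L" and h: "continuous_on A h" and nz: "\<forall>x\<in>A. h x \<noteq> 0"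
  have cA: "compact A" by (rule compact_closed_subset[OF compact_root_space[OF L] A])
  have "closedin (top_of_set (root_space L)) A" using A by (intro closed_subset)
  then obtain H where H: "continuous_on (root_space L) H" "\<And>x. x \<in> A \<Longrightarrow> H x = h x"
    using Tietze_unbounded[OF h] by metis
  have "\<exists>d>0. \<forall>x\<in>A. d \<le> cmod (h x)"
  proof (cases "A = {}")
    case False
    obtain a where "a \<in> A" "\<forall>x\<in>A. cmod (h a) \<le> cmod (h x)"
      using continuous_attains_inf[OF cA False, of "\<lambda>x. cmod (h x)"] h by (auto intro: continuous_intros)
    then show ?thesis using nz by (intro exI[of _ "cmod (h a)"]) auto
  qed (auto intro: exI[of _ 1])
  then obtain d where d: "d > 0" "\<And>x. x \<in> A \<Longrightarrow> d \<le> cmod (h x)" by blast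
  obtain t where t: "\<And>v. v \<in> root_space L \<Longrightarrow> cmod (H v - val v t) < d"
    using approx_continuous[OF L H(1)] d(1) unfolding approx_def by blast
  have close: "cmod (1 - val x t / h x) < 1" if x: "x \<in> A" for x
  proof -
    have hx: "h x \<noteq> 0" using nz x by blast
    have "1 - val x t / h x = (h x - val x t) / h x" using hx by (simp add: diff_divide_distrib)
    then have "cmod (1 - val x t / h x) = cmod (h x - val x t) / cmod (h x)" by (simp add: norm_divide)
    moreover have "cmod (h x - val x t) < cmod (h x)" using t[of x] H(2)[OF x] d(2)[OF x] A(2) x by force
    ultimately show ?thesis using hx by simp
  qed
  have pos: "Re (val x t / h x) > 0" if "x \<in> A" for x
    using close[OF that] abs_Re_le_cmod[of "1 - val x t / h x"] by (simp add: abs_if split: if_splits)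
  define r where "r x = val x (Root 0 t) / exp (Ln (val x t / h x) / of_nat p)" for x
  have "continuous_on A r"
    unfolding r_def
  proof (intro continuous_intros continuous_on_val h)
    show "\<forall>x\<in>A. h x \<noteq> 0" by (rule nz)
    show "val x t / h x \<notin> \<real>\<^sub>\<le>\<^sub>0" if "x \<in> A" for x
      using pos[OF that] by (auto simp: complex_nonpos_Reals_iff)
  qed auto
  moreover have "r x ^ p = h x" if x: "x \<in> A" for x
  proof -
    have nz1: "val x t / h x \<noteq> 0" using pos[OF x] by auto
    have "exp (Ln (val x t / h x) / of_nat p) ^ p = val x t / h x"
      using nz1 by (simp flip: exp_of_nat_mult)
    then have "r x ^ p = val x t / (val x t / h x)"
      using val_rules(5)[of x L t] x A(2) by (auto simp: r_def power_divide)
    then show ?thesis using nz1 by simp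
  qed
  ultimately show "\<exists>r. continuous_on A r \<and> (\<forall>x\<in>A. r x ^ p = h x)" by blast
qed

end

section \<open>Connected sets and the lower bound\<close>

lemma compact_closed_disc: "compactin (closed_disc n) (topspace (closed_disc n))"
proof -
  let ?D = "{x::nat \<Rightarrow> real. (\<forall>i\<ge>n. x i = 0) \<and> (\<Sum>i<n. (x i)\<^sup>2) \<le> 1}"
  have "?D = (\<Inter>i\<in>{n..}. {x. x i = 0}) \<inter> {x. (\<Sum>i<n. (x i)\<^sup>2) \<le> 1}" by auto
  also have "closed \<dots>"
    by (intro closed_Int closed_INT ballI closed_Collect_eq closed_Collect_le continuous_intros continuous_on_coord)
  finally have cl: "closed ?D" .
  have sub: "?D \<subseteq> {x. \<forall>i. x i \<in> {-1..1}}"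
  proof clarify
    fix x :: "nat \<Rightarrow> real" and i assume x: "\<forall>i\<ge>n. x i = 0" "(\<Sum>i<n. (x i)\<^sup>2) \<le> 1"
    show "x i \<in> {-1..1}"
    proof (cases "i < n")
      case True
      have "(x i)\<^sup>2 \<le> (\<Sum>i<n. (x i)\<^sup>2)" by (rule member_le_sum) (use True in auto)
      then have "(x i)\<^sup>2 \<le> 1" using x(2) by linarith
      then have "\<bar>x i\<bar> \<le> 1" by (simp add: abs_square_le_1)
      then show ?thesis by auto
    qed (use x in auto)
  qed
  have "compact {x::nat \<Rightarrow> real. \<forall>i. x i \<in> {-1..1}}" by (rule compact_Pi_coordinates) simp
  from compact_closed_subset[OF this cl sub] have "compact ?D" .
  then show ?thesis by (simp add: closed_disc_eq compactin_subtopology)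
qed

text \<open>In the weak topology it is enough to look at closed cells.  They are path connected, hence either
  contained in C or disjoint from it, and they are compact.\<close>

lemma closedin_path_saturated:
  assumes \<Phi>: "cw_structure K \<Phi>" and C: "C \<subseteq> topspace K"
    and sat: "\<And>x y. path_component_of K x y \<Longrightarrow> x \<in> C \<Longrightarrow> y \<in> C"
  shows "closedin K C"
proof -
  note cw = \<Phi>[unfolded cw_structure_def]
  have haus: "Hausdorff_space K" using cw by (elim conjE)
  have cells: "\<forall>(n, f)\<in>\<Phi>. continuous_map (closed_disc n) K f \<and> inj_on f (open_disc n)"
    using cw by (elim conjE)
  have weak: "\<forall>C\<subseteq>topspace K. (\<forall>(n, f)\<in>\<Phi>. closedin K (C \<inter> f ` topspace (closed_disc n))) \<longrightarrow> closedin K C"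
    using cw by (elim conjE)
  have "closedin K (C \<inter> f ` topspace (closed_disc n))" if nf: "(n, f) \<in> \<Phi>" for n f
  proof -
    let ?D = "topspace (closed_disc n)"
    have f: "continuous_map (closed_disc n) K f" using bspec[OF cells nf] by simp
    have path: "path_component_of K (f (\<lambda>i. 0)) (f x)" if x: "x \<in> ?D" for x
    proof -
      have xx: "\<forall>i\<ge>n. x i = 0" "(\<Sum>i<n. (x i)\<^sup>2) \<le> 1" using x by (auto simp: closed_disc_eq)
      have "continuous_map (top_of_set {0..1::real}) (closed_disc n) (\<lambda>t i. t * x i)"
        unfolding closed_disc_eq continuous_map_subtopology_eu
      proof
        show "continuous_on {0..1} (\<lambda>t i. t * x i)"
          by (intro continuous_on_coordinatewise_then_product continuous_intros)
        show "(\<lambda>t i. t * x i) \<in> {0..1} \<rightarrow> {x. (\<forall>i\<ge>n. x i = 0) \<and> (\<Sum>i<n. (x i)\<^sup>2) \<le> 1}"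
        proof (intro Pi_I CollectI conjI)
          fix t :: real assume t: "t \<in> {0..1}"
          have "(\<Sum>i<n. (t * x i)\<^sup>2) \<le> (\<Sum>i<n. (x i)\<^sup>2)"
            using t by (intro sum_mono) (auto simp: power_mult_distrib power_le_one intro: mult_left_le_one_le)
          then show "(\<Sum>i<n. (t * x i)\<^sup>2) \<le> 1" using xx by simp
        qed (use xx in simp)
      qed
      from continuous_map_compose[OF this f] have "pathin K (\<lambda>t. f (\<lambda>i. t * x i))"
        by (simp add: pathin_def o_def)
      then show ?thesis unfolding path_component_of_def by (intro exI[of _ "\<lambda>t. f (\<lambda>i. t * x i)"]) simp
    qed
    have "C \<inter> f ` ?D = {} \<or> C \<inter> f ` ?D = f ` ?D"
    proof (cases "f (\<lambda>i. 0) \<in> C")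
      case True
      then show ?thesis using sat[OF path] by blast
    next
      case False
      then have "f x \<notin> C" if "x \<in> ?D" for x
        using sat[of "f x" "f (\<lambda>i. 0)"] path[OF that] path_component_of_sym by metis
      then show ?thesis by blast
    qed
    moreover have "closedin K (f ` ?D)"
      by (rule compactin_imp_closedin[OF haus image_compactin[OF compact_closed_disc f]])
    ultimately show ?thesis by (metis closedin_empty)
  qed
  then have "\<forall>(n, f)\<in>\<Phi>. closedin K (C \<inter> f ` topspace (closed_disc n))" by (intro ballI case_prodI2) simp
  with weak C show ?thesis by simp
qed

lemma clopen_path_component:
  assumes "cw_complex K"
  shows "closedin K (path_component_of_set K x)" "openin K (path_component_of_set K x)"
proof -
  obtain \<Phi> where \<Phi>: "cw_structure K \<Phi>" using assms by (auto simp: cw_complex_def)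
  let ?P = "path_component_of_set K x"
  have sub: "?P \<subseteq> topspace K" by (rule path_component_of_subset_topspace)
  show "closedin K ?P"
    by (rule closedin_path_saturated[OF \<Phi> sub]) (auto intro: path_component_of_trans)
  have "closedin K (topspace K - ?P)"
  proof (rule closedin_path_saturated[OF \<Phi>])
    fix y z assume "path_component_of K y z" "y \<in> topspace K - ?P"
    then show "z \<in> topspace K - ?P"
      by (metis (mono_tags, lifting) Diff_iff mem_Collect_eq path_component_of_equiv)
  qed auto
  then show "openin K ?P" using sub by (simp add: openin_closedin_eq)
qed

text \<open>Send a and b to different path components.  These are clopen, so no extension exists over a
  connected set containing both points.\<close>

lemma connected_not_dim_0:
  fixes X :: "'a::metric_space set"
  assumes C: "connected C" "C \<subseteq> X" "a \<in> C" "b \<in> C" "a \<noteq> b"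
    and K: "eilenberg_maclane_space (integer_mod_group p) 0 K" and p: "p \<ge> 2"
  shows "\<not> extends_all_maps (top_of_set X) K"
proof
  assume ext: "extends_all_maps (top_of_set X) K"
  obtain h where h: "bij_betw h (path_components_of K) {0..<int p}"
    using K p unfolding eilenberg_maclane_space_def by (auto simp: carrier_integer_mod_group)
  have "0 \<in> h ` path_components_of K" "1 \<in> h ` path_components_of K"
    using h p by (simp_all add: bij_betw_def)
  then obtain P Q where PQ: "P \<in> path_components_of K" "Q \<in> path_components_of K" "h P = 0" "h Q = 1" by force
  obtain x where x: "x \<in> topspace K" "P = path_component_of_set K x" using PQ(1) by (auto simp: path_components_of_def)
  obtain y where y: "y \<in> topspace K" "Q = path_component_of_set K y" using PQ(2) by (auto simp: path_components_of_def)
  have "P \<noteq> Q" using PQ by auto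
  then have nxy: "\<not> path_component_of K x y" using x y path_component_of_eq by metis
  have cw: "cw_complex K" using K by (simp add: eilenberg_maclane_space_def)
  define f where "f z = (if z = a then x else y)" for z
  have A: "closedin (top_of_set X) {a, b}" using C by (intro closed_subset) auto
  have "subtopology (top_of_set X) {a, b} = top_of_set {a, b}"
    using C by (simp add: subtopology_subtopology Int_absorb1 subset_iff)
  moreover have "continuous_map (top_of_set {a, b}) K f"
    unfolding continuous_map_def
  proof (intro conjI allI impI)
    show "f \<in> topspace (top_of_set {a, b}) \<rightarrow> topspace K" using x y by (auto simp: f_def)
    fix U
    let ?S = "{z \<in> topspace (top_of_set {a, b}). f z \<in> U}"
    have "closed ({a, b} - ?S)" by (intro finite_imp_closed) auto
    then have "closedin (top_of_set {a, b}) ({a, b} - ?S)" by (intro closed_subset) auto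
    then show "openin (top_of_set {a, b}) ?S" by (subst openin_closedin_eq) auto
  qed
  ultimately obtain g where g: "continuous_map (top_of_set X) K g" "\<forall>z\<in>{a, b}. g z = f z"
    using ext A unfolding extends_all_maps_def by metis
  have "connectedin (top_of_set X) C" using C by (simp add: connectedin_subtopology)
  then have con: "connectedin K (g ` C)" by (rule connectedin_continuous_map_image[OF g(1)])
  have ga: "g a = x" "g b = y" using g(2) C(5) by (auto simp: f_def)
  have "g ` C \<subseteq> path_component_of_set K x \<or> disjnt (g ` C) (path_component_of_set K x)"
    by (rule connectedin_clopen_cases[OF con clopen_path_component[OF cw]])
  moreover have "x \<in> g ` C" "y \<in> g ` C" using ga C by auto
  moreover have "path_component_of K x x" using x by (simp add: path_component_of_refl)
  ultimately show False using nxy by (auto simp: disjnt_iff)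
qed

section \<open>Zero-dimensional compacta\<close>

definition totally_disconnected :: "'a::topological_space set \<Rightarrow> bool" where
  "totally_disconnected X \<longleftrightarrow> (\<forall>C a b. connected C \<longrightarrow> C \<subseteq> X \<longrightarrow> a \<in> C \<longrightarrow> b \<in> C \<longrightarrow> a = b)"

text \<open>In a compact Hausdorff space components and quasi-components agree.\<close>

lemma separate_points:
  fixes X :: "'a::metric_space set"
  assumes X: "compact X" "totally_disconnected X" and xy: "x \<in> X" "y \<in> X" "x \<noteq> y"
  obtains U where "openin (top_of_set X) U" "closedin (top_of_set X) U" "x \<in> U" "y \<notin> U"
proof -
  have "quasi_component_of (top_of_set X) x = connected_component_of (top_of_set X) x"
    using X(1) by (intro quasi_eq_connected_component_of)
      (auto intro: compact_space_subtopology Hausdorff_space_subtopology simp: Hausdorff_space_euclidean)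
  moreover have "\<not> connected_component_of (top_of_set X) x y"
  proof
    assume "connected_component_of (top_of_set X) x y"
    then obtain C where "connectedin (top_of_set X) C" "x \<in> C" "y \<in> C" by (auto simp: connected_component_of_def)
    then show False using X(2) xy(3) unfolding totally_disconnected_def by (auto simp: connectedin_subtopology)
  qed
  ultimately have "\<not> quasi_component_of (top_of_set X) x y" by simp
  then show ?thesis using xy that unfolding quasi_component_of by auto
qed

lemma separate_point_closed:
  fixes X :: "'a::metric_space set"
  assumes X: "compact X" "totally_disconnected X" and x: "x \<in> X" and F: "closed F" "F \<subseteq> X" "x \<notin> F"
  obtains U where "openin (top_of_set X) U" "closedin (top_of_set X) U" "x \<in> U" "U \<inter> F = {}"
proof -
  have "\<exists>U. openin (top_of_set X) U \<and> closedin (top_of_set X) U \<and> x \<in> U \<and> y \<notin> U" if "y \<in> F" for y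
    using separate_points[OF X x, of y] that F by (metis subsetD)
  then obtain U where U: "\<And>y. y \<in> F \<Longrightarrow> openin (top_of_set X) (U y)" "\<And>y. y \<in> F \<Longrightarrow> closedin (top_of_set X) (U y)"
    "\<And>y. y \<in> F \<Longrightarrow> x \<in> U y" "\<And>y. y \<in> F \<Longrightarrow> y \<notin> U y" by metis
  have clU: "closed (U y)" if "y \<in> F" for y
    using U(2)[OF that] X(1) compact_imp_closed closedin_closed_trans by blast
  have "compact F" by (rule compact_closed_subset[OF X(1) F(1,2)])
  moreover have "F \<subseteq> (\<Union>y\<in>F. - U y)" using U(4) by blast
  ultimately obtain D where D: "D \<subseteq> F" "finite D" "F \<subseteq> (\<Union>y\<in>D. - U y)"
    using compactE_image[of F F "\<lambda>y. - U y"] clU by (metis open_Compl)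
  show ?thesis
  proof (rule that[of "\<Inter>(insert X (U ` D))"])
    show "openin (top_of_set X) (\<Inter>(insert X (U ` D)))"
      using D U(1) by (intro openin_Inter) auto
    show "closedin (top_of_set X) (\<Inter>(insert X (U ` D)))"
      using D U(2) by (intro closedin_Inter) auto
    show "x \<in> \<Inter>(insert X (U ` D))" using x U(3) D(1) by auto
    show "\<Inter>(insert X (U ` D)) \<inter> F = {}" using D(3) by auto
  qed
qed

lemma separate_closed:
  fixes X :: "'a::metric_space set"
  assumes X: "compact X" "totally_disconnected X" and P: "closed P" "P \<subseteq> X" and F: "closed F" "F \<subseteq> X" "P \<inter> F = {}"
  obtains U where "openin (top_of_set X) U" "closedin (top_of_set X) U" "P \<subseteq> U" "U \<inter> F = {}"
proof -
  have "\<exists>U. openin (top_of_set X) U \<and> closedin (top_of_set X) U \<and> x \<in> U \<and> U \<inter> F = {}" if "x \<in> P" for x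
  proof -
    have "x \<in> X" "x \<notin> F" using that P F by auto
    then show ?thesis using separate_point_closed[OF X _ F(1,2)] by metis
  qed
  then obtain U where U: "\<And>y. y \<in> P \<Longrightarrow> openin (top_of_set X) (U y)" "\<And>y. y \<in> P \<Longrightarrow> closedin (top_of_set X) (U y)"
    "\<And>y. y \<in> P \<Longrightarrow> y \<in> U y" "\<And>y. y \<in> P \<Longrightarrow> U y \<inter> F = {}" by metis
  have "\<exists>T. open T \<and> U y = X \<inter> T" if "y \<in> P" for y using U(1)[OF that] by (simp add: openin_open)
  then obtain T where T: "\<And>y. y \<in> P \<Longrightarrow> open (T y)" "\<And>y. y \<in> P \<Longrightarrow> U y = X \<inter> T y" by metis
  have "compact P" by (rule compact_closed_subset[OF X(1) P])
  moreover have "P \<subseteq> (\<Union>y\<in>P. T y)" using U(3) T(2) by blast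
  ultimately obtain D where D: "D \<subseteq> P" "finite D" "P \<subseteq> (\<Union>y\<in>D. T y)"
    using compactE_image[of P P T] T(1) by metis
  show ?thesis
  proof (rule that[of "\<Union>(U ` D)"])
    show "openin (top_of_set X) (\<Union>(U ` D))" using D U(1) by (intro openin_Union) auto
    show "closedin (top_of_set X) (\<Union>(U ` D))" using D U(2) by (intro closedin_Union) auto
    show "P \<subseteq> \<Union>(U ` D)"
    proof
      fix z assume "z \<in> P"
      then obtain y where "y \<in> D" "z \<in> T y" using D(3) by blast
      then show "z \<in> \<Union>(U ` D)" using T(2)[of y] D(1) P(2) \<open>z \<in> P\<close> by blast
    qed
    show "\<Union>(U ` D) \<inter> F = {}" using U(4) D(1) by blast
  qed
qed

text \<open>Separate the closed set where m equals u from the one where it does not by clopen sets, one value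
  after the other.\<close>

lemma extend_finite_valued:
  fixes X :: "'a::metric_space set" and m :: "'a \<Rightarrow> 'b::t1_space"
  assumes X: "compact X" "totally_disconnected X" and M: "closed M" "M \<subseteq> X"
    and V: "finite V" "c \<in> V" and m: "continuous_on M m" "m ` M \<subseteq> V"
  obtains w where "continuous_on X w" "w ` X \<subseteq> V" "\<And>x. x \<in> M \<Longrightarrow> w x = m x"
proof -
  define D where "D u = {x \<in> M. m x = u}" for u
  have clD: "closed {x \<in> M. m x \<in> S}" if "finite S" for S
  proof -
    have "closed (M \<inter> m -` S)" using m(1) M(1) finite_imp_closed[OF that] by (rule continuous_closed_preimage)
    moreover have "M \<inter> m -` S = {x \<in> M. m x \<in> S}" by auto
    ultimately show ?thesis by simp
  qed
  have "\<exists>w. continuous_on X w \<and> w ` X \<subseteq> V \<and> (\<forall>u\<in>F. \<forall>x\<in>D u. w x = u)" if "F \<subseteq> V" for F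
    using finite_subset[OF that V(1)] that
  proof (induction F rule: finite_induct)
    case empty
    then show ?case using V(2) by (intro exI[of _ "\<lambda>_. c"]) auto
  next
    case (insert u F)
    then obtain w where w: "continuous_on X w" "w ` X \<subseteq> V" "\<forall>u\<in>F. \<forall>x\<in>D u. w x = u" by auto
    define E where "E = {x \<in> M. m x \<in> V - {u}}"
    have D: "closed (D u)" "D u \<subseteq> X" using clD[of "{u}"] M(2) by (auto simp: D_def)
    have E: "closed E" "E \<subseteq> X" "D u \<inter> E = {}"
      using clD[of "V - {u}"] V(1) M(2) by (auto simp: E_def D_def)
    obtain U where U: "openin (top_of_set X) U" "closedin (top_of_set X) U" "D u \<subseteq> U" "U \<inter> E = {}"
      using separate_closed[OF X D E] by blast
    have UX: "U \<subseteq> X" using U(1) openin_imp_subset by blast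
    have clU: "closed U" using U(2) X(1) compact_imp_closed closedin_closed_trans by blast
    have "closedin (top_of_set X) (X - U)" using U(1) by (simp add: closedin_diff)
    then have clXU: "closed (X - U)" using X(1) compact_imp_closed closedin_closed_trans by blast
    have "continuous_on (U \<union> (X - U)) (\<lambda>x. if x \<in> U then u else w x)"
      by (rule continuous_on_cases[OF clU clXU]) (auto intro: continuous_on_subset[OF w(1)])
    moreover have "U \<union> (X - U) = X" using UX by blast
    moreover have "(\<lambda>x. if x \<in> U then u else w x) ` X \<subseteq> V" using w(2) insert.prems by auto
    moreover have "(if x \<in> U then u else w x) = u'" if "u' \<in> insert u F" "x \<in> D u'" for u' x
    proof (cases "u' = u")
      case True then show ?thesis using that U(3) by auto
    next
      case False
      then have "x \<in> E" using that insert.prems by (auto simp: D_def E_def)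
      then have "x \<notin> U" using U(4) by blast
      then show ?thesis using False that w(3) by auto
    qed
    ultimately show ?case by (intro exI[of _ "\<lambda>x. if x \<in> U then u else w x"]) auto
  qed
  from this[of V] obtain w where w: "continuous_on X w" "w ` X \<subseteq> V" "\<forall>u\<in>V. \<forall>x\<in>D u. w x = u" by auto
  show ?thesis by (rule that[OF w(1,2)]) (use w(3) m(2) in \<open>auto simp: D_def\<close>)
qed

section \<open>Zero-dimensional spaces times an interval\<close>

context root_of_unity_group
begin

lemma small_pieces_lift:
  fixes f :: "'y::metric_space \<Rightarrow> (nat \<Rightarrow> real) set"
  assumes A: "compact A" and f: "continuous_map (top_of_set A) K f"
  obtains d where "d > 0" "\<And>T. T \<subseteq> A \<Longrightarrow> (\<And>x y. x \<in> T \<Longrightarrow> y \<in> T \<Longrightarrow> dist x y < d) \<Longrightarrow> lifts f T"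
proof -
  have "\<exists>V. open V \<and> x \<in> V \<and> lifts f (A \<inter> V)" if "x \<in> A" for x
    using lifts_locally[OF A f that] by metis
  then obtain V where V: "\<And>x. x \<in> A \<Longrightarrow> open (V x)" "\<And>x. x \<in> A \<Longrightarrow> x \<in> V x" "\<And>x. x \<in> A \<Longrightarrow> lifts f (A \<inter> V x)" by metis
  obtain d where d: "d > 0" "\<And>x. x \<in> A \<Longrightarrow> \<exists>G\<in>V ` A. ball x d \<subseteq> G"
    using Heine_Borel_lemma[OF A, of "V ` A"] V(1,2) by (metis (no_types, lifting) UN_I image_iff subsetI)
  show ?thesis
  proof (rule that[OF d(1)])
    fix T assume T: "T \<subseteq> A" "\<And>x y. x \<in> T \<Longrightarrow> y \<in> T \<Longrightarrow> dist x y < d"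
    show "lifts f T"
    proof (cases "T = {}")
      case True
      then show ?thesis using lifts_empty by simp
    next
      case False
      then obtain x where x: "x \<in> T" by blast
      then obtain y where y: "y \<in> A" "ball x d \<subseteq> V y" using d(2) T(1) by blast
      have "T \<subseteq> A \<inter> V y" using T x y(2) by (auto simp: subset_iff)
      then show ?thesis by (rule lifts_subset[OF V(3)[OF y(1)]])
    qed
  qed
qed

text \<open>Over L times an interval, lifts are extended from one short interval to the next.  The mismatch lives
  over a slice, where it is a function on a closed subset of L, so it extends over L and can be removed.\<close>

lemma lifts_strip:
  fixes f :: "'a::metric_space \<times> real \<Rightarrow> (nat \<Rightarrow> real) set"
  assumes L: "compact L" "totally_disconnected L" and A: "closed A" "A \<subseteq> L \<times> {0..1}"
    and W: "W \<subseteq> L" "closed W"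
    and small: "\<And>s t. s \<le> t \<Longrightarrow> t \<le> s + h \<Longrightarrow> lifts f (A \<inter> W \<times> {s..t})" and h: "h \<ge> 0"
  shows "lifts f (A \<inter> W \<times> {0..real k * h})"
proof (induction k)
  case 0
  show ?case using small[of 0 0] h by simp
next
  case (Suc k)
  define c where "c = real k * h"
  let ?B = "A \<inter> W \<times> {0..c}" and ?C = "A \<inter> W \<times> {c..c + h}"
  have c: "c \<ge> 0" "real (Suc k) * h = c + h" using h by (auto simp: c_def algebra_simps)
  have cl: "closed ?B" "closed ?C" by (intro closed_Int A(1) closed_Times W(2) closed_atLeastAtMost)+
  have "lifts f (?B \<union> ?C)"
  proof (rule lifts_Un[OF cl])
    show "lifts f ?B" using Suc by (simp add: c_def)
    show "lifts f ?C" using small h by simp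
    fix m assume m: "continuous_on (?B \<inter> ?C) m" "m ` (?B \<inter> ?C) \<subseteq> mu"
    define M where "M = {l \<in> W. (l, c) \<in> A}"
    have MBC: "(l, c) \<in> ?B \<inter> ?C" if "l \<in> M" for l using that h c by (auto simp: M_def)
    have "closed M"
    proof -
      have "closed (W \<inter> (\<lambda>l. (l, c)) -` A)"
        by (rule continuous_closed_preimage[OF _ W(2) A(1)]) (intro continuous_intros)
      moreover have "W \<inter> (\<lambda>l. (l, c)) -` A = M" by (auto simp: M_def)
      ultimately show ?thesis by simp
    qed
    moreover have "M \<subseteq> L" using W by (auto simp: M_def)
    moreover have "continuous_on M (\<lambda>l. inverse (m (l, c)))"
    proof (intro continuous_intros)
      show "continuous_on M (\<lambda>l. m (l, c))"
        by (rule continuous_on_compose2[OF m(1)]) (use MBC in \<open>auto intro!: continuous_intros\<close>)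
      show "\<forall>l\<in>M. m (l, c) \<noteq> 0" using m(2) MBC mu_nz by blast
    qed
    moreover have "(\<lambda>l. inverse (m (l, c))) ` M \<subseteq> mu"
    proof (rule image_subsetI)
      fix l assume "l \<in> M"
      then have "m (l, c) \<in> mu" using m(2) MBC by blast
      then show "inverse (m (l, c)) \<in> mu" by (rule mu_inverse)
    qed
    ultimately obtain w where w: "continuous_on L w" "w ` L \<subseteq> mu" "\<And>l. l \<in> M \<Longrightarrow> w l = inverse (m (l, c))"
      using extend_finite_valued[OF L _ _ finite_mu one_in_mu] by blast
    show "\<exists>u w. continuous_on ?B u \<and> u ` ?B \<subseteq> mu \<and> continuous_on ?C w \<and> w ` ?C \<subseteq> mu \<and>
        (\<forall>x\<in>?B \<inter> ?C. u x = w x * m x)"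
    proof (rule exI[of _ "\<lambda>_. 1"], rule exI[of _ "\<lambda>y. w (fst y)"], intro conjI ballI)
      show "continuous_on ?C (\<lambda>y. w (fst y))"
        by (rule continuous_on_compose2[OF w(1)]) (use W in \<open>auto intro!: continuous_intros\<close>)
      show "(\<lambda>y. w (fst y)) ` ?C \<subseteq> mu" using w(2) W(1) by (auto simp: image_subset_iff subset_iff)
      fix y assume y: "y \<in> ?B \<inter> ?C"
      then have yc: "y = (fst y, c)" by (cases y) auto
      have "fst y \<in> M" using y yc by (cases y) (auto simp: M_def)
      then have "w (fst y) = inverse (m y)" using w(3) yc by metis
      moreover have "m y \<noteq> 0" using m(2) y mu_nz by blast
      ultimately show "1 = w (fst y) * m y" by simp
    qed auto
  qed
  moreover have "?B \<union> ?C = A \<inter> W \<times> {0..real (Suc k) * h}" using c h by auto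
  ultimately show ?case by simp
qed

lemma lifts_disjoint_Un:
  assumes "closed B" "closed C" "B \<inter> C = {}" "lifts f B" "lifts f C"
  shows "lifts f (B \<union> C)"
  by (rule lifts_Un[OF assms(1,2,4,5)]) (use assms(3) in \<open>auto intro!: exI[of _ "\<lambda>_. 1"]\<close>)

text \<open>A partition of L into small clopen sets and of the interval into short pieces makes all
  pieces small enough for local lifts.\<close>

lemma lifts_zero_dim_times_interval:
  fixes f :: "'a::metric_space \<times> real \<Rightarrow> (nat \<Rightarrow> real) set"
  assumes L: "compact L" "totally_disconnected L" and A: "closed A" "A \<subseteq> L \<times> {0..1}"
    and f: "continuous_map (top_of_set A) K f"
  shows "lifts f A"
proof -
  have cA: "compact A"
    by (rule compact_closed_subset[OF _ A]) (intro compact_Times L(1) compact_Icc)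
  obtain d where d: "d > 0" "\<And>T. T \<subseteq> A \<Longrightarrow> (\<And>x y. x \<in> T \<Longrightarrow> y \<in> T \<Longrightarrow> dist x y < d) \<Longrightarrow> lifts f T"
    using small_pieces_lift[OF cA f] by blast
  obtain n :: nat where n: "n > 0" "1 / real n < d / 2"
    using d(1) by (metis half_gt_zero nat_approx_posE zero_less_Suc)
  have strip: "lifts f (A \<inter> W \<times> {0..1})" if W: "W \<subseteq> L" "closed W" "\<And>x y. x \<in> W \<Longrightarrow> y \<in> W \<Longrightarrow> dist x y < d / 2" for W
  proof -
    have "lifts f (A \<inter> W \<times> {0..real n * (1 / real n)})"
    proof (rule lifts_strip[OF L A W(1,2)])
      fix s t :: real assume st: "s \<le> t" "t \<le> s + 1 / real n"
      show "lifts f (A \<inter> W \<times> {s..t})"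
      proof (rule d(2))
        fix x y assume "x \<in> A \<inter> W \<times> {s..t}" "y \<in> A \<inter> W \<times> {s..t}"
        then have xy: "fst x \<in> W" "fst y \<in> W" "snd x \<in> {s..t}" "snd y \<in> {s..t}" by auto
        have "dist (snd x) (snd y) \<le> t - s"
          using xy(3,4) unfolding dist_real_def abs_le_iff by auto
        then have "dist (fst x) (fst y) < d / 2" "dist (snd x) (snd y) < d / 2"
          using W(3)[OF xy(1,2)] st n(2) by linarith+
        moreover have "dist x y \<le> dist (fst x) (fst y) + dist (snd x) (snd y)"
          unfolding dist_prod_def by (rule sqrt_sum_squares_le_sum) auto
        ultimately show "dist x y < d" by linarith
      qed auto
    qed simp
    then show ?thesis using n(1) by simp
  qed
  have "\<exists>U. openin (top_of_set L) U \<and> closedin (top_of_set L) U \<and> l \<in> U \<and> U \<subseteq> ball l (d/4)" if l: "l \<in> L" for l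
  proof -
    have "closed (L - ball l (d/4))" using compact_imp_closed[OF L(1)] by (intro closed_Diff) auto
    then obtain U where "openin (top_of_set L) U" "closedin (top_of_set L) U" "l \<in> U" "U \<inter> (L - ball l (d/4)) = {}"
      using separate_point_closed[OF L l, of "L - ball l (d/4)"] d(1) by auto
    moreover have "U \<subseteq> L" using calculation(1) by (rule openin_imp_subset)
    ultimately show ?thesis by blast
  qed
  then obtain U where U: "\<And>l. l \<in> L \<Longrightarrow> openin (top_of_set L) (U l)" "\<And>l. l \<in> L \<Longrightarrow> closedin (top_of_set L) (U l)"
    "\<And>l. l \<in> L \<Longrightarrow> l \<in> U l" "\<And>l. l \<in> L \<Longrightarrow> U l \<subseteq> ball l (d/4)" by metis
  have "\<exists>T. open T \<and> U l = L \<inter> T" if "l \<in> L" for l using U(1)[OF that] by (simp add: openin_open)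
  then obtain T where T: "\<And>l. l \<in> L \<Longrightarrow> open (T l)" "\<And>l. l \<in> L \<Longrightarrow> U l = L \<inter> T l" by metis
  have "L \<subseteq> (\<Union>l\<in>L. T l)" using U(3) T(2) by blast
  then obtain F where F: "F \<subseteq> L" "finite F" "L \<subseteq> (\<Union>l\<in>F. T l)"
    using compactE_image[OF L(1), of L T] T(1) by metis
  have clo: "closed S" if "closedin (top_of_set L) S" for S
    using closedin_closed_trans[OF that compact_imp_closed[OF L(1)]] .
  have "lifts f (A \<inter> \<Union>(U ` F) \<times> {0..1})"
    using F(2,1)
  proof (induction F rule: finite_induct)
    case empty
    show ?case using strip[of "{}"] by simp
  next
    case (insert l F)
    let ?B = "A \<inter> \<Union>(U ` F) \<times> {0..1}" and ?W = "U l - \<Union>(U ` F)"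
    have cF: "closedin (top_of_set L) (\<Union>(U ` F))" and oF: "openin (top_of_set L) (\<Union>(U ` F))"
      using insert U by (auto intro!: closedin_Union openin_Union)
    have cW: "closedin (top_of_set L) ?W" using insert U(2) oF by (intro closedin_diff) auto
    have "lifts f (?B \<union> A \<inter> ?W \<times> {0..1})"
    proof (rule lifts_disjoint_Un)
      show "closed ?B" "closed (A \<inter> ?W \<times> {0..1})"
        by (intro closed_Int A(1) closed_Times closed_atLeastAtMost clo cF cW)+
      show "lifts f ?B" using insert by simp
      show "lifts f (A \<inter> ?W \<times> {0..1})"
      proof (rule strip)
        show "?W \<subseteq> L" using cW by (rule closedin_imp_subset)
        show "closed ?W" by (rule clo[OF cW])
        fix x y assume "x \<in> ?W" "y \<in> ?W"
        then have "x \<in> ball l (d/4)" "y \<in> ball l (d/4)" using U(4)[of l] insert by auto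
        then have "dist l x < d/4" "dist l y < d/4" by auto
        then show "dist x y < d/2" using dist_triangle2[of x y l] by (simp add: dist_commute)
      qed
    qed auto
    moreover have "?B \<union> A \<inter> ?W \<times> {0..1} = A \<inter> \<Union>(U ` insert l F) \<times> {0..1}" by auto
    ultimately show ?case by simp
  qed
  moreover have "A \<subseteq> A \<inter> \<Union>(U ` F) \<times> {0..1}"
  proof
    fix y assume y: "y \<in> A"
    then have "fst y \<in> L" "snd y \<in> {0..1}" using A(2) by auto
    then obtain l where "l \<in> F" "fst y \<in> T l" using F(3) by blast
    then have "fst y \<in> U l" using T(2) F(1) \<open>fst y \<in> L\<close> by blast
    then show "y \<in> A \<inter> \<Union>(U ` F) \<times> {0..1}" using y \<open>l \<in> F\<close> \<open>snd y \<in> {0..1}\<close>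
      by (auto simp: mem_Times_iff)
  qed
  ultimately show ?thesis by (rule lifts_subset)
qed

end

section \<open>Products with the circle\<close>

definition cpl :: "(nat \<Rightarrow> real) \<Rightarrow> complex" where
  "cpl x = Complex (x 0) (x 1)"

definition tail2 :: "(nat \<Rightarrow> real) \<Rightarrow> nat \<Rightarrow> real" where
  "tail2 x n = x (n + 2)"

text \<open>The circle takes the first two coordinates and the compactum is shifted by two places.\<close>

definition join2 :: "complex \<Rightarrow> (nat \<Rightarrow> real) \<Rightarrow> nat \<Rightarrow> real" where
  "join2 z l n = (if n = 0 then Re z else if n = 1 then Im z else l (n - 2))"

lemma cpl_join2 [simp]: "cpl (join2 z l) = z"
  by (simp add: cpl_def join2_def)

lemma tail2_join2 [simp]: "tail2 (join2 z l) = l"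
  by (simp add: tail2_def[abs_def] join2_def)

lemma join2_split [simp]: "join2 (cpl x) (tail2 x) = x"
proof
  fix n :: nat
  show "join2 (cpl x) (tail2 x) n = x n"
  proof (cases "n < 2")
    case True
    then have "n = 0 \<or> n = 1" by linarith
    then show ?thesis by (auto simp: join2_def cpl_def)
  next
    case False
    then have n: "n - 2 + 2 = n" by simp
    have "join2 (cpl x) (tail2 x) n = x (n - 2 + 2)"
      using False by (simp only: join2_def tail2_def) auto
    then show ?thesis unfolding n .
  qed
qed

lemma split_eqI: "cpl x = cpl y \<Longrightarrow> tail2 x = tail2 y \<Longrightarrow> x = y"
  by (metis join2_split)

lemma continuous_on_cpl [continuous_intros]:
  "continuous_on S f \<Longrightarrow> continuous_on S (\<lambda>x. cpl (f x))"
  unfolding cpl_def complex_eq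
  by (intro continuous_intros; rule continuous_on_product_then_coordinatewise)

lemma continuous_on_tail2 [continuous_intros]:
  "continuous_on S f \<Longrightarrow> continuous_on S (\<lambda>x. tail2 (f x))"
  unfolding tail2_def
  by (rule continuous_on_coordinatewise_then_product; rule continuous_on_product_then_coordinatewise)

lemma continuous_on_join2 [continuous_intros]:
  assumes "continuous_on S f" "continuous_on S g" shows "continuous_on S (\<lambda>x. join2 (f x) (g x))"
proof (rule continuous_on_coordinatewise_then_product)
  fix n :: nat
  consider "n = 0" | "n = 1" | "n \<ge> 2" by linarith
  then show "continuous_on S (\<lambda>x. join2 (f x) (g x) n)"
    by cases (auto simp: join2_def intro!: continuous_intros assms continuous_on_product_then_coordinatewise[OF assms(2)])
qed

definition circle_prod :: "(nat \<Rightarrow> real) set \<Rightarrow> (nat \<Rightarrow> real) set" where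
  "circle_prod L = (\<lambda>(z, l). join2 z l) ` (sphere 0 1 \<times> L)"

lemma circle_prod_iff: "x \<in> circle_prod L \<longleftrightarrow> cmod (cpl x) = 1 \<and> tail2 x \<in> L"
proof
  assume "cmod (cpl x) = 1 \<and> tail2 x \<in> L"
  then have "(cpl x, tail2 x) \<in> sphere 0 1 \<times> L" by simp
  then show "x \<in> circle_prod L" unfolding circle_prod_def by (rule rev_image_eqI) simp
qed (auto simp: circle_prod_def)

lemma compact_circle_prod: "compact L \<Longrightarrow> compact (circle_prod L)"
  unfolding circle_prod_def case_prod_beta
  by (intro compact_continuous_image compact_Times compact_sphere continuous_intros)

definition circle_carrier :: "(nat \<Rightarrow> real) set" where
  "circle_carrier = circle_prod {\<lambda>_. 0}"

definition circle_group :: "(nat \<Rightarrow> real) monoid" where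
  "circle_group = \<lparr>carrier = circle_carrier,
     monoid.mult = (\<lambda>g h. join2 (cpl g * cpl h) (\<lambda>_. 0)), one = join2 1 (\<lambda>_. 0)\<rparr>"

lemma circle_carrier_iff: "g \<in> circle_carrier \<longleftrightarrow> cmod (cpl g) = 1 \<and> tail2 g = (\<lambda>_. 0)"
  by (simp add: circle_carrier_def circle_prod_iff)

lemma group_circle: "group circle_group"
proof (rule groupI)
  fix g assume "g \<in> carrier circle_group"
  then have g: "cmod (cpl g) = 1" "tail2 g = (\<lambda>_. 0)" by (auto simp: circle_group_def circle_carrier_iff)
  show "\<one>\<^bsub>circle_group\<^esub> \<otimes>\<^bsub>circle_group\<^esub> g = g"
    using g by - (rule split_eqI; auto simp: circle_group_def)
  have "cpl g \<noteq> 0" using g by auto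
  then show "\<exists>h\<in>carrier circle_group. h \<otimes>\<^bsub>circle_group\<^esub> g = \<one>\<^bsub>circle_group\<^esub>"
    using g by (intro bexI[of _ "join2 (inverse (cpl g)) (\<lambda>_. 0)"])
      (simp_all add: circle_group_def circle_carrier_iff norm_inverse)
qed (simp_all add: circle_group_def circle_carrier_iff norm_mult mult.assoc)

lemma inv_circle: assumes "g \<in> circle_carrier" shows "inv\<^bsub>circle_group\<^esub> g = join2 (inverse (cpl g)) (\<lambda>_. 0)"
proof -
  have "cpl g \<noteq> 0" using assms by (auto simp: circle_carrier_iff)
  then show ?thesis using assms
    by (intro group.inv_equality[OF group_circle]) (simp_all add: circle_group_def circle_carrier_iff norm_inverse)
qed

lemma compact_group_circle: "compact_group circle_group (top_of_set circle_carrier)"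
  unfolding compact_group_def
proof (intro conjI)
  show "group circle_group" by (rule group_circle)
  show "topspace (top_of_set circle_carrier) = carrier circle_group" by (simp add: circle_group_def)
  show "compact_space (top_of_set circle_carrier)"
    unfolding circle_carrier_def by (intro compact_space_subtopology) (simp add: compact_circle_prod)
  show "Hausdorff_space (top_of_set circle_carrier)"
    by (simp add: Hausdorff_space_subtopology)
  have "continuous_on (circle_carrier \<times> circle_carrier) (\<lambda>y. join2 (cpl (fst y) * cpl (snd y)) (\<lambda>_. 0))"
    by (intro continuous_intros)
  then show "continuous_map (prod_topology (top_of_set circle_carrier) (top_of_set circle_carrier))
      (top_of_set circle_carrier) (\<lambda>(x, y). x \<otimes>\<^bsub>circle_group\<^esub> y)"
    by (auto simp: circle_group_def circle_carrier_iff norm_mult case_prod_beta simp flip: subtopology_Times)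
  have "continuous_on circle_carrier (\<lambda>g. join2 (inverse (cpl g)) (\<lambda>_. 0))"
    by (intro continuous_intros) (auto simp: circle_carrier_iff)
  then have "continuous_on circle_carrier (\<lambda>g. inv\<^bsub>circle_group\<^esub> g)"
    by (rule continuous_on_eq) (simp add: inv_circle)
  moreover have "inv\<^bsub>circle_group\<^esub> g \<in> circle_carrier" if "g \<in> circle_carrier" for g
    unfolding inv_circle[OF that] using that by (simp add: circle_carrier_iff norm_inverse)
  ultimately show "continuous_map (top_of_set circle_carrier) (top_of_set circle_carrier) (\<lambda>g. inv\<^bsub>circle_group\<^esub> g)"
    by auto
qed

definition rotate2 :: "(nat \<Rightarrow> real) set \<Rightarrow> (nat \<Rightarrow> real) \<Rightarrow> (nat \<Rightarrow> real) \<Rightarrow> nat \<Rightarrow> real" where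
  "rotate2 L g = restrict (\<lambda>x. join2 (cpl g * cpl x) (tail2 x)) (circle_prod L)"

lemma continuous_action_rotate2:
  "continuous_action circle_group (top_of_set circle_carrier) (top_of_set (circle_prod L)) (rotate2 L)"
  unfolding continuous_action_def
proof
  have in_prod: "rotate2 L g x \<in> circle_prod L" if "g \<in> circle_carrier" "x \<in> circle_prod L" for g x
    using that by (simp add: rotate2_def circle_prod_iff circle_carrier_iff norm_mult)
  show "group_action circle_group (topspace (top_of_set (circle_prod L))) (rotate2 L)"
  proof (rule group_actionI[OF group_circle])
    show "rotate2 L \<one>\<^bsub>circle_group\<^esub> x = x" if "x \<in> topspace (top_of_set (circle_prod L))" for x
      using that by (simp add: rotate2_def circle_group_def)
    show "rotate2 L (g \<otimes>\<^bsub>circle_group\<^esub> h) x = rotate2 L g (rotate2 L h x)"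
      if "h \<in> carrier circle_group" "x \<in> topspace (top_of_set (circle_prod L))" for g h x
    proof -
      have x: "x \<in> circle_prod L" "h \<in> circle_carrier" using that by (auto simp: circle_group_def)
      show ?thesis using x in_prod[OF x(2,1)]
        by - (rule split_eqI; auto simp: rotate2_def circle_group_def mult.assoc)
    qed
  qed (use in_prod in \<open>auto simp: circle_group_def rotate2_def\<close>)
  have "continuous_on (circle_carrier \<times> circle_prod L) (\<lambda>y. join2 (cpl (fst y) * cpl (snd y)) (tail2 (snd y)))"
    by (intro continuous_intros)
  then have "continuous_on (circle_carrier \<times> circle_prod L) (\<lambda>y. rotate2 L (fst y) (snd y))"
    by (rule continuous_on_eq) (auto simp: rotate2_def)
  then show "continuous_map (prod_topology (top_of_set circle_carrier) (top_of_set (circle_prod L)))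
      (top_of_set (circle_prod L)) (\<lambda>(g, x). rotate2 L g x)"
    using in_prod by (auto simp: case_prod_beta simp flip: subtopology_Times)
qed

lemma orbit_rotate2:
  assumes "x \<in> circle_prod L"
  shows "orbit circle_group (rotate2 L) x = {y \<in> circle_prod L. tail2 y = tail2 x}"
proof
  show "orbit circle_group (rotate2 L) x \<subseteq> {y \<in> circle_prod L. tail2 y = tail2 x}"
    using assms by (auto simp: orbit_def rotate2_def circle_group_def circle_carrier_iff circle_prod_iff norm_mult)
  show "{y \<in> circle_prod L. tail2 y = tail2 x} \<subseteq> orbit circle_group (rotate2 L) x"
  proof
    fix y assume "y \<in> {y \<in> circle_prod L. tail2 y = tail2 x}"
    then have y: "cmod (cpl y) = 1" "tail2 y = tail2 x" by (auto simp: circle_prod_iff)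
    have x: "cmod (cpl x) = 1" using assms by (simp add: circle_prod_iff)
    define g where "g = join2 (cpl y / cpl x) (\<lambda>_. 0)"
    have "g \<in> carrier circle_group" using x y by (simp add: g_def circle_group_def circle_carrier_iff norm_divide)
    moreover have "y = rotate2 L g x"
      using assms x y by - (rule split_eqI; auto simp: rotate2_def g_def)
    ultimately show "y \<in> orbit circle_group (rotate2 L) x" by (auto simp: orbit_def)
  qed
qed

lemma orbit_space_circle_prod:
  assumes "compact L"
  shows "orbit_space circle_group (top_of_set (circle_prod L)) (rotate2 L) homeomorphic_space top_of_set L"
proof (rule orbit_space_homeomorphic[where \<pi> = tail2])
  show "compact (circle_prod L)" using assms by (rule compact_circle_prod)
  show "continuous_on (circle_prod L) tail2" by (intro continuous_intros)
  show "tail2 ` circle_prod L = L"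
  proof
    show "L \<subseteq> tail2 ` circle_prod L"
    proof
      fix l assume "l \<in> L"
      then have "join2 1 l \<in> circle_prod L" by (simp add: circle_prod_iff)
      then show "l \<in> tail2 ` circle_prod L" by (rule rev_image_eqI) simp
    qed
  qed (auto simp: circle_prod_iff)
  fix x y assume xy: "x \<in> circle_prod L" "y \<in> circle_prod L"
  show "orbit circle_group (rotate2 L) x = orbit circle_group (rotate2 L) y \<longleftrightarrow> tail2 x = tail2 y"
    unfolding orbit_rotate2[OF xy(1)] orbit_rotate2[OF xy(2)] using xy by auto
qed

text \<open>The quotient map that glues the ends of the interval to a circle.\<close>

definition wind :: "(nat \<Rightarrow> real) \<times> real \<Rightarrow> nat \<Rightarrow> real" where
  "wind y = join2 (cis (2 * pi * snd y)) (fst y)"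

lemma continuous_on_wind: "continuous_on S wind"
  unfolding wind_def by (intro continuous_intros)

lemma wind_image: "wind ` (L \<times> {0..1}) = circle_prod L"
proof
  show "wind ` (L \<times> {0..1}) \<subseteq> circle_prod L" by (auto simp: wind_def circle_prod_iff)
  show "circle_prod L \<subseteq> wind ` (L \<times> {0..1})"
  proof
    fix x assume x: "x \<in> circle_prod L"
    define t where "t = Arg2pi (cpl x) / (2 * pi)"
    have "t \<in> {0..1}" using Arg2pi_ge_0[of "cpl x"] Arg2pi_lt_2pi[of "cpl x"] by (auto simp: t_def field_simps)
    moreover have "cis (2 * pi * t) = cpl x"
      using polar_Arg2pi[of "cpl x"] x by (simp add: t_def circle_prod_iff)
    then have "x = wind (tail2 x, t)" by (simp add: wind_def)
    ultimately show "x \<in> wind ` (L \<times> {0..1})" using x by (auto simp: circle_prod_iff)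
  qed
qed

lemma wind_eq:
  assumes "wind (l, s) = wind (l', t)" "s \<in> {0..1}" "t \<in> {0..1}"
  shows "l = l'" "s = t \<or> s \<in> {0, 1} \<and> t \<in> {0, 1}"
proof -
  have eq: "cis (2 * pi * s) = cis (2 * pi * t)" "l = l'"
    using arg_cong[OF assms(1), of cpl] arg_cong[OF assms(1), of tail2] by (simp_all add: wind_def)
  then show "l = l'" by simp
  have "cis (2 * pi * (s - t)) = 1" using eq(1) by (simp add: right_diff_distrib flip: cis_divide)
  then have "cos (2 * pi * (s - t)) = 1" by (metis cis.simps(1) one_complex.simps(1))
  then obtain k :: int where "2 * pi * (s - t) = of_int k * 2 * pi" by (auto simp: cos_one_2pi_int)
  then have k: "s - t = of_int k" by simp
  then have "\<bar>real_of_int k\<bar> \<le> 1" using assms(2,3) by auto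
  then have "k \<in> {-1, 0, 1}" by auto
  then show "s = t \<or> s \<in> {0, 1} \<and> t \<in> {0, 1}" using k assms(2,3) by auto
qed

context root_of_unity_group
begin

text \<open>Lifts over the circle do not exist in general, but maps extend: first extend over one fibre of
  the projection to the circle, then cut along this fibre.  On L times an interval the map is now
  prescribed at both ends by the same function, and an extension obtained from a lift descends.\<close>

lemma circle_prod_extends:
  assumes L: "compact L" "totally_disconnected L"
  shows "extends_all_maps (top_of_set (circle_prod L)) K"
  unfolding extends_all_maps_def
proof (intro allI impI, elim conjE)
  let ?X = "circle_prod L" and ?Y = "L \<times> {0..1::real}"
  fix A f assume A: "closedin (top_of_set ?X) A" and "continuous_map (subtopology (top_of_set ?X) A) K f"
  moreover have AX: "A \<subseteq> ?X" using A by (simp add: closedin_imp_subset)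
  ultimately have f: "continuous_map (top_of_set A) K f" by (simp add: subtopology_subtopology Int_absorb1)
  have clA: "closed A" using closedin_closed_trans[OF A compact_imp_closed[OF compact_circle_prod[OF L(1)]]] .
  have cY: "compact ?Y" by (intro compact_Times L(1) compact_Icc)
  have clY: "closed ?Y" by (rule compact_imp_closed[OF cY])
  have pre: "closed (S \<inter> wind -` A)" if "closed S" for S
    by (rule continuous_closed_preimage[OF continuous_on_wind that clA])
  have fw: "continuous_map (top_of_set S) K (\<lambda>y. f (wind y))" if "S \<subseteq> wind -` A" for S
  proof -
    have "continuous_map (top_of_set S) (top_of_set A) wind" using that continuous_on_wind by auto
    from continuous_map_compose[OF this f] show ?thesis by (simp add: o_def)
  qed
  define Z where "Z = L \<times> {0::real}"
  define E where "E = L \<times> {0, 1::real}"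
  have cl: "closed Z" "closed E"
    unfolding Z_def E_def by (intro closed_Times compact_imp_closed[OF L(1)]; simp)+
  \<comment> \<open>extend over the fibre over the base point of the circle\<close>
  have "lifts (\<lambda>y. f (wind y)) (Z \<inter> wind -` A)"
    by (rule lifts_zero_dim_times_interval[OF L pre[OF cl(1)] _ fw]) (auto simp: Z_def)
  moreover have "closedin (top_of_set Z) (Z \<inter> wind -` A)" by (intro closed_subset pre cl) auto
  ultimately obtain g0 where g0: "continuous_map (top_of_set Z) K g0" "\<And>y. y \<in> Z \<inter> wind -` A \<Longrightarrow> g0 y = f (wind y)"
    by (rule lifts_imp_extension) blast
  define B where "B = ?Y \<inter> wind -` A"
  have clB: "closed B" unfolding B_def by (rule pre[OF clY])
  define F where "F y = (if snd y \<in> {0, 1} then g0 (fst y, 0) else f (wind y))" for y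
  have FB: "F y = f (wind y)" if "y \<in> B" for y
  proof (cases "snd y \<in> {0, 1}")
    case True
    then have "wind (fst y, 0) = wind y" by (auto simp: wind_def)
    then have "(fst y, 0) \<in> Z \<inter> wind -` A" "f (wind (fst y, 0)) = f (wind y)"
      using that by (auto simp: B_def Z_def)
    then show ?thesis using g0(2) True by (simp add: F_def)
  qed (simp add: F_def)
  have FE: "F y = g0 (fst y, 0)" if "y \<in> E" for y using that by (auto simp: E_def F_def)
  have EY: "E \<subseteq> ?Y" by (auto simp: E_def)
  have F: "continuous_map (top_of_set (B \<union> E)) K F"
  proof (rule pasting_lemma_closed[where I = "{True, False}" and T = "\<lambda>b. if b then B else E" and
        f = "\<lambda>b y. if b then f (wind y) else g0 (fst y, 0)"])
    show "closedin (top_of_set (B \<union> E)) (if b then B else E)" if "b \<in> {True, False}" for b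
      using clB cl(2) by (cases b) (auto intro: closed_subset)
    have "continuous_map (top_of_set E) (top_of_set Z) (\<lambda>y. (fst y, 0))"
      unfolding continuous_map_subtopology_eu
      by (intro conjI continuous_on_Pair continuous_on_fst continuous_on_id continuous_on_const)
        (auto simp: E_def Z_def)
    from continuous_map_compose[OF this g0(1)] have "continuous_map (top_of_set E) K (\<lambda>y. g0 (fst y, 0))"
      by (simp add: o_def)
    moreover have "continuous_map (top_of_set B) K (\<lambda>y. f (wind y))" by (rule fw) (auto simp: B_def)
    ultimately show "continuous_map (subtopology (top_of_set (B \<union> E)) (if b then B else E)) K
        (\<lambda>y. if b then f (wind y) else g0 (fst y, 0))" if "b \<in> {True, False}" for b
      by (cases b) (simp_all add: subtopology_subtopology Int_absorb1)
    show "(if b then f (wind y) else g0 (fst y, 0)) = (if c then f (wind y) else g0 (fst y, 0))"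
      if "y \<in> topspace (top_of_set (B \<union> E)) \<inter> (if b then B else E) \<inter> (if c then B else E)" for b c y
      using that FB[of y] FE[of y] by (cases b; cases c) simp_all
    show "\<exists>b. b \<in> {True, False} \<and> y \<in> (if b then B else E) \<and> F y = (if b then f (wind y) else g0 (fst y, 0))"
      if "y \<in> topspace (top_of_set (B \<union> E))" for y
    proof (cases "y \<in> B")
      case True then show ?thesis using FB by (intro exI[of _ True]) simp
    next
      case False then show ?thesis using that FE by (intro exI[of _ False]) simp
    qed
  qed simp
  have BE: "B \<union> E \<subseteq> ?Y" using EY by (auto simp: B_def)
  have clBE: "closed (B \<union> E)" using clB cl(2) by (rule closed_Un)
  have "lifts F (B \<union> E)" by (rule lifts_zero_dim_times_interval[OF L clBE BE F])
  moreover have "closedin (top_of_set ?Y) (B \<union> E)" by (rule closed_subset[OF BE clBE])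
  ultimately obtain G where G: "continuous_map (top_of_set ?Y) K G" "\<And>y. y \<in> B \<union> E \<Longrightarrow> G y = F y"
    by (rule lifts_imp_extension) blast
  have q: "quotient_map (top_of_set ?Y) (top_of_set ?X) wind"
    by (rule quotient_map_from_compact[OF cY continuous_on_wind wind_image])
  have Geq: "G x = G y" if "x \<in> topspace (top_of_set ?Y)" "y \<in> topspace (top_of_set ?Y)" "wind x = wind y" for x y
  proof -
    obtain l s m t where xy: "x = (l, s)" "y = (m, t)" by (cases x; cases y)
    have st: "s \<in> {0..1}" "t \<in> {0..1}" "l \<in> L" using that xy by auto
    have "l = m" "s = t \<or> s \<in> {0, 1} \<and> t \<in> {0, 1}" using wind_eq[of l s m t] that(3) st xy by auto
    then show ?thesis
    proof (elim disjE)
      assume "s \<in> {0, 1} \<and> t \<in> {0, 1}"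
      then have "x \<in> E" "y \<in> E" using xy st \<open>l = m\<close> by (auto simp: E_def)
      then show ?thesis using G(2) FE xy \<open>l = m\<close> by simp
    qed (use xy in simp)
  qed
  obtain g where g: "continuous_map (top_of_set ?X) K g" "\<And>y. y \<in> topspace (top_of_set ?Y) \<Longrightarrow> g (wind y) = G y"
    by (rule quotient_map_lift_exists[OF q G(1) Geq]) blast+
  have "g x = f x" if x: "x \<in> A" for x
  proof -
    obtain y where y: "y \<in> ?Y" "x = wind y" using AX x wind_image by blast
    then have "y \<in> B" using x by (simp add: B_def)
    then show ?thesis using g(2)[of y] G(2)[of y] FB[of y] y by simp
  qed
  then show "\<exists>g. continuous_map (top_of_set ?X) K g \<and> (\<forall>x\<in>A. g x = f x)" using g(1) by blast
qed

end

section \<open>The theorem\<close>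

text \<open>Use the distances from the points of a countable dense set as coordinates.\<close>

lemma compact_metrizable_embedding:
  fixes L :: "'a topology"
  assumes "compact_space L" "metrizable_space L"
  obtains L' :: "(nat \<Rightarrow> real) set" where "compact L'" "L homeomorphic_space top_of_set L'"
proof (cases "topspace L = {}")
  case True
  then have "L homeomorphic_space top_of_set ({} :: (nat \<Rightarrow> real) set)"
    by (simp add: homeomorphic_empty_space_eq)
  then show ?thesis using that[of "{}"] by simp
next
  case False
  obtain M d where Md: "Metric_space M d" "L = Metric_space.mtopology M d"
    using assms(2) unfolding metrizable_space_def by blast
  interpret Metric_space M d by (rule Md(1))
  have LM: "topspace L = M" using Md(2) by simp
  have "mtotally_bounded M"
    using assms(1) Md(2) compactin_imp_mtotally_bounded[of M] by (simp add: compact_space_def)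
  then have "\<exists>K. finite K \<and> K \<subseteq> M \<and> M \<subseteq> (\<Union>x\<in>K. mball x (1 / real (Suc n)))" for n
    unfolding mtotally_bounded_def by simp
  then obtain Kn where Kn: "\<And>n. finite (Kn n)" "\<And>n. Kn n \<subseteq> M" "\<And>n. M \<subseteq> (\<Union>x\<in>Kn n. mball x (1 / real (Suc n)))"
    by metis
  define D where "D = (\<Union>n. Kn n)"
  have D: "countable D" "D \<subseteq> M" using Kn(1,2) by (auto simp: D_def intro: countable_finite)
  have "D \<noteq> {}" using Kn(3)[of 0] False LM by (auto simp: D_def)
  define f where "f x i = d (from_nat_into D i) x" for x i
  have a: "from_nat_into D i \<in> M" for i using from_nat_into[OF \<open>D \<noteq> {}\<close>] D(2) by blast
  have "continuous_map L euclideanreal (\<lambda>x. d a x)" if "a \<in> M" for a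
    unfolding continuous_map_def
  proof (intro conjI allI impI)
    fix U :: "real set" assume "openin euclideanreal U"
    then have U: "open U" by simp
    show "openin L {x \<in> topspace L. d a x \<in> U}"
      unfolding Md(2) openin_mtopology
    proof (intro conjI allI impI)
      fix x assume x: "x \<in> {x \<in> topspace mtopology. d a x \<in> U}"
      then obtain e where e: "e > 0" "ball (d a x) e \<subseteq> U" using U by (auto simp: open_contains_ball)
      have "mball x e \<subseteq> {x \<in> topspace mtopology. d a x \<in> U}"
      proof
        fix y assume "y \<in> mball x e"
        then have y: "x \<in> M" "y \<in> M" "d x y < e" by auto
        have "\<bar>d a x - d a y\<bar> < e"
          using triangle[of a x y] triangle[of a y x] y that commute[of y x] by (simp add: abs_less_iff)
        then have "d a y \<in> ball (d a x) e" by (simp add: dist_real_def)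
        then show "y \<in> {x \<in> topspace mtopology. d a x \<in> U}" using e(2) y by auto
      qed
      then show "\<exists>r>0. mball x r \<subseteq> {x \<in> topspace mtopology. d a x \<in> U}" using e(1) by blast
    qed auto
  qed auto
  then have "continuous_map L (product_topology (\<lambda>i. euclideanreal) UNIV) f"
    using a by (simp add: continuous_map_componentwise_UNIV f_def)
  then have "continuous_map L euclidean f" by (simp only: euclidean_product_topology)
  then have fc: "continuous_map L (top_of_set (f ` topspace L)) f"
    by (simp add: continuous_map_in_subtopology)
  have inj: "inj_on f (topspace L)"
  proof (rule inj_onI, rule ccontr)
    fix x y assume xy: "x \<in> topspace L" "y \<in> topspace L" "f x = f y" "x \<noteq> y"
    then have M: "x \<in> M" "y \<in> M" using LM by auto
    then have "d x y / 2 > 0" using xy(4) by simp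
    then obtain n where n: "1 / real (Suc n) < d x y / 2" using nat_approx_posE by metis
    obtain a where a: "a \<in> Kn n" "x \<in> mball a (1 / real (Suc n))" using Kn(3)[of n] M(1) by blast
    have "a \<in> D" using a(1) by (auto simp: D_def)
    then obtain i where "from_nat_into D i = a" using from_nat_into_surj[OF D(1)] by metis
    then have "d a x = d a y" using fun_cong[OF xy(3), of i] by (simp add: f_def)
    moreover have "a \<in> M" "d a x < 1 / real (Suc n)" using a(2) by auto
    ultimately have "d x y < d x y" using triangle[of x a y] M n commute[of x a] by simp
    then show False by simp
  qed
  have "homeomorphic_map L (top_of_set (f ` topspace L)) f"
    by (rule continuous_imp_homeomorphic_map[OF fc assms(1) _ _ inj])
      (auto intro: Hausdorff_space_subtopology simp: Hausdorff_space_euclidean)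
  then have "L homeomorphic_space top_of_set (f ` topspace L)" by (rule homeomorphic_map_imp_homeomorphic_space)
  moreover have "compact (f ` topspace L)"
    using image_compactin[OF assms(1)[unfolded compact_space_def] \<open>continuous_map L euclidean f\<close>] by simp
  ultimately show ?thesis using that by blast
qed

context root_of_unity_group
begin

lemma cohomological_dim_1:
  fixes X :: "'a::metric_space set"
  assumes ext: "extends_all_maps (top_of_set X) K"
    and C: "connected C" "C \<subseteq> X" "a \<in> C" "b \<in> C" "a \<noteq> b"
  shows "cohomological_dim (integer_mod_group p) (top_of_set X) = 1"
proof -
  let ?S = "{enat n | n. \<exists>K :: (nat \<Rightarrow> real) set topology.
                       eilenberg_maclane_space (integer_mod_group p) n K \<and> extends_all_maps (top_of_set X) K}"
  have "enat 1 \<in> ?S" using ext eilenberg_maclane_K by blast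
  then have "Inf ?S \<le> enat 1" by (rule Inf_lower)
  moreover have "enat 1 \<le> Inf ?S"
  proof (rule Inf_greatest)
    fix x assume "x \<in> ?S"
    then obtain n and K' :: "(nat \<Rightarrow> real) set topology" where n: "x = enat n"
      "eilenberg_maclane_space (integer_mod_group p) n K'" "extends_all_maps (top_of_set X) K'" by blast
    have "n \<noteq> 0" using connected_not_dim_0[OF C _ p2] n(2,3) by metis
    then show "enat 1 \<le> x" using n(1) by simp
  qed
  ultimately show ?thesis unfolding cohomological_dim_def by (simp add: one_enat_def)
qed

text \<open>The preimage of the image of U is the union of the translates of U under the group.\<close>

lemma openin_base_image:
  assumes L: "compact L" and U: "openin (top_of_set (root_space L)) U"
  shows "openin (top_of_set L) (base ` U)"
proof -
  have UX: "U \<subseteq> root_space L" using U by (rule openin_imp_subset)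
  have bi: "base ` root_space L = L" using base_in base_surj by blast
  have q: "quotient_map (top_of_set (root_space L)) (top_of_set L) base"
    by (rule quotient_map_from_compact[OF compact_root_space[OF L] continuous_on_base bi])
  have "{x \<in> root_space L. base x \<in> base ` U} = (\<Union>g\<in>twist_carrier. {x \<in> root_space L. twist_action L g x \<in> U})"
  proof (intro subset_antisym subsetI)
    fix x assume "x \<in> {x \<in> root_space L. base x \<in> base ` U}"
    then obtain u where x: "x \<in> root_space L" and u: "u \<in> U" "base x = base u" by blast
    have uX: "u \<in> root_space L" using u UX by blast
    have "orbit twist_group (twist_action L) x = orbit twist_group (twist_action L) u" using orbit_twist_action_iff[OF x uX] u(2) by simp
    moreover have "\<one>\<^bsub>twist_group\<^esub> \<in> carrier twist_group" using group_twist_group by (simp add: group.is_monoid monoid.one_closed)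
    then have "u \<in> orbit twist_group (twist_action L) u" unfolding orbit_def using twist_action_one[OF uX] by force
    ultimately obtain g where "g \<in> twist_carrier" "u = twist_action L g x" by (auto simp: orbit_def twist_group_def)
    then show "x \<in> (\<Union>g\<in>twist_carrier. {x \<in> root_space L. twist_action L g x \<in> U})" using x u(1) by blast
  next
    fix x assume "x \<in> (\<Union>g\<in>twist_carrier. {x \<in> root_space L. twist_action L g x \<in> U})"
    then obtain g where x: "x \<in> root_space L" and g: "twist_action L g x \<in> U" by blast
    have "base (twist_action L g x) = base x" using x by (simp add: base_def[abs_def] val_twist_action)
    then have "base x \<in> base ` U" using g by (metis imageI)
    then show "x \<in> {x \<in> root_space L. base x \<in> base ` U}" using x by simp
  qed
  moreover have "openin (top_of_set (root_space L)) {x \<in> root_space L. twist_action L g x \<in> U}" if g: "g \<in> twist_carrier" for g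
  proof -
    have "continuous_map (top_of_set (root_space L)) (prod_topology (top_of_set twist_carrier) (top_of_set (root_space L))) (\<lambda>x. (g, x))"
      using g continuous_on_Pair[OF continuous_on_const[of "root_space L" g] continuous_on_id]
      by (simp add: continuous_map_pairwise o_def)
    moreover have "continuous_map (prod_topology (top_of_set twist_carrier) (top_of_set (root_space L))) (top_of_set (root_space L)) (\<lambda>(g, x). twist_action L g x)"
      using continuous_action_twist by (simp add: continuous_action_def)
    ultimately have "continuous_map (top_of_set (root_space L)) (top_of_set (root_space L)) ((\<lambda>(g, x). twist_action L g x) \<circ> (\<lambda>x. (g, x)))"
      by (rule continuous_map_compose)
    then have "continuous_map (top_of_set (root_space L)) (top_of_set (root_space L)) (twist_action L g)" by (simp add: o_def)
    from openin_continuous_map_preimage[OF this U] show ?thesis by simp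
  qed
  ultimately have "openin (top_of_set (root_space L)) {x \<in> root_space L. base x \<in> base ` U}" by auto
  moreover have "base ` U \<subseteq> L" using UX bi by blast
  ultimately show ?thesis using q unfolding quotient_map_def by simp
qed

text \<open>If the space of valuations were zero-dimensional, a clopen neighbourhood of a point over a that
  misses the fibre over b would have a clopen image in L, because the projection is open and closed; but a and b
  lie in a connected set.\<close>

lemma root_space_not_totally_disconnected:
  assumes L: "compact L" "\<not> totally_disconnected L"
  shows "\<not> totally_disconnected (root_space L)"
proof
  assume ts: "totally_disconnected (root_space L)"
  obtain C a b where C: "connected C" "C \<subseteq> L" "a \<in> C" "b \<in> C" "a \<noteq> b"
    using L(2) unfolding totally_disconnected_def by blast
  obtain v where v: "v \<in> root_space L" "base v = a" using base_surj C by blast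
  define F where "F = root_space L \<inter> base -` {b}"
  have cX: "compact (root_space L)" by (rule compact_root_space[OF L(1)])
  have "closed F"
    unfolding F_def by (rule continuous_closed_preimage[OF continuous_on_base compact_imp_closed[OF cX]]) simp
  then have F: "closed F" "F \<subseteq> root_space L" "v \<notin> F" using v C(5) by (auto simp: F_def)
  obtain U where U: "openin (top_of_set (root_space L)) U" "closedin (top_of_set (root_space L)) U" "v \<in> U" "U \<inter> F = {}"
    using separate_point_closed[OF cX ts v(1) F] by blast
  have UX: "U \<subseteq> root_space L" using U(1) by (rule openin_imp_subset)
  have "compact U"
    using compact_closed_subset[OF cX _ UX] closedin_closed_trans[OF U(2) compact_imp_closed[OF cX]] by blast
  then have "closed (base ` U)" by (intro compact_imp_closed compact_continuous_image continuous_on_base)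
  moreover have "base ` U \<subseteq> L" using UX base_in by blast
  ultimately have "closedin (top_of_set L) (base ` U)" by (intro closed_subset)
  moreover have "openin (top_of_set L) (base ` U)" by (rule openin_base_image[OF L(1) U(1)])
  moreover have "connectedin (top_of_set L) C" using C by (simp add: connectedin_subtopology)
  ultimately have "C \<subseteq> base ` U \<or> disjnt C (base ` U)" by (intro connectedin_clopen_cases)
  moreover have "a \<in> base ` U" using U(3) v(2) by blast
  moreover have "b \<notin> base ` U" using U(4) UX by (auto simp: F_def)
  ultimately show False using C(3,4) by (auto simp: disjnt_iff)
qed

end

theorem theorem1:
  fixes L :: "'a topology" and p :: nat
  assumes "compact_space L" and "metrizable_space L" and "topspace L \<noteq> {}"
    and "prime p"
  shows "\<exists>(G :: (nat \<Rightarrow> real) monoid) (T :: (nat \<Rightarrow> real) topology)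
            (X :: (nat \<Rightarrow> real) topology) (\<phi> :: (nat \<Rightarrow> real) \<Rightarrow> (nat \<Rightarrow> real) \<Rightarrow> (nat \<Rightarrow> real)).
           compact_group G T \<and>
           compact_space X \<and> metrizable_space X \<and>
           cohomological_dim (integer_mod_group p) X = 1 \<and>
           continuous_action G T X \<phi> \<and>
           orbit_space G X \<phi> homeomorphic_space L"
proof -
  interpret root_of_unity_group p
    using assms(4) by unfold_locales (rule prime_ge_2_nat)
  obtain L' :: "(nat \<Rightarrow> real) set" where L': "compact L'" "L homeomorphic_space top_of_set L'"
    using compact_metrizable_embedding[OF assms(1,2)] .
  have ne: "L' \<noteq> {}" using homeomorphic_empty_space[OF L'(2)] assms(3) by auto
  have L'L: "top_of_set L' homeomorphic_space L" using L'(2) by (rule homeomorphic_space_sym[THEN iffD1])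
  have metr: "metrizable_space (top_of_set S)" for S :: "(nat \<Rightarrow> real) set"
    by (rule metrizable_space_subtopology[OF metrizable_space_euclidean])
  show ?thesis
  proof (cases "totally_disconnected L'")
    case True
    let ?X = "circle_prod L'"
    obtain l where l: "l \<in> L'" using ne by blast
    define C where "C = (\<lambda>z. join2 z l) ` sphere 0 1"
    have "connected (sphere (0::complex) 1)" by (rule connected_sphere) simp
    then have "connected C" unfolding C_def by (intro connected_continuous_image continuous_intros)
    moreover have "C \<subseteq> ?X" using l by (auto simp: C_def circle_prod_iff)
    moreover have "join2 1 l \<in> C" "join2 (- 1) l \<in> C" by (auto simp: C_def)
    moreover have "join2 1 l \<noteq> join2 (- 1) l"
    proof
      assume "join2 1 l = join2 (- 1) l"
      from arg_cong[OF this, of cpl] show False by simp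
    qed
    ultimately have "cohomological_dim (integer_mod_group p) (top_of_set ?X) = 1"
      by (rule cohomological_dim_1[OF circle_prod_extends[OF L'(1) True]])
    moreover have "orbit_space circle_group (top_of_set ?X) (rotate2 L') homeomorphic_space L"
      by (rule homeomorphic_space_trans[OF orbit_space_circle_prod[OF L'(1)] L'L])
    moreover have "compact_space (top_of_set ?X)"
      using compact_circle_prod[OF L'(1)] by (intro compact_space_subtopology) simp
    ultimately show ?thesis
      by (intro exI[of _ circle_group] exI[of _ "top_of_set circle_carrier"] exI[of _ "top_of_set ?X"]
          exI[of _ "rotate2 L'"] conjI compact_group_circle continuous_action_rotate2 metr)
  next
    case False
    let ?X = "root_space L'"
    obtain C a b where C: "connected C" "C \<subseteq> ?X" "a \<in> C" "b \<in> C" "a \<noteq> b"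
      using root_space_not_totally_disconnected[OF L'(1) False] unfolding totally_disconnected_def by blast
    have "cohomological_dim (integer_mod_group p) (top_of_set ?X) = 1"
      by (rule cohomological_dim_1[OF has_roots_imp_extends_all_maps[OF compact_root_space[OF L'(1)] has_roots_root_space[OF L'(1)]] C])
    moreover have "orbit_space twist_group (top_of_set ?X) (twist_action L') homeomorphic_space L"
      by (rule homeomorphic_space_trans[OF orbit_space_root_space[OF L'(1)] L'L])
    moreover have "compact_space (top_of_set ?X)"
      using compact_root_space[OF L'(1)] by (intro compact_space_subtopology) simp
    ultimately show ?thesis
      by (intro exI[of _ twist_group] exI[of _ "top_of_set twist_carrier"] exI[of _ "top_of_set ?X"]
          exI[of _ "twist_action L'"] conjI compact_group_twist_group continuous_action_twist metr)
  qed
qed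

end
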